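(* Let $k\ge1$ and let $N_1,N_2,\ldots,N_k$ be integers, all at least $2$, and $\mathbf N=(N_1,\ldots,N_k)$. (i) The radius of convergence of the Taylor series of $\mathbf z_{\mathbf N}(q)$ at $q=0$ is at most $\exp\big(-\pi\cot(\pi/M_{\mathbf N})\big)$. (ii) If $\Phi_{\mathbf N}\ge4$, then the radius of convergence of the Taylor series of $\mathbf z_{\mathbf N}(q)$ at $q=0$ is at most $\mathbf q_{\mathbf N}(1/C_{\mathbf N})$.
   Context: For an integer $N\ge 2$ let $r_1,\ldots,r_{\varphi(N)}$ be the integers in $\{1,\ldots,N\}$ coprime to $N$ ($\varphi$ is Euler's totient), and put $C_N:=N^{\varphi(N)}\prod_{p\mid N}p^{\varphi(N)/(p-1)}$ (product over primes $p$ dividing $N$). With $(\alpha)_m=\alpha(\alpha+1)\cdots(\alpha+m-1)$, $(\alpha)_0=1$, and $H(x,m)=\sum_{n=0}^{m-1}\frac1{x+n}$, define for $m\ge0$ $$\mathbf B_N(m)=C_N^m\prod_{j=1}^{\varphi(N)}\frac{(r_j/N)_m}{m!},\qquad \mathbf H_N(m)=\sum_{j=1}^{\varphi(N)}H(r_j/N,m)-\varphi(N)H(1,m).$$ For $\mathbf N=(N_1,\ldots,N_k)$ put $C_{\mathbf N}=\prod_{j=1}^kC_{N_j}$, $\Phi_{\mathbf N}=\sum_{j=1}^k\varphi(N_j)$, $M_{\mathbf N}=\max(N_1,\ldots,N_k)$, $\mathbf B_{\mathbf N}(m)=\prod_{j=1}^k\mathbf B_{N_j}(m)$, $\mathbf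 H_{\mathbf N}(m)=\sum_{j=1}^k\mathbf H_{N_j}(m)$, and $$\mathbf F_{\mathbf N}(z)=\sum_{m\ge0}\mathbf B_{\mathbf N}(m)z^m,\qquad \mathbf G_{\mathbf N}(z)=\sum_{m\ge1}\mathbf H_{\mathbf N}(m)\mathbf B_{\mathbf N}(m)z^m.$$ The canonical coordinate is the power series $\mathbf q_{\mathbf N}(z)=z\exp\big(\mathbf G_{\mathbf N}(z)/\mathbf F_{\mathbf N}(z)\big)$; its Taylor series at $0$ converges at $z=1/C_{\mathbf N}$, and $\mathbf q_{\mathbf N}(1/C_{\mathbf N})$ denotes its sum there. The mirror map $\mathbf z_{\mathbf N}(q)$ is the compositional inverse of $\mathbf q_{\mathbf N}(z)$ (as power series, with $\mathbf z_{\mathbf N}(0)=0$), which converges in a neighbourhood of $q=0$. *)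

theory Defs
  imports "HOL-Analysis.Analysis" "HOL-Number_Theory.Totient"
begin

text \<open>
  The index tuple of the mirror map is a list \<open>Ns\<close> of natural numbers. For \<open>N \<ge> 2\<close>, the set
  \<^term>\<open>totatives N\<close> consists of the integers in \<open>{1..N}\<close> coprime to \<open>N\<close>.
\<close>

text \<open>The exponent in the following definition is an exact quotient:\<close>

lemma prime_minus_one_dvd_totient:
  assumes "p \<in> prime_factors N"
  shows "(p - 1) dvd totient N"
proof -
  have "prime p" "p dvd N" using assms by auto
  then show ?thesis using totient_dvd[of p N] totient_prime[of p] by simp
qed

definition C1 :: "nat \<Rightarrow> nat" where
  "C1 N = N ^ totient N * (\<Prod>p\<in>prime_factors N. p ^ (totient N div (p - 1)))"

definition harm_shift :: "real \<Rightarrow> nat \<Rightarrow> real" where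
  "harm_shift x m = (\<Sum>n<m. 1 / (x + real n))"

definition B1 :: "nat \<Rightarrow> nat \<Rightarrow> real" where
  "B1 N m = real (C1 N) ^ m * (\<Prod>r\<in>totatives N. pochhammer (real r / real N) m / fact m)"

definition H1 :: "nat \<Rightarrow> nat \<Rightarrow> real" where
  "H1 N m = (\<Sum>r\<in>totatives N. harm_shift (real r / real N) m)
              - real (totient N) * harm_shift 1 m"

definition C_of :: "nat list \<Rightarrow> nat" where
  "C_of Ns = (\<Prod>N\<leftarrow>Ns. C1 N)"

definition Phi_of :: "nat list \<Rightarrow> nat" where
  "Phi_of Ns = (\<Sum>N\<leftarrow>Ns. totient N)"

definition M_of :: "nat list \<Rightarrow> nat" where
  "M_of Ns = Max (set Ns)"

definition B_of :: "nat list \<Rightarrow> nat \<Rightarrow> real" where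
  "B_of Ns m = (\<Prod>N\<leftarrow>Ns. B1 N m)"

definition H_of :: "nat list \<Rightarrow> nat \<Rightarrow> real" where
  "H_of Ns m = (\<Sum>N\<leftarrow>Ns. H1 N m)"

definition F_of :: "nat list \<Rightarrow> real fps" where
  "F_of Ns = Abs_fps (B_of Ns)"

definition G_of :: "nat list \<Rightarrow> real fps" where
  "G_of Ns = Abs_fps (\<lambda>m. if m = 0 then 0 else H_of Ns m * B_of Ns m)"

text \<open>\<open>fps_exp 1 oo f\<close> is the formal exponential of \<open>f\<close>, for \<open>f\<close> without constant term.\<close>

definition canonical_coord :: "nat list \<Rightarrow> real fps" where
  "canonical_coord Ns = fps_X * (fps_exp 1 oo (G_of Ns / F_of Ns))"

definition mirror_map :: "nat list \<Rightarrow> real fps" where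
  "mirror_map Ns = fps_inv (canonical_coord Ns)"

text \<open>
  The side conditions of formal division, composition and compositional inversion are met, so that
  the operations above have their usual meaning.
\<close>

lemma F_of_nth_0 [simp]: "fps_nth (F_of Ns) 0 = 1"
  by (induction Ns) (simp_all add: F_of_def B_of_def B1_def)

lemma G_div_F_nth_0 [simp]: "fps_nth (G_of Ns / F_of Ns) 0 = 0"
  by (simp add: G_of_def fps_divide_unit)

lemma canonical_coord_nth_0 [simp]: "fps_nth (canonical_coord Ns) 0 = 0"
  by (simp add: canonical_coord_def)

lemma canonical_coord_nth_1 [simp]: "fps_nth (canonical_coord Ns) (Suc 0) = 1"
  by (simp add: canonical_coord_def)

lemma mirror_map_nth_0: "fps_nth (mirror_map Ns) 0 = 0"
  by (simp add: mirror_map_def fps_inv_def)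

lemma mirror_map_inverse:
  "mirror_map Ns oo canonical_coord Ns = fps_X"
  "canonical_coord Ns oo mirror_map Ns = fps_X"
  unfolding mirror_map_def by (simp_all add: fps_inv fps_inv_right)

end

theory Submission
  imports Defs "HOL-Complex_Analysis.Complex_Analysis" "HOL-Real_Asymp.Real_Asymp"
begin

text \<open>
  Write \<open>C\<close>, \<open>M\<close>, \<open>\<Phi>\<close> for the constants attached to \<open>Ns\<close>, let the parameters be the fractions \<open>r / N\<close>
  with \<open>r\<close> coprime to \<open>N\<close>, and put \<open>b\<^sub>m = B\<^sub>m / C\<^sup>m\<close>, the product of \<open>(a)\<^sub>m / m!\<close> over all
  parameters \<open>a\<close>. The harmonic sums \<open>H\<^sub>m\<close> increase strictly to \<open>ln C\<close> (\<open>H_of_tendsto\<close>). Both bounds are proved by contradiction: if the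
  mirror map \<open>z(q)\<close> converged in a larger disc, it would continue \<open>z(q(x)) = x\<close> to a place where this is
  impossible.

  For the bound by \<open>exp (- pi cot (pi / M))\<close> the place is \<open>x \<rightarrow> -\<infinity>\<close>. The numbers \<open>b\<^sub>m\<close> are the moments of
  a probability law on the unit interval, the law of a product of independent Beta variables, and the
  moments of \<open>ln t\<close> are \<open>b\<^sub>m (H\<^sub>m - ln C)\<close>. Therefore
  \<open>F(-x) = \<integral> 1 / (1 + Cxt)\<close> and \<open>q(-x) = - exp (E)\<close>, where \<open>E\<close> is the average of \<open>ln (Cxt)\<close> with weight
  \<open>1 / (1 + Cxt)\<close>. This continues \<open>q\<close> to the whole negative axis. The claim \<open>E \<le> - pi cot (pi / M)\<close> is
  stable under multiplication by a further independent factor (\<open>log_mean_le_mconv\<close>), so that only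
  the two parameters \<open>a = 1 / M\<close> and \<open>1 - a\<close> matter. For these two the law has density \<open>t\<^bsup>a-1\<^esup> k(t)\<close> with \<open>k\<close>
  nonincreasing, whereas for the weight \<open>t\<^bsup>a-1\<^esup> dt\<close> on the whole half-line the average is exactly
  \<open>Digamma a - Digamma (1 - a) = - pi cot (pi a)\<close>; a nonincreasing factor can only lower it
  (\<open>log_mean_le_pair\<close>). Now \<open>\<bar>q(-x)\<bar>\<close> stays below the claimed radius for all \<open>x > 0\<close>. A mirror map
  converging in a larger disc would be bounded there, but its value at \<open>q(-x)\<close> is \<open>-x\<close>
  (\<open>conv_radius_mirror_le_of_log_mean\<close>). The two parameters are present unless \<open>Ns = [2]\<close>, where
  \<open>z = q / (1 + q)\<^sup>2\<close> has a pole at \<open>q = -1\<close>.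

  For the bound by \<open>q(1 / C)\<close> the place is \<open>x\<^sub>0 = 1 / C\<close>. By Kaluza's argument the log-convexity of \<open>b\<^sub>m\<close>
  and the monotonicity of \<open>H\<^sub>m\<close> make the coefficients of \<open>h = G / F\<close> nonnegative, so \<open>q = x exp h\<close> has
  nonnegative coefficients as well and converges at \<open>x\<^sub>0\<close>. Let \<open>z\<close> be holomorphic at \<open>q\<^sub>0 = q(x\<^sub>0)\<close>. If
  \<open>z'(q\<^sub>0) = 0\<close>, then \<open>x\<^sub>0 - x\<close> is at most of the order of \<open>(q\<^sub>0 - q(x))\<^sup>2\<close>; but \<open>\<Phi> \<ge> 4\<close> gives \<open>b\<^sub>m \<le> m\<^sup>-\<^sup>2\<close>, whence
  \<open>q\<^sub>0 - q(x)\<close> is of order at most \<open>(x\<^sub>0 - x)\<^bsup>3/4\<^esup>\<close>. If \<open>z'(q\<^sub>0) \<noteq> 0\<close>, then \<open>q\<close> and hence \<open>h\<close> continue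
  holomorphically to a neighbourhood of \<open>x\<^sub>0\<close>, so by the theorem of Vivanti and Pringsheim \<open>h\<close> has a
  radius of convergence larger than \<open>x\<^sub>0\<close>. Comparing coefficients in \<open>G = h F\<close> and dividing by those of
  \<open>F\<close> then yields \<open>H\<^sub>m \<rightarrow> h(x\<^sub>0)\<close> (\<open>convolution_quotient_tendsto\<close>), that is \<open>G(x\<^sub>0) = ln C F(x\<^sub>0)\<close>. This
  contradicts \<open>H\<^sub>m < ln C\<close>.
\<close>

section \<open>The limit of the harmonic sums\<close>

definition coprime_harm :: "nat set \<Rightarrow> nat \<Rightarrow> real" where
  "coprime_harm P n = (\<Sum>k | k \<in> {1..n} \<and> (\<forall>p\<in>P. \<not> p dvd k). 1 / real k)"

text \<open>
  Sieving out one more prime removes the multiples of \<open>p\<close>, and these form a copy of the old index set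
  scaled by \<open>p\<close>.
\<close>

lemma coprime_harm_insert:
  assumes "prime p" "p \<notin> P" "\<And>q. q \<in> P \<Longrightarrow> prime q"
  shows "coprime_harm (insert p P) (p * n) = coprime_harm P (p * n) - coprime_harm P n / real p"
proof -
  let ?S = "\<lambda>P n. {k. k \<in> {1..n} \<and> (\<forall>p\<in>P. \<not> p dvd k)}"
  have p0: "p > 0" using assms(1) prime_gt_0_nat by blast
  have np: "q dvd p * k \<longleftrightarrow> q dvd k" if "q \<in> P" for q k
    using assms that by (metis primes_dvd_imp_eq prime_dvd_mult_iff)
  have eq: "?S P (p * n) = ?S (insert p P) (p * n) \<union> (\<lambda>k. p * k) ` ?S P n" (is "?L = ?R")
  proof
    show "?L \<subseteq> ?R"
    proof
      fix k assume k: "k \<in> ?L"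
      show "k \<in> ?R"
      proof (cases "p dvd k")
        case True
        then obtain j where j: "k = p * j" by auto
        have "j \<in> ?S P n" using k j np p0 by auto
        then show ?thesis using j by blast
      qed (use k in auto)
    qed
    show "?R \<subseteq> ?L" using np p0 by auto
  qed
  have disj: "?S (insert p P) (p * n) \<inter> (\<lambda>k. p * k) ` ?S P n = {}" by auto
  have "coprime_harm P (p * n) = coprime_harm (insert p P) (p * n)
          + (\<Sum>k\<in>(\<lambda>k. p * k) ` ?S P n. 1 / real k)"
    unfolding coprime_harm_def by (subst eq, subst sum.union_disjoint) (use disj in auto)
  also have "(\<Sum>k\<in>(\<lambda>k. p * k) ` ?S P n. 1 / real k) = coprime_harm P n / real p"
    unfolding coprime_harm_def
    by (subst sum.reindex) (use p0 in \<open>auto simp: inj_on_def sum_divide_distrib mult.commute\<close>)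
  finally show ?thesis by simp
qed

text \<open>
  Each prime \<open>p\<close> turns the main term \<open>A (ln x + c)\<close> into \<open>A (ln x + c) - A / p (ln x - ln p + c)\<close>, which is
  \<open>A (1 - 1 / p) (ln x + c + ln p / (p - 1))\<close>. Restricting \<open>x\<close> to multiples of \<open>D\<close> keeps all arguments
  integral.
\<close>

lemma coprime_harm_asymp:
  assumes "finite P" "\<And>q. q \<in> P \<Longrightarrow> prime q" "D > 0" "\<Prod>P dvd D"
  shows "(\<lambda>m. coprime_harm P (D * m) - (\<Prod>p\<in>P. 1 - 1 / real p) * ln (real (D * m)))
           \<longlonglongrightarrow> (\<Prod>p\<in>P. 1 - 1 / real p) * (euler_mascheroni + (\<Sum>p\<in>P. ln (real p) / (real p - 1)))"
  using assms
proof (induction P arbitrary: D rule: finite_induct)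
  case empty
  have eq: "coprime_harm {} n = harm n" for n
    unfolding coprime_harm_def harm_def by (intro sum.cong) (auto simp: divide_inverse)
  have "(\<lambda>m. harm (D * m) - ln (real (D * m))) \<longlonglongrightarrow> (euler_mascheroni :: real)"
    by (rule filterlim_compose[OF euler_mascheroni_LIMSEQ])
       (use empty in \<open>auto intro!: filterlim_subseq strict_monoI\<close>)
  then show ?case by (simp add: eq)
next
  case (insert p P)
  define A where "A = (\<Prod>p\<in>P. 1 - 1 / real p)"
  define S where "S = (\<Sum>p\<in>P. ln (real p) / (real p - 1))"
  have p: "prime p" and P: "\<And>q. q \<in> P \<Longrightarrow> prime q" using insert.prems by auto
  have p1: "p > 1" using p prime_gt_1_nat by blast
  have "p * \<Prod>P dvd D" using insert.prems(3) insert.hyps by simp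
  then obtain E where E: "D = (p * \<Prod>P) * E" by auto
  define D' where "D' = \<Prod>P * E"
  have D: "D = p * D'" using E by (simp add: D'_def)
  have D: "D = p * D'" "D' > 0" "\<Prod>P dvd D'" "\<Prod>P dvd D"
    using insert.prems(2) by (simp_all add: D) (simp_all add: D'_def)
  have 1: "(\<lambda>m. coprime_harm P (D * m) - A * ln (real (D * m))) \<longlonglongrightarrow> A * (euler_mascheroni + S)"
    using insert.IH[OF P insert.prems(2) D(4)] unfolding A_def S_def by simp
  have 2: "(\<lambda>m. coprime_harm P (D' * m) - A * ln (real (D' * m))) \<longlonglongrightarrow> A * (euler_mascheroni + S)"
    using insert.IH[OF P D(2,3)] unfolding A_def S_def by simp
  let ?f = "\<lambda>m. (coprime_harm P (D * m) - A * ln (real (D * m)))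
          - (1 / real p) * (coprime_harm P (D' * m) - A * ln (real (D' * m))) + A / real p * ln (real p)"
  have "?f
        \<longlonglongrightarrow> A * (euler_mascheroni + S) - (1 / real p) * (A * (euler_mascheroni + S)) + A / real p * ln (real p)"
    by (intro tendsto_intros 1 2)
  also have "A * (euler_mascheroni + S) - (1 / real p) * (A * (euler_mascheroni + S)) + A / real p * ln (real p)
     = ((1 - 1 / real p) * A) * (euler_mascheroni + (ln (real p) / (real p - 1) + S))"
  proof -
    have *: "(1 - 1 / real p) * (ln (real p) / (real p - 1)) = ln (real p) / real p"
      using p1 by (simp add: divide_simps)
    have "((1 - 1 / real p) * A) * (euler_mascheroni + (ln (real p) / (real p - 1) + S))
        = (1 - 1 / real p) * A * (euler_mascheroni + S)
          + A * ((1 - 1 / real p) * (ln (real p) / (real p - 1)))"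
      by (simp only: ring_distribs mult_ac add_ac)
    also have "\<dots> = A * (euler_mascheroni + S) - (1 / real p) * (A * (euler_mascheroni + S)) + A / real p * ln (real p)"
      unfolding * by (simp add: ring_distribs)
    finally show ?thesis ..
  qed
  finally have lim: "?f
        \<longlonglongrightarrow> ((1 - 1 / real p) * A) * (euler_mascheroni + (ln (real p) / (real p - 1) + S))" .
  have ev: "\<forall>\<^sub>F m in sequentially. ?f m
      = coprime_harm (insert p P) (D * m) - ((1 - 1 / real p) * A) * ln (real (D * m))"
    using eventually_gt_at_top[of 0]
  proof eventually_elim
    case (elim m)
    have "ln (real (D * m)) = ln (real p) + ln (real (D' * m))"
      using D(2) p1 elim unfolding D(1) by (simp add: ln_mult)
    moreover have "coprime_harm (insert p P) (D * m) = coprime_harm P (D * m) - coprime_harm P (D' * m) / real p"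
      using coprime_harm_insert[OF p insert.hyps(2) P, of "D' * m"] unfolding D(1) by (simp add: mult.assoc)
    ultimately show ?case by (simp add: algebra_simps)
  qed
  have "(\<lambda>m. coprime_harm (insert p P) (D * m) - ((1 - 1 / real p) * A) * ln (real (D * m)))
        \<longlonglongrightarrow> ((1 - 1 / real p) * A) * (euler_mascheroni + (ln (real p) / (real p - 1) + S))"
    by (rule Lim_transform_eventually[OF lim ev])
  then show ?case using insert.hyps unfolding A_def S_def by simp
qed

lemma coprime_iff_prime_factors:
  assumes "N > (0::nat)"
  shows "coprime k N \<longleftrightarrow> (\<forall>p\<in>prime_factors N. \<not> p dvd k)"
proof
  assume *: "coprime k N"
  show "\<forall>p\<in>prime_factors N. \<not> p dvd k"
  proof (intro ballI notI)
    fix p assume p: "p \<in> prime_factors N" "p dvd k"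
    then have "is_unit p" using coprime_common_divisor[OF *, of p] by (simp add: in_prime_factors_iff)
    then show False using p by (simp add: in_prime_factors_iff)
  qed
next
  assume *: "\<forall>p\<in>prime_factors N. \<not> p dvd k"
  show "coprime k N"
  proof (rule ccontr)
    assume "\<not> coprime k N"
    then have "gcd k N \<noteq> 1" by (simp add: coprime_iff_gcd_eq_1)
    then obtain p where "prime p" "p dvd gcd k N" using prime_factor_nat by blast
    then show False using * assms by (auto simp: in_prime_factors_iff)
  qed
qed

lemma coprime_add_mult_iff: "coprime (r + N * m) N \<longleftrightarrow> coprime r (N::nat)"
proof -
  have "gcd (r + N * m) N = gcd r N"
    using gcd_add_mult[of N m r] by (metis gcd.commute add.commute mult.commute)
  then show ?thesis by (simp only: coprime_iff_gcd_eq_1)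
qed

text \<open>
  The integers up to \<open>N m\<close> that are coprime to \<open>N\<close> are the \<open>r + N n\<close> with \<open>r\<close> a totative and \<open>n < m\<close>.
\<close>

lemma sum_harm_shift_totatives:
  assumes "N \<ge> 2"
  shows "(\<Sum>r\<in>totatives N. harm_shift (real r / real N) m)
           = real N * coprime_harm (prime_factors N) (N * m)"
proof (induction m)
  case 0
  then show ?case by (simp add: harm_shift_def coprime_harm_def)
next
  case (Suc m)
  have N: "N > 0" using assms by simp
  let ?S = "\<lambda>n. {k. k \<in> {1..n} \<and> (\<forall>p\<in>prime_factors N. \<not> p dvd k)}"
  have inj: "inj_on (\<lambda>r. r + N * m) (totatives N)" by (auto simp: inj_on_def)
  have eq: "?S (N * Suc m) = ?S (N * m) \<union> (\<lambda>r. r + N * m) ` totatives N" (is "?L = ?R")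
  proof
    show "?R \<subseteq> ?L"
    proof
      fix k assume "k \<in> ?R"
      then consider "k \<in> ?S (N * m)" | r where "r \<in> totatives N" "k = r + N * m" by blast
      then show "k \<in> ?L"
      proof cases
        case 1
        then show ?thesis by auto
      next
        case 2
        then have "coprime k N" "1 \<le> k" "k \<le> N * Suc m"
          using coprime_add_mult_iff by (auto simp: in_totatives_iff)
        then show ?thesis by (simp add: coprime_iff_prime_factors[OF N])
      qed
    qed
  next
    show "?L \<subseteq> ?R"
    proof
      fix k assume k: "k \<in> ?L"
      show "k \<in> ?R"
      proof (cases "k \<le> N * m")
        case False
        then obtain r where r: "k = r + N * m" "r > 0"
          by (metis less_imp_add_positive not_le add.commute)
        have "coprime (r + N * m) N" using k unfolding r coprime_iff_prime_factors[OF N] by blast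
        then have "coprime r N" by (simp only: coprime_add_mult_iff)
        then have "r \<in> totatives N" using k r by (auto simp: in_totatives_iff)
        then show ?thesis using r by blast
      qed (use k in auto)
    qed
  qed
  have disj: "?S (N * m) \<inter> (\<lambda>r. r + N * m) ` totatives N = {}"
    by (auto simp: in_totatives_iff)
  have "coprime_harm (prime_factors N) (N * Suc m) = coprime_harm (prime_factors N) (N * m)
     + (\<Sum>k\<in>(\<lambda>r. r + N * m) ` totatives N. 1 / real k)"
    unfolding coprime_harm_def by (subst eq, subst sum.union_disjoint) (use disj in auto)
  also have "(\<Sum>k\<in>(\<lambda>r. r + N * m) ` totatives N. 1 / real k)
      = (\<Sum>r\<in>totatives N. 1 / (real r + real N * real m))"
    by (subst sum.reindex[OF inj]) simp
  finally have "real N * coprime_harm (prime_factors N) (N * Suc m)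
      = real N * coprime_harm (prime_factors N) (N * m)
        + (\<Sum>r\<in>totatives N. real N / (real r + real N * real m))"
    by (simp add: algebra_simps sum_distrib_left)
  also have "(\<Sum>r\<in>totatives N. real N / (real r + real N * real m))
       = (\<Sum>r\<in>totatives N. 1 / (real r / real N + real m))"
    using N by (intro sum.cong refl) (simp add: divide_simps mult.commute)
  finally show ?case using Suc by (simp add: harm_shift_def sum.distrib)
qed

lemma ln_C1:
  assumes "N \<ge> 2"
  shows "ln (real (C1 N)) = real (totient N) * (ln (real N) + (\<Sum>p\<in>prime_factors N. ln (real p) / (real p - 1)))"
proof -
  have pos: "p > 1" "p > 0" if "p \<in> prime_factors N" for p
    using that prime_gt_1_nat prime_gt_0_nat by auto
  have "ln (real (C1 N)) = ln (real N ^ totient N) + ln (\<Prod>p\<in>prime_factors N. real p ^ (totient N div (p - 1)))"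
    unfolding C1_def of_nat_mult of_nat_power of_nat_prod
    using pos assms by (intro ln_mult_pos prod_pos) auto
  also have "ln (\<Prod>p\<in>prime_factors N. real p ^ (totient N div (p - 1)))
       = (\<Sum>p\<in>prime_factors N. ln (real p ^ (totient N div (p - 1))))"
    using pos by (intro ln_prod) auto
  also have "\<dots> = (\<Sum>p\<in>prime_factors N. real (totient N) * (ln (real p) / (real p - 1)))"
  proof (intro sum.cong refl)
    fix p assume p: "p \<in> prime_factors N"
    have "real (totient N div (p - 1)) = real (totient N) / real (p - 1)"
      using prime_minus_one_dvd_totient[OF p] by (simp add: real_of_nat_div)
    then show "ln (real p ^ (totient N div (p - 1))) = real (totient N) * (ln (real p) / (real p - 1))"
      using pos(1)[OF p] by (simp add: ln_realpow of_nat_diff)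
  qed
  finally show ?thesis using assms by (simp add: ln_realpow algebra_simps sum_distrib_left)
qed

text \<open>
  This is where the arithmetic form of the constant \<open>C\<^sub>N\<close> enters: its logarithm is exactly the
  logarithm and the prime sum in the asymptotics of the harmonic sums over integers coprime to \<open>N\<close>.
\<close>

lemma H1_tendsto:
  assumes "N \<ge> 2"
  shows "H1 N \<longlonglongrightarrow> ln (real (C1 N))"
proof -
  define A where "A = (\<Prod>p\<in>prime_factors N. 1 - 1 / real p)"
  define S where "S = (\<Sum>p\<in>prime_factors N. ln (real p) / (real p - 1))"
  have tot: "real (totient N) = real N * A" unfolding A_def by (rule totient_formula2)
  have "\<Prod>(prime_factors N) dvd N"
  proof -
    have "(\<Prod>p\<in>prime_factors N. p) dvd (\<Prod>p\<in>prime_factors N. p ^ multiplicity p N)"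
      by (intro prod_dvd_prod) (auto simp: prime_factors_multiplicity intro!: dvd_power)
    also have "\<dots> = N" using assms prime_factorization_nat[of N] by simp
    finally show ?thesis by simp
  qed
  then have 1: "(\<lambda>m. coprime_harm (prime_factors N) (N * m) - A * ln (real (N * m)))
      \<longlonglongrightarrow> A * (euler_mascheroni + S)"
    unfolding A_def S_def using assms by (intro coprime_harm_asymp) auto
  have "(\<lambda>m. real N * (coprime_harm (prime_factors N) (N * m) - A * ln (real (N * m)))
           - real (totient N) * (harm m - ln (real m)) + real (totient N) * ln (real N))
     \<longlonglongrightarrow> real N * (A * (euler_mascheroni + S)) - real (totient N) * euler_mascheroni
           + real (totient N) * ln (real N)"
    by (intro tendsto_intros 1 euler_mascheroni_LIMSEQ)
  also have "real N * (A * (euler_mascheroni + S)) - real (totient N) * euler_mascheroni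
           + real (totient N) * ln (real N) = ln (real (C1 N))"
    unfolding ln_C1[OF assms] S_def[symmetric] tot by (simp add: algebra_simps)
  finally have lim: "(\<lambda>m. real N * (coprime_harm (prime_factors N) (N * m) - A * ln (real (N * m)))
           - real (totient N) * (harm m - ln (real m)) + real (totient N) * ln (real N))
     \<longlonglongrightarrow> ln (real (C1 N))" .
  have h1: "harm_shift 1 m = harm m" for m
    unfolding harm_shift_def harm_def
    by (subst sum.atLeast_Suc_atMost_Suc_shift[of _ 0, simplified, symmetric] | 
        simp add: sum.atLeast1_atMost_eq lessThan_atLeast0 divide_inverse add.commute)+
  have "\<forall>\<^sub>F m in sequentially. real N * (coprime_harm (prime_factors N) (N * m) - A * ln (real (N * m)))
           - real (totient N) * (harm m - ln (real m)) + real (totient N) * ln (real N) = H1 N m"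
    using eventually_gt_at_top[of 0]
  proof eventually_elim
    case (elim m)
    then show ?case unfolding H1_def sum_harm_shift_totatives[OF assms] h1 tot
      using assms by (simp add: ln_mult algebra_simps)
  qed
  then show ?thesis by (rule Lim_transform_eventually[OF lim])
qed

lemma C1_pos: "N \<ge> 2 \<Longrightarrow> C1 N > 0"
  unfolding C1_def by (auto intro!: prod_pos prime_gt_0_nat)

lemma H_of_tendsto:
  assumes "\<And>N. N \<in> set Ns \<Longrightarrow> N \<ge> 2"
  shows "C_of Ns > 0" "H_of Ns \<longlonglongrightarrow> ln (real (C_of Ns))"
proof -
  have "C_of Ns > 0 \<and> H_of Ns \<longlonglongrightarrow> ln (real (C_of Ns))" using assms
  proof (induction Ns)
    case Nil
    then show ?case by (simp add: C_of_def H_of_def)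
  next
    case (Cons N Ns)
    have "H_of (N # Ns) = (\<lambda>m. H1 N m + H_of Ns m)" by (auto simp: H_of_def)
    moreover have "C_of (N # Ns) = C1 N * C_of Ns" by (simp add: C_of_def)
    ultimately show ?case using Cons C1_pos[of N] H1_tendsto[of N]
      by (auto simp: ln_mult intro!: tendsto_add)
  qed
  then show "C_of Ns > 0" "H_of Ns \<longlonglongrightarrow> ln (real (C_of Ns))" by auto
qed

section \<open>Hypergeometric coefficients\<close>

text \<open>
  The parameters \<open>r / N\<close> are kept as a multiset, so that results can be proved by induction on it
  and two chosen parameters can be moved to the front.
\<close>

definition params :: "nat list \<Rightarrow> real multiset" where
  "params Ns = (\<Sum>N\<leftarrow>Ns. image_mset (\<lambda>r. real r / real N) (mset_set (totatives N)))"

definition bcoef :: "real multiset \<Rightarrow> nat \<Rightarrow> real" where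
  "bcoef A m = (\<Prod>a\<in>#A. pochhammer a m / fact m)"

definition hcoef :: "real multiset \<Rightarrow> nat \<Rightarrow> real" where
  "hcoef A m = (\<Sum>a\<in>#A. harm_shift a m - harm_shift 1 m)"

lemma params_Cons:
  "params (N # Ns) = image_mset (\<lambda>r. real r / real N) (mset_set (totatives N)) + params Ns"
  by (simp add: params_def)

lemma B_of_eq_bcoef: "B_of Ns m = real (C_of Ns) ^ m * bcoef (params Ns) m"
proof (induction Ns)
  case Nil
  then show ?case by (simp add: B_of_def C_of_def bcoef_def params_def)
next
  case (Cons N Ns)
  have "B1 N m = real (C1 N) ^ m * bcoef (image_mset (\<lambda>r. real r / real N) (mset_set (totatives N))) m"
    by (simp add: B1_def bcoef_def prod_unfold_prod_mset image_mset.compositionality o_def)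
  moreover have "bcoef (params (N # Ns)) m
      = bcoef (image_mset (\<lambda>r. real r / real N) (mset_set (totatives N))) m * bcoef (params Ns) m"
    by (simp add: bcoef_def params_Cons)
  ultimately show ?case using Cons
    by (simp add: B_of_def C_of_def power_mult_distrib)
qed

lemma H_of_eq_hcoef: "H_of Ns m = hcoef (params Ns) m"
proof (induction Ns)
  case Nil
  then show ?case by (simp add: H_of_def hcoef_def params_def)
next
  case (Cons N Ns)
  have "H1 N m = hcoef (image_mset (\<lambda>r. real r / real N) (mset_set (totatives N))) m"
    by (simp add: H1_def hcoef_def sum_unfold_sum_mset[symmetric] image_mset.compositionality o_def
          sum_subtractf totient_def)
  moreover have "hcoef (params (N # Ns)) m
      = hcoef (image_mset (\<lambda>r. real r / real N) (mset_set (totatives N))) m + hcoef (params Ns) m"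
    by (simp add: hcoef_def params_Cons)
  ultimately show ?case using Cons by (simp add: H_of_def)
qed

lemma size_params: "size (params Ns) = Phi_of Ns"
  by (induction Ns) (simp_all add: params_Cons Phi_of_def totient_def, simp add: params_def)

lemma params_range:
  assumes "\<And>N. N \<in> set Ns \<Longrightarrow> N \<ge> 2" "a \<in># params Ns"
  shows "1 / real (M_of Ns) \<le> a" "a < 1"
proof -
  have "\<exists>N\<in>set Ns. \<exists>r\<in>totatives N. a = real r / real N"
    using assms(2) by (induction Ns) (auto simp: params_Cons, simp add: params_def)
  then obtain N r where N: "N \<in> set Ns" "r \<in> totatives N" "a = real r / real N" by blast
  have N2: "N \<ge> 2" using N assms by blast
  have "N \<le> M_of Ns" unfolding M_of_def using N by simp
  then have "1 / real (M_of Ns) \<le> 1 / real N" using N2 by (simp add: frac_le)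
  also have "1 / real N \<le> a" using N by (auto simp: in_totatives_iff divide_right_mono)
  finally show "1 / real (M_of Ns) \<le> a" .
  show "a < 1" using N N2 totatives_less[of r N] by simp
qed

text \<open>
  If \<open>r\<close> is coprime to \<open>N\<close>, then so is \<open>N - r\<close>.
\<close>

lemma params_reflect:
  assumes "\<And>N. N \<in> set Ns \<Longrightarrow> N \<ge> 2"
  shows "image_mset (\<lambda>a. 1 - a) (params Ns) = params Ns"
  using assms
proof (induction Ns)
  case Nil
  then show ?case by (simp add: params_def)
next
  case (Cons N Ns)
  then have N: "N \<ge> 2" by simp
  have cop: "coprime (N - r) N" if "r \<le> N" "coprime r N" for r
    using that by (metis coprime_diff_one_left_nat coprime_iff_gcd_eq_1 gcd.commute gcd_diff2_nat)
  have img: "(\<lambda>r. N - r) ` totatives N = totatives N"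
  proof -
    have sub: "(\<lambda>r. N - r) ` totatives N \<subseteq> totatives N"
    proof
      fix k assume "k \<in> (\<lambda>r. N - r) ` totatives N"
      then obtain r where r: "r \<in> totatives N" "k = N - r" by blast
      have "r < N" using totatives_less[of r N] r N by simp
      then show "k \<in> totatives N" using r cop by (auto simp: in_totatives_iff)
    qed
    moreover have "totatives N \<subseteq> (\<lambda>r. N - r) ` totatives N"
    proof
      fix k assume k: "k \<in> totatives N"
      then have "N - k \<in> totatives N" using sub by blast
      moreover have "k = N - (N - k)" using totatives_le[OF k] by simp
      ultimately show "k \<in> (\<lambda>r. N - r) ` totatives N" by blast
    qed
    ultimately show ?thesis by blast
  qed
  have inj: "inj_on (\<lambda>r. N - r) (totatives N)"
    using totatives_le by (auto simp: inj_on_def) (metis diff_diff_cancel)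
  have "image_mset (\<lambda>a. 1 - a) (image_mset (\<lambda>r. real r / real N) (mset_set (totatives N)))
      = image_mset (\<lambda>r. real (N - r) / real N) (mset_set (totatives N))"
    unfolding image_mset.compositionality o_def using N totatives_le
    by (intro image_mset_cong) (auto simp: of_nat_diff divide_simps)
  also have "\<dots> = image_mset (\<lambda>r. real r / real N) (image_mset (\<lambda>r. N - r) (mset_set (totatives N)))"
    by (simp add: image_mset.compositionality o_def)
  also have "image_mset (\<lambda>r. N - r) (mset_set (totatives N)) = mset_set (totatives N)"
    using image_mset_mset_set[OF inj] img by simp
  finally show ?case using Cons by (simp add: params_Cons)
qed

lemma bcoef_0 [simp]: "bcoef A 0 = 1" by (simp add: bcoef_def)

lemma hcoef_0 [simp]: "hcoef A 0 = 0" by (simp add: hcoef_def harm_shift_def)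

lemma bcoef_pos: "(\<And>a. a \<in># A \<Longrightarrow> a > 0) \<Longrightarrow> bcoef A m > 0"
  unfolding bcoef_def by (induction A) (auto intro!: divide_pos_pos mult_pos_pos pochhammer_pos)

text \<open>
  The quotient of two consecutive coefficients; its monotonicity in \<open>m\<close> is the log-convexity of the
  sequence of coefficients.
\<close>

definition bratio :: "real multiset \<Rightarrow> nat \<Rightarrow> real" where
  "bratio A m = (\<Prod>a\<in>#A. (a + real m) / (1 + real m))"

lemma bcoef_Suc: "bcoef A (Suc m) = bcoef A m * bratio A m"
  unfolding bcoef_def bratio_def
  by (induction A) (auto simp: pochhammer_Suc field_simps)

lemma bratio_pos: "(\<And>a. a \<in># A \<Longrightarrow> a > 0) \<Longrightarrow> bratio A m > 0"
  unfolding bratio_def by (induction A) (auto intro!: divide_pos_pos mult_pos_pos add_pos_nonneg)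

lemma bratio_mono:
  assumes "\<And>a. a \<in># A \<Longrightarrow> 0 < a \<and> a < 1"
  shows "bratio A m \<le> bratio A (Suc m)"
  using assms
proof (induction A)
  case (add a A)
  have "(a + real m) / (1 + real m) \<le> (a + real (Suc m)) / (1 + real (Suc m))"
    using add.prems[of a] by (simp add: divide_simps) (simp add: algebra_simps)
  moreover have "bratio A m \<le> bratio A (Suc m)" "bratio A m > 0"
    using add by (auto intro: bratio_pos)
  moreover have "0 \<le> (a + real (Suc m)) / (1 + real (Suc m))"
    using add.prems[of a] by simp
  ultimately have "(a + real m) / (1 + real m) * bratio A m
      \<le> (a + real (Suc m)) / (1 + real (Suc m)) * bratio A (Suc m)"
    by (intro mult_mono) auto
  then show ?case by (simp add: bratio_def)
qed (simp add: bratio_def)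

lemma bratio_tendsto: "bratio A \<longlonglongrightarrow> 1"
proof (induction A)
  case (add a A)
  have "(\<lambda>m. (a + real m) / (1 + real m)) \<longlonglongrightarrow> 1" by real_asymp
  from tendsto_mult[OF this add.IH] show ?case by (simp add: bratio_def)
qed (simp add: bratio_def)

lemma hcoef_strict_mono:
  assumes "\<And>a. a \<in># A \<Longrightarrow> 0 < a \<and> a < 1" "A \<noteq> {#}"
  shows "strict_mono (hcoef A)"
proof (rule strict_mono_Suc_iff[THEN iffD2], intro allI)
  fix m
  have "hcoef A (Suc m) - hcoef A m = (\<Sum>a\<in>#A. 1 / (a + real m) - 1 / (1 + real m))"
    unfolding hcoef_def by (induction A) (auto simp: harm_shift_def)
  moreover have "(\<Sum>a\<in>#A. 1 / (a + real m) - 1 / (1 + real m)) > 0"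
  proof -
    obtain a A' where A: "A = add_mset a A'" using assms(2) by (cases A) auto
    have pos: "1 / (a + real m) - 1 / (1 + real m) > 0" if "a \<in># A" for a
      using assms(1)[OF that] by (simp add: frac_less2)
    have *: "\<forall>a\<in>#A'. 0 \<le> f a \<Longrightarrow> 0 \<le> (\<Sum>a\<in>#A'. f a)" for f :: "real \<Rightarrow> real"
      by (induction A') auto
    have "\<forall>a\<in>#A'. 0 \<le> 1 / (a + real m) - 1 / (1 + real m)"
      using pos by (intro ballI less_imp_le) (simp add: A)
    then have "(\<Sum>a\<in>#A'. 1 / (a + real m) - 1 / (1 + real m)) \<ge> 0" by (rule *)
    then show ?thesis using pos[of a] by (simp add: A)
  qed
  ultimately show "hcoef A m < hcoef A (Suc m)" by simp
qed

text \<open>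
  Factorwise, \<open>(a + m) (1 - a + m) \<le> (1 / 2 + m)\<^sup>2\<close> by the inequality of the means.
\<close>

lemma pochhammer_reflect_le:
  assumes "0 < a" "a < (1::real)"
  shows "pochhammer a m * pochhammer (1 - a) m \<le> pochhammer (1 / 2) m ^ 2"
proof (induction m)
  case (Suc m)
  have "(a + real m) * (1 - a + real m) \<le> (1 / 2 + real m) ^ 2"
    using zero_le_power2[of "a - 1 / 2"] by (simp add: power2_eq_square algebra_simps)
  then have "(pochhammer a m * pochhammer (1 - a) m) * ((a + real m) * (1 - a + real m))
      \<le> pochhammer (1 / 2) m ^ 2 * (1 / 2 + real m) ^ 2"
    using Suc assms by (intro mult_mono) (auto intro!: mult_nonneg_nonneg pochhammer_nonneg)
  then show ?case by (simp add: pochhammer_Suc power_mult_distrib mult_ac)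
qed simp

lemma pochhammer_half_le: "(pochhammer (1 / 2) m / fact m :: real) ^ 2 \<le> 1 / (2 * real m + 1)"
proof (induction m)
  case (Suc m)
  have "(pochhammer (1 / 2) (Suc m) / fact (Suc m) :: real) ^ 2
     = (pochhammer (1 / 2) m / fact m) ^ 2 * ((1 / 2 + real m) / (1 + real m)) ^ 2"
    by (simp add: pochhammer_Suc power_mult_distrib power_divide)
  also have "\<dots> \<le> 1 / (2 * real m + 1) * ((1 / 2 + real m) / (1 + real m)) ^ 2"
    using Suc by (intro mult_right_mono) auto
  also have "\<dots> \<le> 1 / (2 * real (Suc m) + 1)"
  proof -
    have "(1 + real m * 2) ^ 2 * (3 + 2 * real m) \<le> (1 + 2 * real m) * (2 + 2 * real m) ^ 2"
      by (simp add: power2_eq_square algebra_simps)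
    then show ?thesis by (simp add: divide_simps power_divide add_ac)
  qed
  finally show ?case .
qed simp

lemma bcoef_mult_reflect:
  assumes "\<And>a. a \<in># A \<Longrightarrow> 0 < a \<and> a < 1"
  shows "bcoef A m * bcoef (image_mset (\<lambda>a. 1 - a) A) m \<le> (1 / (2 * real m + 1)) ^ size A"
  using assms
proof (induction A)
  case (add a A)
  have a: "0 < a" "a < 1" using add.prems by auto
  have "pochhammer a m / fact m * (pochhammer (1 - a) m / fact m) \<le> (pochhammer (1 / 2) m / fact m) ^ 2"
    using pochhammer_reflect_le[OF a, of m]
    by (simp add: power_divide power2_eq_square divide_right_mono)
  also note pochhammer_half_le
  finally have 1: "pochhammer a m / fact m * (pochhammer (1 - a) m / fact m) \<le> 1 / (2 * real m + 1)" .
  have pos: "bcoef A m > 0" "bcoef (image_mset (\<lambda>a. 1 - a) A) m > 0"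
    using add.prems by (auto intro!: bcoef_pos)
  have "(pochhammer a m / fact m * (pochhammer (1 - a) m / fact m))
          * (bcoef A m * bcoef (image_mset (\<lambda>a. 1 - a) A) m)
      \<le> 1 / (2 * real m + 1) * (1 / (2 * real m + 1)) ^ size A"
    using add pos by (intro mult_mono 1) auto
  then show ?case by (simp add: bcoef_def mult_ac)
qed (simp add: bcoef_def)

text \<open>
  By the symmetry under \<open>a \<mapsto> 1 - a\<close> the square of the coefficient pairs each parameter with its
  reflection, and every pair contributes at most \<open>1 / (2m + 1)\<close>.
\<close>

lemma bcoef_le_inverse_square:
  assumes "\<And>a. a \<in># A \<Longrightarrow> 0 < a \<and> a < 1" "image_mset (\<lambda>a. 1 - a) A = A" "size A \<ge> 4"
  shows "bcoef A m \<le> (1 / (2 * real m + 1)) ^ 2"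
proof -
  have "bcoef A m ^ 2 \<le> (1 / (2 * real m + 1)) ^ size A"
    using bcoef_mult_reflect[of A m] assms by (simp add: power2_eq_square)
  also have "\<dots> \<le> (1 / (2 * real m + 1)) ^ 4"
    using assms(3) by (intro power_decreasing) auto
  also have "\<dots> = ((1 / (2 * real m + 1)) ^ 2) ^ 2" by (simp add: power_divide)
  finally show ?thesis by (rule power2_le_imp_le) simp
qed


section \<open>Positivity of the coefficients of \<open>G / F\<close>\<close>

text \<open>
  Kaluza's theorem. With \<open>e\<close> the coefficients of the inverse, \<open>- e\<^sub>n\<^sub>+\<^sub>1\<close> is the sum of
  \<open>e\<^sub>j B\<^sub>n\<^sub>+\<^sub>1\<^sub>-\<^sub>j = e\<^sub>j B\<^sub>n\<^sub>-\<^sub>j \<rho>\<^sub>n\<^sub>-\<^sub>j\<close> over \<open>j \<le> n\<close>. Replacing \<open>\<rho>\<^sub>n\<^sub>-\<^sub>j\<close> by the larger \<open>\<rho>\<^sub>n\<close> lowers it, because the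
  terms with \<open>j > 0\<close> are nonpositive, and leaves \<open>\<rho>\<^sub>n\<close> times the \<open>n\<close>-th coefficient of the product,
  which is \<open>0\<close> or, for \<open>n = 0\<close>, equal to \<open>1\<close>.
\<close>

lemma kaluza_inverse_nonpos:
  fixes B :: "nat \<Rightarrow> real"
  assumes "B 0 = 1" "\<And>n. B n > 0" and logconvex: "\<And>n. B (Suc n) = B n * \<rho> n" "\<And>n. \<rho> n \<le> \<rho> (Suc n)"
  shows "fps_nth (inverse (Abs_fps B)) (Suc n) \<le> 0"
proof (induction n rule: less_induct)
  case (less n)
  define e where "e = fps_nth (inverse (Abs_fps B))"
  have mono: "\<rho> i \<le> \<rho> j" if "i \<le> j" for i j
    using lift_Suc_mono_le[of \<rho> i j] logconvex(2) that by blast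
  have "inverse (Abs_fps B) * Abs_fps B = 1" using assms(1) by (intro inverse_mult_eq_1) simp
  then have conv: "(\<Sum>j=0..k. e j * B (k - j)) = (if k = 0 then 1 else 0)" for k
    unfolding e_def fps_eq_iff fps_mult_nth by simp
  have e0: "e 0 = 1" using conv[of 0] assms(1) by simp
  have rec: "e (Suc n) = - (\<Sum>j=0..n. e j * B (Suc n - j))"
    using conv[of "Suc n"] assms(1) by simp
  have "(\<Sum>j=0..n. e j * B (n - j) * \<rho> n) \<le> (\<Sum>j=0..n. e j * B (Suc n - j))"
  proof (intro sum_mono)
    fix j assume j: "j \<in> {0..n}"
    then have B: "B (Suc n - j) = B (n - j) * \<rho> (n - j)"
      using logconvex(1)[of "n - j"] by (simp add: Suc_diff_le)
    show "e j * B (n - j) * \<rho> n \<le> e j * B (Suc n - j)"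
    proof (cases j)
      case 0
      then show ?thesis using B by simp
    next
      case (Suc i)
      then have "e j * B (n - j) \<le> 0"
        using less[of i] j assms(2)[of "n - j"] by (auto simp: e_def mult_nonpos_nonneg)
      then have "e j * B (n - j) * \<rho> n \<le> e j * B (n - j) * \<rho> (n - j)"
        using mono[of "n - j" n] by (intro mult_left_mono_neg) auto
      then show ?thesis using B by (simp add: mult_ac)
    qed
  qed
  moreover have "(\<Sum>j=0..n. e j * B (n - j) * \<rho> n) \<ge> 0"
  proof (cases "n = 0")
    case True
    then show ?thesis using e0 assms(1) assms(2)[of 1] logconvex(1)[of 0] by simp
  next
    case False
    have "(\<Sum>j=0..n. e j * B (n - j) * \<rho> n) = (\<Sum>j=0..n. e j * B (n - j)) * \<rho> n"
      by (simp add: sum_distrib_right)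
    then show ?thesis using conv[of n] False by simp
  qed
  ultimately show ?case using rec unfolding e_def by simp
qed

text \<open>
  The \<open>n\<close>-th coefficient is the sum of \<open>H\<^sub>j B\<^sub>j e\<^sub>n\<^sub>-\<^sub>j\<close>, with \<open>e\<close> the coefficients of the inverse. Since
  the sum of \<open>B\<^sub>j e\<^sub>n\<^sub>-\<^sub>j\<close> vanishes for \<open>n > 0\<close>, one may replace \<open>H\<^sub>j\<close> by \<open>H\<^sub>j - H\<^sub>n \<le> 0\<close>, and for \<open>j < n\<close> the factor
  \<open>e\<^sub>n\<^sub>-\<^sub>j\<close> is nonpositive too.
\<close>

lemma quotient_nonneg:
  fixes B H :: "nat \<Rightarrow> real"
  assumes "B 0 = 1" "\<And>n. B n > 0" "\<And>n. B (Suc n) = B n * \<rho> n" "\<And>n. \<rho> n \<le> \<rho> (Suc n)"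
    and "H 0 = 0" "mono H"
  shows "fps_nth (Abs_fps (\<lambda>n. H n * B n) / Abs_fps B) n \<ge> 0"
proof -
  define E where "E = inverse (Abs_fps B)"
  define e where "e = fps_nth E"
  have eneg: "e j \<le> 0" if "j > 0" for j
    using kaluza_inverse_nonpos[of B \<rho> "j - 1"] assms that by (simp add: e_def E_def)
  have "Abs_fps B * E = 1" unfolding E_def using assms(1) by (intro inverse_mult_eq_1') simp
  then have conv: "(\<Sum>j=0..n. B j * e (n - j)) = (if n = 0 then 1 else 0)"
    unfolding e_def fps_eq_iff fps_mult_nth by simp
  have "Abs_fps (\<lambda>n. H n * B n) / Abs_fps B = Abs_fps (\<lambda>n. H n * B n) * E"
    unfolding E_def using assms(1) by (intro fps_divide_unit) simp
  then have "fps_nth (Abs_fps (\<lambda>n. H n * B n) / Abs_fps B) n = (\<Sum>j=0..n. H j * B j * e (n - j))"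
    by (simp add: fps_mult_nth e_def)
  also have "\<dots> = (\<Sum>j=0..n. (H j - H n) * B j * e (n - j))"
  proof -
    have "(\<Sum>j=0..n. (H j - H n) * B j * e (n - j))
       = (\<Sum>j=0..n. H j * B j * e (n - j)) - H n * (\<Sum>j=0..n. B j * e (n - j))"
      by (simp add: sum_subtractf sum_distrib_left algebra_simps)
    moreover have "H n * (\<Sum>j=0..n. B j * e (n - j)) = 0" using conv assms(5) by simp
    ultimately show ?thesis by simp
  qed
  also have "\<dots> \<ge> 0"
  proof (intro sum_nonneg)
    fix j assume j: "j \<in> {0..n}"
    show "(H j - H n) * B j * e (n - j) \<ge> 0"
    proof (cases "j = n")
      case False
      then have "e (n - j) \<le> 0" using j eneg by simp
      moreover have "(H j - H n) * B j \<le> 0"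
        using j assms(2)[of j] monoD[OF assms(6), of j n] by (intro mult_nonpos_nonneg) auto
      ultimately show ?thesis by (rule mult_nonpos_nonpos[rotated])
    qed simp
  qed
  finally show ?thesis .
qed

lemma quotient_le_numerator:
  fixes B H :: "nat \<Rightarrow> real"
  assumes "B 0 = 1" "\<And>n. B n \<ge> 0" "\<And>n. fps_nth (G / Abs_fps B) n \<ge> 0"
  shows "fps_nth (G / Abs_fps B) n \<le> fps_nth G n"
proof -
  have "G = (G / Abs_fps B) * Abs_fps B"
    using assms(1) by (simp add: fps_divide_unit inverse_mult_eq_1 mult.assoc)
  then have "fps_nth G n = (\<Sum>j=0..n. fps_nth (G / Abs_fps B) j * B (n - j))"
    by (metis (no_types, lifting) fps_mult_nth fps_nth_Abs_fps sum.cong)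
  moreover have "(\<Sum>j=0..n. fps_nth (G / Abs_fps B) j * B (n - j))
      \<ge> fps_nth (G / Abs_fps B) n * B (n - n)"
    using assms by (intro member_le_sum) (auto intro!: mult_nonneg_nonneg)
  ultimately show ?thesis using assms(1) by simp
qed

lemma fps_exp_compose_nonneg:
  fixes h :: "real fps"
  assumes "\<And>n. fps_nth h n \<ge> 0"
  shows "fps_nth (fps_exp 1 oo h) n \<ge> 0"
proof -
  have "fps_nth (h ^ i) n \<ge> 0" for i n
    by (induction i arbitrary: n) (auto simp: fps_mult_nth intro!: sum_nonneg mult_nonneg_nonneg assms)
  then show ?thesis by (auto simp: fps_compose_nth intro!: sum_nonneg)
qed

section \<open>Beta laws and their multiplicative convolutions\<close>

text \<open>
  The Mellin transform \<open>s \<mapsto> E[X\<^sup>s]\<close> of a product \<open>X\<close> of independent variables with laws Beta(\<open>a\<close>, \<open>1 - a\<close>).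
\<close>

definition mellin :: "real multiset \<Rightarrow> real \<Rightarrow> real" where
  "mellin A s = (\<Prod>a\<in>#A. Gamma (a + s) / (Gamma a * Gamma (1 + s)))"

text \<open>
  The moments are required for all real exponents \<open>s > - e\<close> rather than for integers only: this makes
  the property stable under products, and the moments of \<open>ln t\<close> can be read off by differentiating
  in \<open>s\<close>.
\<close>

definition mellin_rep :: "real measure \<Rightarrow> real multiset \<Rightarrow> real \<Rightarrow> bool" where
  "mellin_rep \<mu> A e \<longleftrightarrow> 0 < e \<and> e \<le> 1 \<and> (\<forall>a\<in>#A. e \<le> a) \<and> sets \<mu> = sets borel
     \<and> (AE t in \<mu>. 0 < t \<and> t \<le> 1)
     \<and> (\<forall>s>-e. (\<integral>\<^sup>+t. ennreal (t powr s) \<partial>\<mu>) = ennreal (mellin A s))"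

lemma mellin_repD:
  assumes "mellin_rep \<mu> A e"
  shows "0 < e" "e \<le> 1" "\<And>a. a \<in># A \<Longrightarrow> e \<le> a" "sets \<mu> = sets borel"
    "AE t in \<mu>. 0 < t \<and> t \<le> 1"
    "\<And>s. s > -e \<Longrightarrow> (\<integral>\<^sup>+t. ennreal (t powr s) \<partial>\<mu>) = ennreal (mellin A s)"
  using assms unfolding mellin_rep_def by auto

lemma mellin_pos:
  assumes "0 < e" "e \<le> 1" "\<And>a. a \<in># A \<Longrightarrow> e \<le> a" "s > -e"
  shows "mellin A s > 0"
  using assms(3)
proof (induction A)
  case (add a A)
  have "e \<le> a" using add.prems[of a] by simp
  then have "Gamma (a + s) / (Gamma a * Gamma (1 + s)) > 0"
    using assms by (intro divide_pos_pos mult_pos_pos Gamma_real_pos) auto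
  moreover have "mellin A s > 0" using add by simp
  ultimately have "Gamma (a + s) / (Gamma a * Gamma (1 + s)) * mellin A s > 0" by (rule mult_pos_pos)
  then show ?case by (simp add: mellin_def)
qed (simp add: mellin_def)

lemma mellin_0:
  assumes "\<And>a. a \<in># A \<Longrightarrow> a > 0"
  shows "mellin A 0 = 1"
  using assms
proof (induction A)
  case (add a A)
  have "Gamma a > 0" using add.prems[of a] by (intro Gamma_real_pos) simp
  then have "Gamma a \<noteq> 0" by linarith
  then show ?case using add by (simp add: mellin_def)
qed (simp add: mellin_def)

lemma mellin_of_nat:
  assumes "\<And>a. a \<in># A \<Longrightarrow> a > 0"
  shows "mellin A (real m) = bcoef A m"
  using assms
proof (induction A)
  case (add a A)
  have "a \<notin> \<int>\<^sub>\<le>\<^sub>0" using add.prems[of a] by (auto elim!: nonpos_Ints_cases)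
  then have "Gamma (a + real m) / (Gamma a * Gamma (1 + real m)) = pochhammer a m / fact m"
    by (simp add: pochhammer_Gamma Gamma_fact)
  then show ?case using add by (simp add: mellin_def bcoef_def)
qed (simp add: mellin_def bcoef_def)

lemma mellin_has_derivative:
  assumes "0 < e" "e \<le> 1" "\<And>a. a \<in># A \<Longrightarrow> e \<le> a" "s > -e"
  shows "(mellin A has_field_derivative mellin A s * (\<Sum>a\<in>#A. Digamma (a + s) - Digamma (1 + s))) (at s)"
  using assms(3)
proof (induction A)
  case empty
  have "mellin {#} = (\<lambda>_. 1)" by (auto simp: mellin_def)
  then show ?case by simp
next
  case (add a A)
  have a: "e \<le> a" using add.prems[of a] by simp
  have np: "a + s \<notin> \<int>\<^sub>\<le>\<^sub>0" "1 + s \<notin> \<int>\<^sub>\<le>\<^sub>0"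
    using a assms by (auto elim!: nonpos_Ints_cases)
  have nz: "Gamma a \<noteq> 0" "Gamma (1 + s) \<noteq> 0"
    using a assms Gamma_real_pos[of a] Gamma_real_pos[of "1 + s"] by linarith+
  have eq: "mellin (add_mset a A) = (\<lambda>s. Gamma (a + s) / (Gamma a * Gamma (1 + s)) * mellin A s)"
    by (auto simp: mellin_def)
  have "((\<lambda>s. Gamma (a + s) / (Gamma a * Gamma (1 + s))) has_field_derivative
      Gamma (a + s) / (Gamma a * Gamma (1 + s)) * (Digamma (a + s) - Digamma (1 + s))) (at s)"
    using np nz by (auto intro!: derivative_eq_intros simp: field_simps)
  moreover have "(mellin A has_field_derivative mellin A s * (\<Sum>a\<in>#A. Digamma (a + s) - Digamma (1 + s))) (at s)"
    using add by simp
  ultimately have "((\<lambda>s. Gamma (a + s) / (Gamma a * Gamma (1 + s)) * mellin A s) has_field_derivative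
      Gamma (a + s) / (Gamma a * Gamma (1 + s)) * (Digamma (a + s) - Digamma (1 + s)) * mellin A s +
      mellin A s * (\<Sum>a\<in>#A. Digamma (a + s) - Digamma (1 + s)) * (Gamma (a + s) / (Gamma a * Gamma (1 + s)))) (at s)"
    by (rule DERIV_mult)
  then show ?case unfolding eq by (rule DERIV_cong) (simp add: algebra_simps diff_divide_distrib)
qed

lemma mellin_rep_prob:
  assumes "mellin_rep \<mu> A e"
  shows "emeasure \<mu> (space \<mu>) = 1"
proof -
  note r = mellin_repD[OF assms]
  have "1 = ennreal (mellin A 0)" using r(1,3) by (subst mellin_0) (auto intro: less_le_trans)
  also have "\<dots> = (\<integral>\<^sup>+t. ennreal (t powr 0) \<partial>\<mu>)" using r(1) r(6)[of 0] by simp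
  also have "\<dots> = (\<integral>\<^sup>+t. 1 \<partial>\<mu>)" using r(5) by (intro nn_integral_cong_AE) auto
  also have "\<dots> = emeasure \<mu> (space \<mu>)" by simp
  finally show ?thesis ..
qed

lemma mellin_rep_finite_measure: "mellin_rep \<mu> A e \<Longrightarrow> finite_measure \<mu>"
  by (intro finite_measureI) (simp add: mellin_rep_prob)

lemma mellin_rep_powr:
  assumes "mellin_rep \<mu> A e" "s > -e"
  shows "has_bochner_integral \<mu> (\<lambda>t. t powr s) (mellin A s)"
proof -
  note r = mellin_repD[OF assms(1)]
  have [measurable_cong]: "sets \<mu> = sets borel" by (rule r(4))
  show ?thesis
    using r(6)[OF assms(2)] mellin_pos[of e A s] r(1-3) assms(2)
    by (intro has_bochner_integral_nn_integral) auto
qed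

lemma neg_ln_le_powr:
  assumes "0 < t" "t \<le> (1::real)" "d > 0"
  shows "\<bar>ln t\<bar> \<le> t powr (-d) / d"
proof -
  have "d * (- ln t) = ln (t powr (-d))" using assms by (simp add: ln_powr)
  also have "\<dots> \<le> t powr (-d)" using assms ln_le_minus_one[of "t powr (-d)"] by simp
  finally have "- ln t \<le> t powr (-d) / d" using assms by (simp add: field_simps)
  then show ?thesis using assms by simp
qed

lemma mellin_rep_integrable_ln:
  assumes "mellin_rep \<mu> A e" "s > -e"
  shows "integrable \<mu> (\<lambda>t. t powr s * ln t)"
proof -
  note r = mellin_repD[OF assms(1)]
  have [measurable_cong]: "sets \<mu> = sets borel" by (rule r(4))
  \<comment> \<open>Half of the margin \<open>s + e\<close> is spent on dominating the logarithm by a power.\<close>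
  define d where "d = (s + e) / 2"
  have d: "d > 0" "s - d > -e" using assms by (auto simp: d_def field_simps)
  have "integrable \<mu> (\<lambda>t. t powr (s - d) / d)"
    using mellin_rep_powr[OF assms(1) d(2)] by (auto simp: has_bochner_integral_iff)
  then show ?thesis
  proof (rule Bochner_Integration.integrable_bound)
    show "AE t in \<mu>. norm (t powr s * ln t) \<le> norm (t powr (s - d) / d)"
      using r(5)
    proof eventually_elim
      case (elim t)
      have "t powr s * \<bar>ln t\<bar> \<le> t powr s * (t powr (-d) / d)"
        using neg_ln_le_powr[of t d] elim d by (intro mult_left_mono) auto
      also have "\<dots> = t powr (s - d) / d" by (simp add: powr_add[symmetric])
      finally show ?case using d by (simp add: abs_mult)
    qed
  qed measurable
qed

text \<open>
  From \<open>1 + x \<le> exp x\<close> one gets \<open>t\<^bsup>s+h\<^esup> - t\<^sup>s - h t\<^sup>s ln t \<ge> 0\<close> for \<open>h\<close> of either sign. After integration the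
  left-hand side is a function of \<open>h\<close> with a minimum at \<open>0\<close>, so its derivative vanishes there. This
  avoids interchanging derivative and integral.
\<close>

lemma mellin_rep_integral_ln:
  assumes "mellin_rep \<mu> A e" "s > -e"
  shows "(\<integral>t. t powr s * ln t \<partial>\<mu>) = mellin A s * (\<Sum>a\<in>#A. Digamma (a + s) - Digamma (1 + s))"
proof -
  note r = mellin_repD[OF assms(1)]
  define J where "J = (\<integral>t. t powr s * ln t \<partial>\<mu>)"
  have ge: "mellin A (s + h) - mellin A s - h * J \<ge> 0" if "s + h > -e" for h
  proof -
    have i: "integrable \<mu> (\<lambda>t. t powr (s + h))" "integrable \<mu> (\<lambda>t. t powr s)"
      "(\<integral>t. t powr (s + h) \<partial>\<mu>) = mellin A (s + h)" "(\<integral>t. t powr s \<partial>\<mu>) = mellin A s"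
      using mellin_rep_powr[OF assms(1) that] mellin_rep_powr[OF assms]
      by (auto simp: has_bochner_integral_iff)
    have "0 \<le> (\<integral>t. t powr (s + h) - t powr s - h * (t powr s * ln t) \<partial>\<mu>)"
    proof (rule integral_nonneg_AE)
      show "AE t in \<mu>. 0 \<le> t powr (s + h) - t powr s - h * (t powr s * ln t)"
        using r(5)
      proof eventually_elim
        case (elim t)
        have "1 + h * ln t \<le> exp (h * ln t)" by (rule exp_ge_add_one_self)
        also have "exp (h * ln t) = t powr h" using elim by (simp add: powr_def)
        finally have "t powr s * (1 + h * ln t) \<le> t powr s * t powr h" by (intro mult_left_mono) auto
        then show ?case by (simp add: powr_add algebra_simps)
      qed
    qed
    also have "\<dots> = mellin A (s + h) - mellin A s - h * J"
      using i mellin_rep_integrable_ln[OF assms] by (simp add: J_def)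
    finally show ?thesis .
  qed
  have "((\<lambda>h. mellin A (s + h) - mellin A s - h * J) has_field_derivative
     mellin A s * (\<Sum>a\<in>#A. Digamma (a + s) - Digamma (1 + s)) - J) (at 0)"
  proof -
    have "(mellin A has_field_derivative mellin A s * (\<Sum>a\<in>#A. Digamma (a + s) - Digamma (1 + s))) (at (s + 0))"
      using mellin_has_derivative[of e A s] r(1-3) assms(2) by simp
    then have "((\<lambda>h. mellin A (s + h)) has_field_derivative
        mellin A s * (\<Sum>a\<in>#A. Digamma (a + s) - Digamma (1 + s))) (at 0)"
      using DERIV_shift[of "mellin A" _ 0 s] by (simp add: add.commute)
    then show ?thesis by (auto intro!: derivative_eq_intros)
  qed
  then have "mellin A s * (\<Sum>a\<in>#A. Digamma (a + s) - Digamma (1 + s)) - J = 0"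
  proof (rule DERIV_local_min)
    show "0 < s + e" using assms by simp
    show "\<forall>h. \<bar>0 - h\<bar> < s + e \<longrightarrow>
        mellin A (s + 0) - mellin A s - 0 * J \<le> mellin A (s + h) - mellin A s - h * J"
      using ge by (auto simp: abs_if split: if_splits)
  qed
  then show ?thesis by (simp add: J_def)
qed

text \<open>
  Both the limit of the harmonic sums \<open>hcoef A\<close> and minus the mean of \<open>ln t\<close> under the law attached to
  \<open>A\<close>. For \<open>A = params Ns\<close> it equals \<open>ln C\<close>.
\<close>

definition psi_gap :: "real multiset \<Rightarrow> real" where
  "psi_gap A = (\<Sum>a\<in>#A. Digamma 1 - Digamma a)"

lemma sum_Digamma_of_nat:
  assumes "\<And>a. a \<in># A \<Longrightarrow> a > 0"
  shows "(\<Sum>a\<in>#A. Digamma (a + real m) - Digamma (1 + real m)) = hcoef A m - psi_gap A"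
proof -
  have dig: "Digamma (x + real m) = Digamma x + harm_shift x m" if "x > 0" for x :: real
  proof (induction m)
    case (Suc m)
    then show ?case using Digamma_plus1[of "x + real m"] that
      by (simp add: harm_shift_def add_ac)
  qed (simp add: harm_shift_def)
  show ?thesis using assms
  proof (induction A)
    case (add a A)
    then show ?case using dig[of a] dig[of 1] by (simp add: hcoef_def psi_gap_def)
  qed (simp add: hcoef_def psi_gap_def)
qed

lemma hcoef_tendsto:
  assumes "\<And>a. a \<in># A \<Longrightarrow> a > 0"
  shows "hcoef A \<longlonglongrightarrow> psi_gap A"
  using assms
proof (induction A)
  case empty
  then show ?case by (simp add: hcoef_def psi_gap_def)
next
  case (add a A)
  have lim: "(\<lambda>m. ln (real m) - harm_shift x m) \<longlonglongrightarrow> Digamma x" if "x > 0" for x :: real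
    using Digamma_LIMSEQ[of x] that by (simp add: harm_shift_def divide_inverse)
  have "(\<lambda>m. (ln (real m) - harm_shift 1 m) - (ln (real m) - harm_shift a m) + hcoef A m)
       \<longlonglongrightarrow> (Digamma 1 - Digamma a) + psi_gap A"
    using add by (intro tendsto_intros lim) auto
  then show ?case by (simp add: hcoef_def psi_gap_def)
qed

lemma mellin_rep_moments:
  assumes "mellin_rep \<mu> A e"
  shows "integrable \<mu> (\<lambda>t. t ^ m)" "(\<integral>t. t ^ m \<partial>\<mu>) = bcoef A m"
    "integrable \<mu> (\<lambda>t. t ^ m * ln t)" "(\<integral>t. t ^ m * ln t \<partial>\<mu>) = bcoef A m * (hcoef A m - psi_gap A)"
proof -
  note r = mellin_repD[OF assms]
  have [measurable_cong]: "sets \<mu> = sets borel" by (rule r(4))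
  have pos: "a > 0" if "a \<in># A" for a using r(1) r(3)[OF that] by simp
  have m: "real m > - e" using r(1) by simp
  have eq: "AE t in \<mu>. t powr real m = t ^ m" using r(5) by eventually_elim (simp add: powr_realpow)
  have eq': "AE t in \<mu>. t powr real m * ln t = t ^ m * ln t"
    using eq by eventually_elim simp
  have 1: "integrable \<mu> (\<lambda>t. t powr real m)" "(\<integral>t. t powr real m \<partial>\<mu>) = bcoef A m"
    using mellin_rep_powr[OF assms m] mellin_of_nat[of A m] pos by (auto simp: has_bochner_integral_iff)
  show "integrable \<mu> (\<lambda>t. t ^ m)" using 1(1) eq by (subst (asm) integrable_cong_AE) auto
  show "(\<integral>t. t ^ m \<partial>\<mu>) = bcoef A m"
    unfolding 1(2)[symmetric] using eq by (intro integral_cong_AE) auto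
  show "integrable \<mu> (\<lambda>t. t ^ m * ln t)"
    using mellin_rep_integrable_ln[OF assms m] eq' by (subst (asm) integrable_cong_AE) auto
  have "(\<integral>t. t ^ m * ln t \<partial>\<mu>) = (\<integral>t. t powr real m * ln t \<partial>\<mu>)"
    using eq' by (intro integral_cong_AE) auto
  also have "\<dots> = bcoef A m * (hcoef A m - psi_gap A)"
    using mellin_rep_integral_ln[OF assms m] mellin_of_nat[of A m] sum_Digamma_of_nat[of A m] pos by simp
  finally show "(\<integral>t. t ^ m * ln t \<partial>\<mu>) = bcoef A m * (hcoef A m - psi_gap A)" .
qed

text \<open>
  Multiplicative convolution: the law of a product of independent variables.
\<close>

definition mconv :: "real measure \<Rightarrow> real measure \<Rightarrow> real measure" where
  "mconv \<mu> \<nu> = distr (\<mu> \<Otimes>\<^sub>M \<nu>) borel (\<lambda>(x, y). x * y)"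

lemma mellin_rep_mconv:
  assumes "mellin_rep \<mu> A e" "mellin_rep \<nu> A' e"
  shows "mellin_rep (mconv \<mu> \<nu>) (A + A') e"
proof -
  note r = mellin_repD[OF assms(1)]
  note r' = mellin_repD[OF assms(2)]
  have [measurable_cong]: "sets \<mu> = sets borel" by (rule r(4))
  have [measurable_cong]: "sets \<nu> = sets borel" by (rule r'(4))
  interpret \<mu>: finite_measure \<mu> using assms(1) by (rule mellin_rep_finite_measure)
  interpret \<nu>: finite_measure \<nu> using assms(2) by (rule mellin_rep_finite_measure)
  interpret P: pair_sigma_finite \<mu> \<nu> ..
  have "AE t in mconv \<mu> \<nu>. 0 < t \<and> t \<le> 1"
    unfolding mconv_def
  proof (subst AE_distr_iff)
    show "AE x in \<mu> \<Otimes>\<^sub>M \<nu>. 0 < (case x of (x, y) \<Rightarrow> x * y) \<and> (case x of (x, y) \<Rightarrow> x * y) \<le> 1"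
    proof (rule P.AE_pair_measure)
      show "AE x in \<mu>. AE y in \<nu>. 0 < (case (x, y) of (x, y) \<Rightarrow> x * y) \<and> (case (x, y) of (x, y) \<Rightarrow> x * y) \<le> 1"
        using r(5)
      proof eventually_elim
        case (elim x)
        show ?case using r'(5) by eventually_elim (use elim in \<open>auto intro: mult_le_one\<close>)
      qed
    qed measurable
  qed measurable
  moreover have "(\<integral>\<^sup>+t. ennreal (t powr s) \<partial>mconv \<mu> \<nu>) = ennreal (mellin (A + A') s)" if s: "s > -e" for s
  proof -
    have "(\<integral>\<^sup>+t. ennreal (t powr s) \<partial>mconv \<mu> \<nu>)
        = (\<integral>\<^sup>+p. ennreal ((fst p * snd p) powr s) \<partial>(\<mu> \<Otimes>\<^sub>M \<nu>))"
      unfolding mconv_def by (subst nn_integral_distr) (auto simp: case_prod_beta)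
    also have "\<dots> = (\<integral>\<^sup>+x. (\<integral>\<^sup>+y. ennreal (x powr s) * ennreal (y powr s) \<partial>\<nu>) \<partial>\<mu>)"
      by (subst \<nu>.nn_integral_fst[symmetric]) (auto simp: powr_mult ennreal_mult)
    also have "\<dots> = (\<integral>\<^sup>+x. ennreal (x powr s) * ennreal (mellin A' s) \<partial>\<mu>)"
      using r'(6)[OF s] by (simp add: nn_integral_cmult)
    also have "\<dots> = ennreal (mellin A s) * ennreal (mellin A' s)"
      using r(6)[OF s] by (simp add: nn_integral_multc)
    also have "\<dots> = ennreal (mellin (A + A') s)"
      using mellin_pos[of e A s] r(1-3) s by (simp add: ennreal_mult'[symmetric] mellin_def less_imp_le)
    finally show ?thesis .
  qed
  ultimately show ?thesis
    unfolding mellin_rep_def using r(1-3) r'(3) by (auto simp: mconv_def)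
qed

lemma nn_integral_Beta:
  assumes "p > 0" "q > (0::real)"
  shows "(\<integral>\<^sup>+t. ennreal (indicator {0<..<1} t * (t powr (p - 1) * (1 - t) powr (q - 1))) \<partial>lborel)
            = ennreal (Beta p q)"
proof -
  have "((\<lambda>t. t powr (p - 1) * (1 - t) powr (q - 1)) has_integral Beta p q) {0<..<1}"
    using has_integral_Beta_real[OF assms] by (simp add: has_integral_Icc_iff_Ioo)
  then show ?thesis
    using nn_integral_has_integral_lebesgue[of "{0<..<1}" "\<lambda>t. t powr (p - 1) * (1 - t) powr (q - 1)"]
    by simp
qed

text \<open>
  The law Beta(\<open>a\<close>, \<open>1 - a\<close>).
\<close>

definition beta_measure :: "real \<Rightarrow> real measure" where
  "beta_measure a = density lborel (\<lambda>t. ennreal (indicator {0<..<1} t *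
      (t powr (a - 1) * (1 - t) powr (- a)) / (Gamma a * Gamma (1 - a))))"

lemma mellin_rep_beta:
  assumes "0 < e" "e \<le> a" "a < 1"
  shows "mellin_rep (beta_measure a) {#a#} e"
proof -
  have G: "Gamma a > 0" "Gamma (1 - a) > 0" using assms by (auto intro!: Gamma_real_pos)
  have "AE t in beta_measure a. 0 < t \<and> t \<le> 1"
    unfolding beta_measure_def by (subst AE_density) (auto simp: indicator_def)
  moreover have "(\<integral>\<^sup>+t. ennreal (t powr s) \<partial>beta_measure a) = ennreal (mellin {#a#} s)" if s: "s > -e" for s
  proof -
    have "(\<integral>\<^sup>+t. ennreal (t powr s) \<partial>beta_measure a)
        = (\<integral>\<^sup>+t. ennreal (1 / (Gamma a * Gamma (1 - a))) *
             ennreal (indicator {0<..<1} t * (t powr ((a + s) - 1) * (1 - t) powr ((1 - a) - 1))) \<partial>lborel)"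
      unfolding beta_measure_def
    proof (subst nn_integral_density, measurable, intro nn_integral_cong)
      fix t :: real
      have "indicator {0<..<1} t * (t powr (a - 1) * (1 - t) powr (- a)) / (Gamma a * Gamma (1 - a)) * t powr s
        = 1 / (Gamma a * Gamma (1 - a)) *
             (indicator {0<..<1} t * (t powr ((a + s) - 1) * (1 - t) powr ((1 - a) - 1)))"
        by (simp add: powr_add powr_diff powr_minus_divide mult_ac)
      then show "ennreal (indicator {0<..<1} t * (t powr (a - 1) * (1 - t) powr (- a)) / (Gamma a * Gamma (1 - a)))
            * ennreal (t powr s) = ennreal (1 / (Gamma a * Gamma (1 - a))) *
             ennreal (indicator {0<..<1} t * (t powr ((a + s) - 1) * (1 - t) powr ((1 - a) - 1)))"
        using G by (subst (1 2) ennreal_mult'[symmetric]) auto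
    qed
    also have "\<dots> = ennreal (1 / (Gamma a * Gamma (1 - a))) * ennreal (Beta (a + s) (1 - a))"
      using assms s by (subst nn_integral_cmult) (measurable, subst nn_integral_Beta, auto)
    also have "\<dots> = ennreal (mellin {#a#} s)"
      using G by (simp add: ennreal_mult'[symmetric] mellin_def Beta_def add_ac)
    finally show ?thesis .
  qed
  ultimately show ?thesis unfolding mellin_rep_def using assms by (auto simp: beta_measure_def)
qed

section \<open>The product of two complementary Beta variables\<close>

text \<open>
  The logarithmic derivative of \<open>\<Gamma>(x) \<Gamma>(1 - x) = pi / sin (pi x)\<close>.
\<close>

lemma Digamma_reflection:
  assumes "0 < a" "a < (1::real)"
  shows "Digamma a - Digamma (1 - a) = - pi * cot (pi * a)"
proof -
  have refl: "Gamma x * Gamma (1 - x) = pi / sin (pi * x)" for x :: real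
  proof -
    have "complex_of_real (Gamma x * Gamma (1 - x)) = complex_of_real (pi / sin (pi * x))"
      using Gamma_reflection_complex[of "complex_of_real x"]
      by (simp add: Gamma_complex_of_real[symmetric] sin_of_real[symmetric])
    then show ?thesis by (simp only: of_real_eq_iff)
  qed
  have G: "Gamma a > 0" "Gamma (1 - a) > 0" "sin (pi * a) > 0"
    using assms by (auto intro!: Gamma_real_pos sin_gt_zero simp: field_simps)
  have np: "a \<notin> \<int>\<^sub>\<le>\<^sub>0" "1 - a \<notin> \<int>\<^sub>\<le>\<^sub>0" using assms by (auto elim!: nonpos_Ints_cases)
  have "((\<lambda>x. Gamma x * Gamma (1 - x)) has_field_derivative
      Gamma a * Gamma (1 - a) * (Digamma a - Digamma (1 - a))) (at a)"
    using np by (auto intro!: derivative_eq_intros simp: algebra_simps)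
  moreover have "((\<lambda>x. pi / sin (pi * x)) has_field_derivative
      pi / sin (pi * a) * (- pi * cot (pi * a))) (at a)"
    using G by (auto intro!: derivative_eq_intros simp: cot_def power2_eq_square)
  ultimately have "Gamma a * Gamma (1 - a) * (Digamma a - Digamma (1 - a))
      = pi / sin (pi * a) * (- pi * cot (pi * a))"
    unfolding refl by (rule DERIV_unique)
  then have "pi / sin (pi * a) * (Digamma a - Digamma (1 - a)) = pi / sin (pi * a) * (- pi * cot (pi * a))"
    unfolding refl .
  moreover have "pi / sin (pi * a) \<noteq> 0" using G by simp
  ultimately show ?thesis using mult_left_cancel by blast
qed

lemma nn_integral_Beta_scaled:
  assumes "p > 0" "q > 0" "s > (0::real)"
  shows "(\<integral>\<^sup>+t. ennreal (if 0 < t \<and> t < s then t powr (p - 1) * (s - t) powr (q - 1) else 0) \<partial>lborel)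
            = ennreal (s powr (p + q - 1) * Beta p q)"
proof -
  have eq: "(if 0 < 0 + s * t \<and> 0 + s * t < s then (0 + s * t) powr (p - 1) * (s - (0 + s * t)) powr (q - 1) else 0)
     = s powr (p + q - 2) * (indicator {0<..<1} t * (t powr (p - 1) * (1 - t) powr (q - 1)))" for t
  proof -
    have "s - s * t = s * (1 - t)" by (simp add: algebra_simps)
    moreover have "s powr (p + q - 2) = s powr (p - 1) * s powr (q - 1)" by (simp add: powr_add[symmetric])
    ultimately show ?thesis
      using assms(3) by (auto simp: powr_mult indicator_def zero_less_mult_iff mult_less_cancel_left1)
  qed
  have "(\<integral>\<^sup>+t. ennreal (if 0 < t \<and> t < s then t powr (p - 1) * (s - t) powr (q - 1) else 0) \<partial>lborel)
     = ennreal \<bar>s\<bar> * (\<integral>\<^sup>+t. ennreal (s powr (p + q - 2) *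
           (indicator {0<..<1} t * (t powr (p - 1) * (1 - t) powr (q - 1)))) \<partial>lborel)"
    using assms(3) by (subst nn_integral_real_affine[of _ s 0]) (simp_all only: eq, measurable)
  also have "\<dots> = ennreal s * (ennreal (s powr (p + q - 2)) * ennreal (Beta p q))"
    using assms by (subst ennreal_mult') (auto simp: nn_integral_cmult nn_integral_Beta)
  also have "\<dots> = ennreal (s powr 1 * s powr (p + q - 2) * Beta p q)"
    using assms(3) by (simp add: ennreal_mult'[symmetric] mult.assoc)
  also have "s powr 1 * s powr (p + q - 2) = s powr (p + q - 1)"
    by (simp only: powr_add[symmetric]) (simp add: algebra_simps)
  finally show ?thesis .
qed

definition pair_integrand :: "real \<Rightarrow> real \<Rightarrow> real \<Rightarrow> real" where
  "pair_integrand a t u =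
     indicator {0<..<1} u * ((t + (1 - t) * u) powr (-a) * (1 - u) powr (a - 1) * u powr (-a))"

lemma pair_integrand_measurable [measurable]:
  "(\<lambda>(t, u). pair_integrand a t u) \<in> borel_measurable (borel \<Otimes>\<^sub>M borel)"
  unfolding pair_integrand_def by measurable

text \<open>
  The product of independent variables with laws Beta(\<open>a\<close>, \<open>1 - a\<close>) and Beta(\<open>1 - a\<close>, \<open>a\<close>) has, up to a
  constant, the density \<open>t\<^bsup>a-1\<^esup> k(t)\<close> with this \<open>k\<close>. With the chosen integrand \<open>k\<close> visibly decreases in
  \<open>t\<close>, since \<open>t + (1 - t) u\<close> increases.
\<close>

definition pair_kernel :: "real \<Rightarrow> real \<Rightarrow> ennreal" where
  "pair_kernel a t = (\<integral>\<^sup>+u. ennreal (pair_integrand a t u) \<partial>lborel)"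

lemma pair_kernel_measurable [measurable]: "pair_kernel a \<in> borel_measurable borel"
  unfolding pair_kernel_def by measurable

lemma pair_kernel_antimono:
  assumes "0 \<le> a" "0 < s" "s \<le> t" "t < 1"
  shows "pair_kernel a t \<le> pair_kernel a s"
  unfolding pair_kernel_def
proof (intro nn_integral_mono ennreal_leI)
  fix u :: real
  show "pair_integrand a t u \<le> pair_integrand a s u"
  proof (cases "u \<in> {0<..<1}")
    case True
    have "(t - s) * (1 - u) \<ge> 0" using True assms by simp
    then have "s + (1 - s) * u \<le> t + (1 - t) * u" by (simp add: algebra_simps)
    moreover have "s + (1 - s) * u > 0" using True assms by (intro add_pos_nonneg) auto
    ultimately have "(t + (1 - t) * u) powr (-a) \<le> (s + (1 - s) * u) powr (-a)"
      using assms by (intro powr_mono2') auto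
    then show ?thesis by (auto simp: pair_integrand_def intro!: mult_left_mono mult_right_mono)
  qed (simp add: pair_integrand_def)
qed

lemma pair_kernel_finite:
  assumes "0 < a" "a < 1" "0 < t" "t < 1"
  shows "pair_kernel a t < \<infinity>"
proof -
  have "pair_kernel a t \<le> (\<integral>\<^sup>+u. ennreal (t powr (-a)) * ennreal (indicator {0<..<1} u *
      (u powr ((1 - a) - 1) * (1 - u) powr (a - 1))) \<partial>lborel)"
    unfolding pair_kernel_def
  proof (intro nn_integral_mono)
    fix u :: real
    have "pair_integrand a t u \<le> t powr (-a) * (indicator {0<..<1} u * (u powr ((1 - a) - 1) * (1 - u) powr (a - 1)))"
    proof (cases "u \<in> {0<..<1}")
      case True
      then have "(t + (1 - t) * u) powr (-a) \<le> t powr (-a)"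
        using assms by (intro powr_mono2') auto
      then have "(t + (1 - t) * u) powr (-a) * ((1 - u) powr (a - 1) * u powr (-a))
          \<le> t powr (-a) * ((1 - u) powr (a - 1) * u powr (-a))"
        by (intro mult_right_mono) auto
      then show ?thesis using True by (simp add: pair_integrand_def mult_ac)
    qed (simp add: pair_integrand_def)
    then show "ennreal (pair_integrand a t u) \<le> ennreal (t powr (-a)) * ennreal (indicator {0<..<1} u * (u powr ((1 - a) - 1) * (1 - u) powr (a - 1)))"
      by (simp add: ennreal_mult'[symmetric] ennreal_leI)
  qed
  also have "\<dots> = ennreal (t powr (-a)) * ennreal (Beta (1 - a) a)"
    using assms by (subst nn_integral_cmult) (measurable, subst nn_integral_Beta, auto)
  also have "\<dots> < \<infinity>" by (simp add: ennreal_mult'[symmetric])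
  finally show ?thesis .
qed

text \<open>
  The substitution \<open>s = t + (1 - t) u\<close>. The resulting integral is the one that a convolution produces,
  and it is suited to interchanging the order of integration.
\<close>

lemma pair_kernel_alt:
  assumes "0 < t" "t < 1"
  shows "pair_kernel a t = (\<integral>\<^sup>+s. ennreal (if t < s \<and> s < 1
      then s powr (-a) * (1 - s) powr (a - 1) * (s - t) powr (-a) else 0) \<partial>lborel)"
proof -
  have eq: "(if t < t + (1 - t) * u \<and> t + (1 - t) * u < 1
      then (t + (1 - t) * u) powr (-a) * (1 - (t + (1 - t) * u)) powr (a - 1) * (t + (1 - t) * u - t) powr (-a) else 0)
    = 1 / (1 - t) * pair_integrand a t u" for u
  proof -
    have e1: "1 - (t + (1 - t) * u) = (1 - t) * (1 - u)" by (simp add: algebra_simps)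
    have "t + (1 - t) * u < 1 \<longleftrightarrow> 0 < (1 - t) * (1 - u)" unfolding e1[symmetric] by simp
    also have "\<dots> \<longleftrightarrow> u < 1" using assms by (simp add: zero_less_mult_iff)
    finally have e2: "t + (1 - t) * u < 1 \<longleftrightarrow> u < 1" .
    have e3: "t < t + (1 - t) * u \<longleftrightarrow> u > 0" using assms by (simp add: zero_less_mult_iff)
    have "(1 - t) powr (a - 1) * (1 - t) powr (-a) = (1 - t) powr (-1)"
      by (simp only: powr_add[symmetric]) simp
    then have "(1 - t) powr (a - 1) * (1 - t) powr (-a) = 1 / (1 - t)"
      using assms by (simp add: powr_minus_divide)
    moreover have "(t + (1 - t) * u) powr (-a) * ((1 - t) * (1 - u)) powr (a - 1) * ((1 - t) * u) powr (-a)
        = ((1 - t) powr (a - 1) * (1 - t) powr (-a)) *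
           ((t + (1 - t) * u) powr (-a) * (1 - u) powr (a - 1) * u powr (-a))"
      by (simp only: powr_mult mult_ac)
    ultimately have "(t + (1 - t) * u) powr (-a) * ((1 - t) * (1 - u)) powr (a - 1) * ((1 - t) * u) powr (-a)
        = 1 / (1 - t) * ((t + (1 - t) * u) powr (-a) * (1 - u) powr (a - 1) * u powr (-a))" by simp
    moreover have "t + (1 - t) * u - t = (1 - t) * u" by simp
    ultimately show ?thesis unfolding e1 e2 e3 by (simp add: pair_integrand_def indicator_def)
  qed
  have "(\<integral>\<^sup>+s. ennreal (if t < s \<and> s < 1
      then s powr (-a) * (1 - s) powr (a - 1) * (s - t) powr (-a) else 0) \<partial>lborel)
    = ennreal \<bar>1 - t\<bar> * (\<integral>\<^sup>+u. ennreal (1 / (1 - t) * pair_integrand a t u) \<partial>lborel)"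
  proof (subst nn_integral_real_affine[of _ "1 - t" t])
    show "(\<lambda>s. ennreal (if t < s \<and> s < 1 then s powr (-a) * (1 - s) powr (a - 1) * (s - t) powr (-a) else 0))
        \<in> borel_measurable borel" by measurable
    show "1 - t \<noteq> 0" using assms by simp
  qed (simp only: eq)
  also have "\<dots> = ennreal (1 - t) * (ennreal (1 / (1 - t)) * pair_kernel a t)"
  proof -
    have "(\<integral>\<^sup>+u. ennreal (1 / (1 - t) * pair_integrand a t u) \<partial>lborel)
      = (\<integral>\<^sup>+u. ennreal (1 / (1 - t)) * ennreal (pair_integrand a t u) \<partial>lborel)"
      by (intro nn_integral_cong ennreal_mult') (use assms in \<open>auto simp: pair_integrand_def\<close>)
    also have "\<dots> = ennreal (1 / (1 - t)) * pair_kernel a t"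
      unfolding pair_kernel_def by (intro nn_integral_cmult) measurable
    finally show ?thesis using assms by simp
  qed
  also have "\<dots> = pair_kernel a t"
    using assms by (simp add: mult.assoc[symmetric] ennreal_mult'[symmetric])
  finally show ?thesis ..
qed

text \<open>
  After interchanging the integrations the inner integral is a scaled Beta integral in \<open>t\<close> over
  \<open>(0, x)\<close>, and what remains is a Beta integral in \<open>x\<close>.
\<close>

lemma pair_kernel_moment:
  assumes "0 < a" "a < 1" "a + s > 0" "1 - a + s > 0"
  shows "(\<integral>\<^sup>+t. (if 0 < t \<and> t < 1 then ennreal (t powr (a + s - 1)) * pair_kernel a t else 0) \<partial>lborel)
           = ennreal (Beta (a + s) (1 - a) * Beta (1 - a + s) a)"
proof -
  let ?f = "\<lambda>t x. ennreal (if 0 < t \<and> t < x \<and> x < 1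
       then t powr (a + s - 1) * (x powr (-a) * (1 - x) powr (a - 1) * (x - t) powr (-a)) else 0)"
  have "(\<integral>\<^sup>+t. (if 0 < t \<and> t < 1 then ennreal (t powr (a + s - 1)) * pair_kernel a t else 0) \<partial>lborel)
      = (\<integral>\<^sup>+t. (\<integral>\<^sup>+x. ?f t x \<partial>lborel) \<partial>lborel)"
  proof (intro nn_integral_cong)
    fix t :: real
    show "(if 0 < t \<and> t < 1 then ennreal (t powr (a + s - 1)) * pair_kernel a t else 0)
         = (\<integral>\<^sup>+x. ?f t x \<partial>lborel)"
    proof (cases "0 < t \<and> t < 1")
      case True
      have "(\<integral>\<^sup>+x. ?f t x \<partial>lborel) = (\<integral>\<^sup>+x. ennreal (t powr (a + s - 1)) * ennreal (if t < x \<and> x < 1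
          then x powr (-a) * (1 - x) powr (a - 1) * (x - t) powr (-a) else 0) \<partial>lborel)"
        using True by (intro nn_integral_cong) (auto simp: ennreal_mult'[symmetric])
      also have "\<dots> = ennreal (t powr (a + s - 1)) * pair_kernel a t"
        using True by (subst nn_integral_cmult) (auto simp: pair_kernel_alt)
      finally show ?thesis using True by simp
    next
      case False
      then have "?f t = (\<lambda>_. 0)" by (auto simp: fun_eq_iff)
      then show ?thesis using False by auto
    qed
  qed
  also have "\<dots> = (\<integral>\<^sup>+x. (\<integral>\<^sup>+t. ?f t x \<partial>lborel) \<partial>lborel)"
    by (rule lborel_pair.Fubini'[symmetric]) measurable
  also have "\<dots> = (\<integral>\<^sup>+x. ennreal (Beta (a + s) (1 - a)) *
       ennreal (indicator {0<..<1} x * (x powr ((1 - a + s) - 1) * (1 - x) powr (a - 1))) \<partial>lborel)"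
  proof (intro nn_integral_cong)
    fix x :: real
    show "(\<integral>\<^sup>+t. ?f t x \<partial>lborel) = ennreal (Beta (a + s) (1 - a)) *
       ennreal (indicator {0<..<1} x * (x powr ((1 - a + s) - 1) * (1 - x) powr (a - 1)))"
    proof (cases "x \<in> {0<..<1}")
      case True
      have B: "Beta (a + s) (1 - a) \<ge> 0"
        using assms by (auto simp: Beta_def intro!: divide_nonneg_nonneg mult_nonneg_nonneg less_imp_le Gamma_real_pos)
      have "(\<integral>\<^sup>+t. ?f t x \<partial>lborel) = (\<integral>\<^sup>+t. ennreal (x powr (-a) * (1 - x) powr (a - 1)) *
          ennreal (if 0 < t \<and> t < x then t powr ((a + s) - 1) * (x - t) powr ((1 - a) - 1) else 0) \<partial>lborel)"
        using True by (intro nn_integral_cong) (auto simp: ennreal_mult'[symmetric] mult_ac)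
      also have "\<dots> = ennreal (x powr (-a) * (1 - x) powr (a - 1)) *
          ennreal (x powr ((a + s) + (1 - a) - 1) * Beta (a + s) (1 - a))"
        using assms True by (subst nn_integral_cmult) (measurable, subst nn_integral_Beta_scaled, auto)
      also have "\<dots> = ennreal (Beta (a + s) (1 - a) * ((x powr (-a) * x powr s) * (1 - x) powr (a - 1)))"
        using B by (subst ennreal_mult'[symmetric]) (auto simp: mult_ac)
      also have "\<dots> = ennreal (Beta (a + s) (1 - a) * (x powr (s - a) * (1 - x) powr (a - 1)))"
        by (simp only: powr_add[symmetric]) simp
      finally show ?thesis using True B by (simp add: ennreal_mult'[symmetric])
    next
      case False
      then have "?f t x = 0" for t by auto
      then show ?thesis using False by simp
    qed
  qed
  also have "\<dots> = ennreal (Beta (a + s) (1 - a)) * ennreal (Beta (1 - a + s) a)"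
    using assms by (subst nn_integral_cmult) (measurable, subst nn_integral_Beta, auto)
  also have "\<dots> = ennreal (Beta (a + s) (1 - a) * Beta (1 - a + s) a)"
    using assms by (intro ennreal_mult'[symmetric])
      (auto simp: Beta_def intro!: divide_nonneg_nonneg mult_nonneg_nonneg less_imp_le Gamma_real_pos)
  finally show ?thesis .
qed

definition pair_density :: "real \<Rightarrow> real \<Rightarrow> real" where
  "pair_density a t = (if 0 < t \<and> t < 1
     then t powr (a - 1) * enn2real (pair_kernel a t) / (Gamma a * Gamma (1 - a)) ^ 2 else 0)"

lemma pair_density_measurable [measurable]: "pair_density a \<in> borel_measurable borel"
  unfolding pair_density_def by measurable

lemma pair_density_nonneg: "pair_density a t \<ge> 0"
  unfolding pair_density_def by auto

definition pair_measure :: "real \<Rightarrow> real measure" where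
  "pair_measure a = density lborel (\<lambda>t. ennreal (pair_density a t))"

lemma mellin_rep_pair:
  assumes "0 < a" "a \<le> 1 / 2"
  shows "mellin_rep (pair_measure a) {#a, 1 - a#} a"
proof -
  have G: "Gamma a > 0" "Gamma (1 - a) > 0" using assms by (auto intro!: Gamma_real_pos)
  define c where "c = 1 / (Gamma a * Gamma (1 - a)) ^ 2"
  have c: "c > 0" using G by (simp add: c_def)
  have "AE t in pair_measure a. 0 < t \<and> t \<le> 1"
    unfolding pair_measure_def by (subst AE_density) (auto simp: pair_density_def)
  moreover have "(\<integral>\<^sup>+t. ennreal (t powr s) \<partial>pair_measure a) = ennreal (mellin {#a, 1 - a#} s)"
    if s: "s > -a" for s
  proof -
    have "(\<integral>\<^sup>+t. ennreal (t powr s) \<partial>pair_measure a)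
      = (\<integral>\<^sup>+t. ennreal c * (if 0 < t \<and> t < 1 then ennreal (t powr (a + s - 1)) * pair_kernel a t else 0) \<partial>lborel)"
      unfolding pair_measure_def
    proof (subst nn_integral_density, measurable, intro nn_integral_cong)
      fix t :: real
      show "ennreal (pair_density a t) * ennreal (t powr s)
        = ennreal c * (if 0 < t \<and> t < 1 then ennreal (t powr (a + s - 1)) * pair_kernel a t else 0)"
      proof (cases "0 < t \<and> t < 1")
        case True
        then have "pair_kernel a t < \<infinity>" using assms by (intro pair_kernel_finite) auto
        then have k: "pair_kernel a t = ennreal (enn2real (pair_kernel a t))" by simp
        have "pair_density a t * t powr s = c * (t powr (a + s - 1) * enn2real (pair_kernel a t))"
          using True by (simp add: pair_density_def c_def powr_add powr_diff mult_ac)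
        then show ?thesis using True c
          by (subst k) (simp add: ennreal_mult'[symmetric] pair_density_nonneg)
      qed (auto simp: pair_density_def)
    qed
    also have "\<dots> = ennreal c * ennreal (Beta (a + s) (1 - a) * Beta (1 - a + s) a)"
      using assms s by (subst nn_integral_cmult) (measurable, subst pair_kernel_moment, auto)
    also have "\<dots> = ennreal (mellin {#a, 1 - a#} s)"
      using c G by (simp add: ennreal_mult'[symmetric] mellin_def Beta_def c_def power2_eq_square add_ac mult_ac)
    finally show ?thesis .
  qed
  ultimately show ?thesis unfolding mellin_rep_def using assms by (auto simp: pair_measure_def)
qed

section \<open>An inequality between logarithmic means\<close>

lemma has_bochner_integral_lebesgue_iff:
  fixes f :: "real \<Rightarrow> real"
  assumes "f \<in> borel_measurable borel"
  shows "has_bochner_integral lebesgue f x \<longleftrightarrow> has_bochner_integral lborel f x"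
  using assms by (simp add: has_bochner_integral_iff integrable_completion integral_completion)

lemma has_bochner_integral_density_iff:
  fixes f g :: "real \<Rightarrow> real"
  assumes "f \<in> borel_measurable borel" "g \<in> borel_measurable borel" "\<And>t. g t \<ge> 0"
  shows "has_bochner_integral (density lborel (\<lambda>t. ennreal (g t))) f x
     \<longleftrightarrow> has_bochner_integral lborel (\<lambda>t. g t * f t) x"
  using assms by (simp add: has_bochner_integral_iff integrable_density integral_density)

lemma mellin_rep_integrable_log_quotient:
  assumes "mellin_rep \<mu> A e" "y > 0"
  shows "integrable \<mu> (\<lambda>t. (ln (y * t) - k) / (1 + y * t))"
proof -
  note r = mellin_repD[OF assms(1)]
  have [measurable_cong]: "sets \<mu> = sets borel" by (rule r(4))
  interpret finite_measure \<mu> using assms(1) by (rule mellin_rep_finite_measure)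
  have "integrable \<mu> (\<lambda>t. \<bar>ln y - k\<bar> + \<bar>ln t\<bar>)"
    using mellin_rep_moments(3)[OF assms(1), of 0] by (intro Bochner_Integration.integrable_add) auto
  then show ?thesis
  proof (rule Bochner_Integration.integrable_bound)
    show "AE t in \<mu>. norm ((ln (y * t) - k) / (1 + y * t)) \<le> norm (\<bar>ln y - k\<bar> + \<bar>ln t\<bar>)"
      using r(5)
    proof eventually_elim
      case (elim t)
      have "\<bar>(ln (y * t) - k) / (1 + y * t)\<bar> = \<bar>ln (y * t) - k\<bar> / (1 + y * t)"
        using elim assms by (simp add: abs_divide)
      also have "\<dots> \<le> \<bar>ln (y * t) - k\<bar> / 1"
        using elim assms by (intro divide_left_mono) (auto intro!: mult_pos_pos add_pos_pos)
      also have "\<dots> \<le> \<bar>ln y - k\<bar> + \<bar>ln t\<bar>" using elim assms abs_triangle_ineq[of "ln y - k" "ln t"] by (simp add: ln_mult algebra_simps)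
      finally show ?case by simp
    qed
  qed measurable
qed

text \<open>
  In terms of averages: with weight \<open>1 / (1 + y t)\<close>, the mean of \<open>ln (y t)\<close> is at most \<open>k\<close>, for every
  \<open>y > 0\<close>.
\<close>

definition log_mean_le :: "real measure \<Rightarrow> real \<Rightarrow> bool" where
  "log_mean_le \<mu> k \<longleftrightarrow> (\<forall>y>0. (\<integral>t. (ln (y * t) - k) / (1 + y * t) \<partial>\<mu>) \<le> 0)"

text \<open>
  Conditioning on the second factor \<open>z\<close> replaces \<open>y\<close> by \<open>y z\<close> in the integral over the first one.
\<close>

lemma log_mean_le_mconv:
  assumes "mellin_rep \<mu> A e" "mellin_rep \<nu> A' e" "log_mean_le \<mu> k"
  shows "log_mean_le (mconv \<mu> \<nu>) k"
  unfolding log_mean_le_def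
proof (intro allI impI)
  fix y :: real assume y: "y > 0"
  note r = mellin_repD[OF assms(1)]
  note r' = mellin_repD[OF assms(2)]
  have [measurable_cong]: "sets \<mu> = sets borel" by (rule r(4))
  have [measurable_cong]: "sets \<nu> = sets borel" by (rule r'(4))
  interpret \<mu>: finite_measure \<mu> using assms(1) by (rule mellin_rep_finite_measure)
  interpret \<nu>: finite_measure \<nu> using assms(2) by (rule mellin_rep_finite_measure)
  interpret P: pair_sigma_finite \<mu> \<nu> ..
  let ?f = "\<lambda>t. (ln (y * t) - k) / (1 + y * t)"
  have "integrable (mconv \<mu> \<nu>) ?f"
    by (rule mellin_rep_integrable_log_quotient[OF mellin_rep_mconv[OF assms(1,2)] y])
  then have int: "integrable (\<mu> \<Otimes>\<^sub>M \<nu>) (case_prod (\<lambda>x z. ?f (x * z)))"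
    unfolding mconv_def by (subst (asm) integrable_distr_eq) (auto simp: case_prod_unfold)
  have "(\<integral>t. ?f t \<partial>mconv \<mu> \<nu>) = integral\<^sup>L (\<mu> \<Otimes>\<^sub>M \<nu>) (case_prod (\<lambda>x z. ?f (x * z)))"
    unfolding mconv_def by (subst integral_distr) (auto simp: case_prod_unfold)
  also have "\<dots> = (\<integral>z. (\<integral>x. ?f (x * z) \<partial>\<mu>) \<partial>\<nu>)"
    using P.integral_snd[OF int] by simp
  finally have eq: "(\<integral>t. ?f t \<partial>mconv \<mu> \<nu>) = (\<integral>z. (\<integral>x. ?f (x * z) \<partial>\<mu>) \<partial>\<nu>)" .
  have "0 \<le> (\<integral>z. - (\<integral>x. ?f (x * z) \<partial>\<mu>) \<partial>\<nu>)"
  proof (rule integral_nonneg_AE)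
    show "AE z in \<nu>. 0 \<le> - (\<integral>x. ?f (x * z) \<partial>\<mu>)"
      using r'(5)
    proof eventually_elim
      case (elim z)
      then have "(\<integral>x. (ln ((y * z) * x) - k) / (1 + (y * z) * x) \<partial>\<mu>) \<le> 0"
        using assms(3) y unfolding log_mean_le_def by auto
      then show ?case by (simp add: mult_ac)
    qed
  qed
  then show "(\<integral>t. ?f t \<partial>mconv \<mu> \<nu>) \<le> 0" unfolding eq by simp
qed

text \<open>
  The mean of \<open>ln x - ln (1 - x)\<close> under Beta(\<open>a\<close>, \<open>1 - a\<close>) is \<open>Digamma a - Digamma (1 - a)\<close>, the second
  logarithm being treated by the reflection \<open>x \<mapsto> 1 - x\<close>.
\<close>

lemma beta_log_odds:
  assumes "0 < a" "a < (1::real)"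
  shows "has_bochner_integral lborel (\<lambda>x. indicator {0<..<1} x *
     (x powr (a - 1) * (1 - x) powr (-a) * (ln x - ln (1 - x) + pi * cot (pi * a)))) 0"
proof -
  define c where "c = Gamma a * Gamma (1 - a)"
  define w where "w b t = indicator {0<..<1} t * (t powr (b - 1) * (1 - t) powr (-b)) / c" for b t :: real
  have c: "c > 0" unfolding c_def using assms by (intro mult_pos_pos Gamma_real_pos) auto
  have wnn: "w b t \<ge> 0" for b t unfolding w_def using c by auto
  have [measurable]: "w b \<in> borel_measurable borel" for b unfolding w_def[abs_def] by measurable
  have mom: "has_bochner_integral lborel (\<lambda>t. w b t * 1) 1"
      "has_bochner_integral lborel (\<lambda>t. w b t * ln t) (Digamma b - Digamma 1)"
    if "b = a \<or> b = 1 - a" for b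
  proof -
    have b: "0 < b" "b < 1" and cb: "Gamma b * Gamma (1 - b) = c"
      using that assms by (auto simp: c_def mult.commute)
    have rep: "mellin_rep (beta_measure b) {#b#} b" using b by (intro mellin_rep_beta) auto
    have dens: "beta_measure b = density lborel (\<lambda>t. ennreal (w b t))"
      unfolding beta_measure_def cb w_def ..
    have "has_bochner_integral (beta_measure b) (\<lambda>_. 1) (1 :: real)"
      using mellin_rep_moments(1,2)[OF rep, of 0]
      by (simp only: has_bochner_integral_iff power_0 bcoef_0 simp_thms)
    then show "has_bochner_integral lborel (\<lambda>t. w b t * 1) 1"
      unfolding dens by (subst (asm) has_bochner_integral_density_iff[OF _ _ wnn]) measurable
    have "has_bochner_integral (beta_measure b) ln (Digamma b - Digamma 1)"
      using mellin_rep_moments(3,4)[OF rep, of 0] by (simp add: has_bochner_integral_iff psi_gap_def)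
    then show "has_bochner_integral lborel (\<lambda>t. w b t * ln t) (Digamma b - Digamma 1)"
      unfolding dens by (subst (asm) has_bochner_integral_density_iff[OF _ _ wnn]) measurable
  qed
  have refl: "w (1 - a) (1 + (-1) * t) = w a t" for t
    by (auto simp: w_def indicator_def mult.commute)
  have "has_bochner_integral lborel (\<lambda>t. w (1 - a) (1 + (-1) * t) * ln (1 + (-1) * t))
         ((Digamma (1 - a) - Digamma 1) /\<^sub>R \<bar>-1\<bar>)"
    using mom(2)[of "1 - a"] by (intro lborel_has_bochner_integral_real_affine_iff[THEN iffD1]) auto
  then have m3: "has_bochner_integral lborel (\<lambda>t. w a t * ln (1 - t)) (Digamma (1 - a) - Digamma 1)"
    unfolding refl by simp
  have "has_bochner_integral lborel
      (\<lambda>t. c * ((w a t * ln t - w a t * ln (1 - t)) + w a t * 1 * (pi * cot (pi * a))))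
      (c * ((Digamma a - Digamma 1) - (Digamma (1 - a) - Digamma 1) + 1 * (pi * cot (pi * a))))"
    by (intro has_bochner_integral_mult_right has_bochner_integral_add has_bochner_integral_diff
        has_bochner_integral_mult_left mom m3) auto
  moreover have "c * ((Digamma a - Digamma 1) - (Digamma (1 - a) - Digamma 1) + 1 * (pi * cot (pi * a))) = 0"
    using Digamma_reflection[OF assms] by simp
  moreover have "(\<lambda>t. c * ((w a t * ln t - w a t * ln (1 - t)) + w a t * 1 * (pi * cot (pi * a))))
     = (\<lambda>x. indicator {0<..<1} x *
     (x powr (a - 1) * (1 - x) powr (-a) * (ln x - ln (1 - x) + pi * cot (pi * a))))"
    unfolding w_def using c by (auto simp: fun_eq_iff indicator_def field_simps)
  ultimately show ?thesis by (simp only:)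
qed

text \<open>
  The substitution \<open>y t = x / (1 - x)\<close> transforms this integral into the mean of the log-odds.
\<close>

lemma log_mellin_zero:
  assumes "0 < a" "a < (1::real)" "y > 0"
  shows "has_bochner_integral lborel
     (\<lambda>t. indicator {0<..} t * ((ln (y * t) + pi * cot (pi * a)) / (1 + y * t) * t powr (a - 1))) 0"
proof -
  define k where "k = - pi * cot (pi * a)"
  let ?f = "\<lambda>t. (ln (y * t) - k) / (1 + y * t) * t powr (a - 1)"
  let ?w = "\<lambda>x. x powr (a - 1) * (1 - x) powr (-a) * (ln x - ln (1 - x) - k)"
  let ?g = "\<lambda>x::real. x / ((1 - x) * y)"
  let ?g' = "\<lambda>x::real. 1 / ((1 - x) ^ 2 * y)"
  have "has_bochner_integral lborel (\<lambda>x. y powr (-a) * (indicator {0<..<1} x * ?w x)) (y powr (-a) * 0)"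
    using beta_log_odds[OF assms(1,2)] unfolding k_def
    by (intro has_bochner_integral_mult_right) simp
  then have "has_bochner_integral lebesgue (\<lambda>x. indicator {0<..<1} x *\<^sub>R (y powr (-a) * ?w x)) 0"
    by (subst has_bochner_integral_lebesgue_iff) (simp_all add: mult_ac)
  then have ai: "(\<lambda>x. y powr (-a) * ?w x) absolutely_integrable_on {0<..<1}"
    and ie: "integral {0<..<1} (\<lambda>x. y powr (-a) * ?w x) = 0"
  proof -
    assume h: "has_bochner_integral lebesgue (\<lambda>x. indicator {0<..<1} x *\<^sub>R (y powr (-a) * ?w x)) 0"
    show ai: "(\<lambda>x. y powr (-a) * ?w x) absolutely_integrable_on {0<..<1}"
      unfolding set_integrable_def using h by (simp only: has_bochner_integral_iff)
    show "integral {0<..<1} (\<lambda>x. y powr (-a) * ?w x) = 0"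
      using set_lebesgue_integral_eq_integral(2)[OF ai] h
      unfolding set_lebesgue_integral_def by (simp only: has_bochner_integral_iff)
  qed
  have eq: "\<bar>?g' x\<bar> * ?f (?g x) = y powr (-a) * ?w x" if "x \<in> {0<..<1}" for x
  proof -
    have x: "0 < x" "x < 1" using that by auto
    have l: "ln (y * ?g x) = ln x - ln (1 - x)" using x assms by (simp add: ln_div)
    have d: "1 + y * ?g x = 1 / (1 - x)" using x assms by (simp add: field_simps)
    have "(?g x) powr (a - 1) = x powr (a - 1) / ((1 - x) powr (a - 1) * y powr (a - 1))"
      using x assms by (simp add: powr_divide powr_mult)
    also have "\<dots> = x powr (a - 1) * ((1 - x) powr (-a) * (1 - x)) * (y powr (-a) * y)"
      using x assms by (simp add: powr_diff powr_minus_divide)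
    finally show ?thesis unfolding l d using x assms
      by (simp add: power2_eq_square)
  qed
  have "(\<lambda>x. \<bar>?g' x\<bar> * ?f (?g x)) absolutely_integrable_on {0<..<1}
      \<and> integral {0<..<1} (\<lambda>x. \<bar>?g' x\<bar> * ?f (?g x)) = 0"
  proof
    show "(\<lambda>x. \<bar>?g' x\<bar> * ?f (?g x)) absolutely_integrable_on {0<..<1}"
      by (rule set_integrable_cong[OF refl refl eq, THEN iffD2, OF _ ai])
    show "integral {0<..<1} (\<lambda>x. \<bar>?g' x\<bar> * ?f (?g x)) = 0"
    proof -
      have "integral {0<..<1} (\<lambda>x. \<bar>?g' x\<bar> * ?f (?g x)) = integral {0<..<1} (\<lambda>x. y powr (-a) * ?w x)"
        by (rule Henstock_Kurzweil_Integration.integral_cong) (rule eq)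
      then show ?thesis by (simp only: ie)
    qed
  qed
  moreover have "(?g has_field_derivative ?g' x) (at x within {0<..<1})" if "x \<in> {0<..<1}" for x
  proof -
    have "(?g has_field_derivative (1 * ((1 - x) * y) - x * (- 1 * y)) / ((1 - x) * y * ((1 - x) * y))) (at x within {0<..<1})"
      using that assms by (auto intro!: derivative_eq_intros)
    moreover have "(1 * ((1 - x) * y) - x * (- 1 * y)) / ((1 - x) * y * ((1 - x) * y)) = ?g' x"
      using that assms by (simp add: divide_simps power2_eq_square) (simp add: algebra_simps)
    ultimately show ?thesis by simp
  qed
  moreover have "inj_on ?g {0<..<1}"
    using assms by (auto simp: inj_on_def field_simps)
  ultimately have "?f absolutely_integrable_on ?g ` {0<..<1} \<and> integral (?g ` {0<..<1}) ?f = 0"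
    by (subst (asm) has_absolute_integral_change_of_variables_1') auto
  moreover have "?g ` {0<..<1} = {0<..}"
  proof
    show "?g ` {0<..<1} \<subseteq> {0<..}" using assms by auto
    show "{0<..} \<subseteq> ?g ` {0<..<1}"
    proof
      fix t :: real assume t: "t \<in> {0<..}"
      define u where "u = 1 + y * t"
      have u: "u > 0" unfolding u_def using t assms by (intro add_pos_pos mult_pos_pos) auto
      have "1 - y * t / u = 1 / u" using u by (simp add: divide_simps) (simp add: u_def)
      then have "t = ?g (y * t / u)" using t assms u by simp
      moreover have "y * t / u \<in> {0<..<1}" using t assms u by (simp add: u_def)
      ultimately show "t \<in> ?g ` {0<..<1}" by blast
    qed
  qed
  ultimately have f: "?f absolutely_integrable_on {0<..}" "integral {0<..} ?f = 0" by simp_all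
  then have "has_bochner_integral lebesgue (\<lambda>t. indicator {0<..} t *\<^sub>R ?f t) 0"
    using set_lebesgue_integral_eq_integral(2)[OF f(1)]
    by (auto simp: set_integrable_def set_lebesgue_integral_def has_bochner_integral_iff)
  then show ?thesis unfolding k_def
    by (subst (asm) has_bochner_integral_lebesgue_iff) simp_all
qed

text \<open>
  Let \<open>f\<close> be the integrand without density; it changes sign from negative to positive at \<open>t\<^sub>0\<close>. As the
  kernel \<open>k\<close> decreases, \<open>f(t) k(t) \<le> f(t) k(t\<^sub>0)\<close> on the unit interval. Integrating against \<open>t\<^bsup>a-1\<^esup>\<close>, and
  enlarging the range to the half-line, where the added part is nonnegative, gives the bound \<open>0\<close>.
  If \<open>t\<^sub>0 \<ge> 1\<close>, then \<open>f\<close> is nonpositive on the whole unit interval.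
\<close>

lemma log_mean_le_pair:
  assumes "0 < a" "a \<le> 1 / 2"
  shows "log_mean_le (pair_measure a) (- pi * cot (pi * a))"
  unfolding log_mean_le_def
proof (intro allI impI)
  fix y :: real assume y: "y > 0"
  define k where "k = - pi * cot (pi * a)"
  define t0 where "t0 = exp k / y"
  define C where "C = 1 / (Gamma a * Gamma (1 - a)) ^ 2"
  define K where "K = (if t0 < 1 then enn2real (pair_kernel a t0) else 0)"
  let ?f = "\<lambda>t. (ln (y * t) - k) / (1 + y * t)"
  have G: "Gamma a > 0" "Gamma (1 - a) > 0" using assms by (auto intro!: Gamma_real_pos)
  have C: "C > 0" using G by (simp add: C_def)
  have t0: "t0 > 0" using y by (simp add: t0_def)
  have lnt0: "ln (y * t0) = k" using y by (simp add: t0_def)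
  have sign: "?f t \<ge> 0 \<longleftrightarrow> t \<ge> t0" if "t > 0" for t
  proof -
    have "?f t \<ge> 0 \<longleftrightarrow> ln (y * t) \<ge> ln (y * t0)"
    proof -
      have "1 + y * t > 0" using that y by (intro add_pos_pos mult_pos_pos) auto
      then show ?thesis using lnt0 by (simp add: zero_le_divide_iff not_le)
    qed
    also have "\<dots> \<longleftrightarrow> t \<ge> t0" using that y t0 by simp
    finally show ?thesis .
  qed
  have zero: "has_bochner_integral lborel (\<lambda>t. indicator {0<..} t * (?f t * t powr (a - 1))) 0"
    using log_mellin_zero[of a y] assms y by (simp add: k_def)
  have int: "integrable (pair_measure a) ?f"
    by (rule mellin_rep_integrable_log_quotient[OF mellin_rep_pair[OF assms] y])
  have "(\<integral>t. ?f t \<partial>pair_measure a) = (\<integral>t. pair_density a t * ?f t \<partial>lborel)"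
    unfolding pair_measure_def by (subst integral_density) (auto simp: pair_density_nonneg)
  also have "\<dots> \<le> (\<integral>t. C * K * (indicator {0<..} t * (?f t * t powr (a - 1))) \<partial>lborel)"
  proof (rule integral_mono)
    show "integrable lborel (\<lambda>t. pair_density a t * ?f t)"
      using int unfolding pair_measure_def
      by (subst (asm) integrable_density) (auto simp: pair_density_nonneg)
    show "integrable lborel (\<lambda>t. C * K * (indicator {0<..} t * (?f t * t powr (a - 1))))"
      using zero by (intro integrable_mult_right) (auto simp: has_bochner_integral_iff)
    fix t :: real
    have K0: "K \<ge> 0" by (simp add: K_def)
    show "pair_density a t * ?f t \<le> C * K * (indicator {0<..} t * (?f t * t powr (a - 1)))"
    proof (cases "0 < t \<and> t < 1")
      case False
      then consider "t \<le> 0" | "t \<ge> 1" by linarith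
      then show ?thesis
      proof cases
        case 2
        have "K * ?f t \<ge> 0"
        proof (cases "t0 < 1")
          case True
          then show ?thesis using K0 sign[of t] 2 by (intro mult_nonneg_nonneg) auto
        qed (simp add: K_def)
        from mult_nonneg_nonneg[OF mult_nonneg_nonneg[OF less_imp_le[OF C] this] powr_ge_zero[of t "a - 1"]]
        show ?thesis using 2 by (simp add: pair_density_def mult_ac)
      qed (auto simp: pair_density_def)
    next
      case True
      have fin: "pair_kernel a s < top" if "0 < s" "s < 1" for s
        using pair_kernel_finite[of a s] assms that by (simp add: less_top)
      have "enn2real (pair_kernel a t) * ?f t \<le> K * ?f t"
      proof (cases "t \<ge> t0")
        case ge: True
        then have "enn2real (pair_kernel a t) \<le> K"
          using True t0 assms fin[of t0] pair_kernel_antimono[of a t0 t]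
          by (auto simp: K_def intro!: enn2real_mono)
        then show ?thesis using sign[of t] True ge by (intro mult_right_mono) auto
      next
        case False
        then have "K \<le> enn2real (pair_kernel a t)"
          using True t0 assms fin[of t] pair_kernel_antimono[of a t t0]
          by (auto simp: K_def intro!: enn2real_mono)
        then show ?thesis using sign[of t] True False by (intro mult_right_mono_neg) auto
      qed
      then have "C * t powr (a - 1) * (enn2real (pair_kernel a t) * ?f t) \<le> C * t powr (a - 1) * (K * ?f t)"
        using C by (intro mult_left_mono) auto
      then show ?thesis using True by (simp add: pair_density_def C_def mult_ac)
    qed
  qed
  also have "\<dots> = 0"
    using zero unfolding has_bochner_integral_iff
    by (simp only: integral_mult_right_zero mult_zero_right)
  finally show "(\<integral>t. (ln (y * t) - - pi * cot (pi * a)) / (1 + y * t) \<partial>pair_measure a) \<le> 0"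
    by (simp add: k_def)
qed

lemma exists_log_mean_le_measure:
  assumes "0 < a" "a \<le> 1 / 2" "\<And>b. b \<in># A \<Longrightarrow> a \<le> b \<and> b < 1"
  shows "\<exists>\<mu>. mellin_rep \<mu> ({#a, 1 - a#} + A) a \<and> log_mean_le \<mu> (- pi * cot (pi * a))"
  using assms(3)
proof (induction A)
  case empty
  then show ?case using mellin_rep_pair log_mean_le_pair assms by auto
next
  case (add b A)
  then obtain \<mu> where \<mu>: "mellin_rep \<mu> ({#a, 1 - a#} + A) a" "log_mean_le \<mu> (- pi * cot (pi * a))" by auto
  have b: "mellin_rep (beta_measure b) {#b#} a" using add.prems[of b] assms by (intro mellin_rep_beta) auto
  have "mellin_rep (mconv \<mu> (beta_measure b)) ({#a, 1 - a#} + A + {#b#}) a"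
    by (rule mellin_rep_mconv[OF \<mu>(1) b])
  moreover have "log_mean_le (mconv \<mu> (beta_measure b)) (- pi * cot (pi * a))"
    by (rule log_mean_le_mconv[OF \<mu>(1) b \<mu>(2)])
  ultimately show ?case by auto
qed

section \<open>Complexified power series and Stieltjes transforms\<close>

text \<open>
  Holomorphic continuation needs complex arguments, so real power series are viewed as complex ones.
\<close>

definition cfps :: "real fps \<Rightarrow> complex fps" where
  "cfps f = Abs_fps (\<lambda>n. complex_of_real (fps_nth f n))"

lemma cfps_nth [simp]: "fps_nth (cfps f) n = complex_of_real (fps_nth f n)"
  by (simp add: cfps_def)

lemma cfps_mult: "cfps (f * g) = cfps f * cfps g"
  by (simp add: fps_eq_iff fps_mult_nth)

lemma cfps_1 [simp]: "cfps 1 = 1" by (simp add: fps_eq_iff)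

lemma cfps_X [simp]: "cfps fps_X = fps_X" by (simp add: fps_eq_iff fps_X_def)

lemma cfps_exp [simp]: "cfps (fps_exp c) = fps_exp (complex_of_real c)"
  by (simp add: fps_eq_iff)

lemma cfps_power: "cfps (f ^ n) = cfps f ^ n"
  by (induction n) (simp_all add: cfps_mult)

lemma cfps_compose: "cfps (f oo g) = cfps f oo cfps g"
  by (simp add: fps_eq_iff fps_compose_nth cfps_power[symmetric])

lemma cfps_divide:
  assumes "fps_nth g 0 \<noteq> 0"
  shows "cfps (f / g) = cfps f / cfps g"
proof -
  have "(f / g) * g = f" using assms by (simp add: fps_divide_unit inverse_mult_eq_1 mult.assoc)
  then have "cfps (f / g) * cfps g = cfps f" by (simp add: cfps_mult[symmetric])
  moreover have "cfps g \<noteq> 0" using assms by (auto simp: fps_eq_iff)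
  ultimately show ?thesis by (metis nonzero_mult_div_cancel_right)
qed

lemma conv_radius_cfps [simp]: "fps_conv_radius (cfps f) = fps_conv_radius f"
proof -
  have "conv_radius (fps_nth (cfps f)) = conv_radius (\<lambda>n. norm (fps_nth (cfps f) n))"
    by (rule conv_radius_norm[symmetric])
  also have "\<dots> = conv_radius (\<lambda>n. norm (fps_nth f n))" by simp
  also have "\<dots> = conv_radius (fps_nth f)" by (rule conv_radius_norm)
  finally show ?thesis by (simp add: fps_conv_radius_def)
qed

lemma eval_cfps_of_real:
  assumes "summable (\<lambda>n. fps_nth f n * x ^ n)"
  shows "eval_fps (cfps f) (complex_of_real x) = complex_of_real (eval_fps f x)"
  using suminf_of_real[OF assms, where 'a = complex] by (simp add: eval_fps_def)

lemma cfps_canonical_coord: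
  "cfps (canonical_coord Ns) = fps_X * (fps_exp 1 oo (cfps (G_of Ns) / cfps (F_of Ns)))"
  by (simp add: canonical_coord_def cfps_mult cfps_compose cfps_divide)

lemma cfps_mirror_map: "cfps (mirror_map Ns) oo cfps (canonical_coord Ns) = fps_X"
  by (simp add: cfps_compose[symmetric] mirror_map_inverse)

lemma one_plus_mult_ge:
  assumes "0 < t" "t \<le> (1 :: real)"
  shows "min 1 (1 + x) \<le> 1 + x * t"
proof (cases "x \<ge> 0")
  case False
  then have "x * 1 \<le> x * t" using assms by (intro mult_left_mono_neg) auto
  then show ?thesis by simp
qed (use assms in simp)

lemma norm_one_plus_ge:
  fixes y :: complex and t :: real
  assumes "0 < t" "t \<le> 1"
  shows "norm (1 + y * of_real t) \<ge> min 1 (1 + Re y)"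
proof -
  have "min 1 (1 + Re y) \<le> 1 + Re y * t" by (rule one_plus_mult_ge[OF assms])
  also have "1 + Re y * t = Re (1 + y * of_real t)" by simp
  also have "\<dots> \<le> norm (1 + y * of_real t)" by (rule complex_Re_le_cmod)
  finally show ?thesis .
qed

lemma norm_integral_le_AE:
  fixes f :: "'a \<Rightarrow> 'b::{banach,second_countable_topology}" and g :: "'a \<Rightarrow> real"
  assumes "integrable M f" "integrable M g" "AE x in M. norm (f x) \<le> g x"
  shows "norm (\<integral>x. f x \<partial>M) \<le> (\<integral>x. g x \<partial>M)"
proof -
  have "norm (\<integral>x. f x \<partial>M) \<le> (\<integral>x. norm (f x) \<partial>M)" by (rule integral_norm_bound)
  also have "\<dots> \<le> (\<integral>x. g x \<partial>M)" using assms by (intro integral_mono_AE integrable_norm) auto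
  finally show ?thesis .
qed

locale unit_interval_measure = finite_measure \<mu> for \<mu> :: "real measure" +
  assumes sets_borel [measurable_cong]: "sets \<mu> = sets borel"
    and AE_unit: "AE t in \<mu>. 0 < t \<and> t \<le> 1"
begin

definition stieltjes :: "(real \<Rightarrow> real) \<Rightarrow> complex \<Rightarrow> complex" where
  "stieltjes g y = (\<integral>t. of_real (g t) / (1 + y * of_real t) \<partial>\<mu>)"

lemma integrable_stieltjes:
  fixes g :: "real \<Rightarrow> real"
  assumes "integrable \<mu> g" "Re y > -1"
  shows "integrable \<mu> (\<lambda>t. complex_of_real (g t) / (1 + y * of_real t))"
proof -
  have [measurable]: "g \<in> borel_measurable \<mu>" using assms(1) by (rule borel_measurable_integrable)
  define d where "d = min 1 (1 + Re y)"
  have d: "d > 0" using assms by (simp add: d_def)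
  have "integrable \<mu> (\<lambda>t. g t / d)" using assms(1) by simp
  then show ?thesis
  proof (rule Bochner_Integration.integrable_bound)
    show "AE t in \<mu>. norm (complex_of_real (g t) / (1 + y * of_real t)) \<le> norm (g t / d)"
      using AE_unit
    proof eventually_elim
      case (elim t)
      then show ?case using norm_one_plus_ge[of t y] d
        by (auto simp: norm_divide d_def[symmetric] intro!: divide_left_mono mult_pos_pos)
    qed
  qed measurable
qed

text \<open>
  The difference quotient minus the formal derivative equals \<open>y - y\<^sub>0\<close> times an integral that is bounded
  near \<open>y\<^sub>0\<close>, because \<open>1 + y t\<close> stays away from \<open>0\<close>.
\<close>

lemma holomorphic_stieltjes:
  assumes "integrable \<mu> g"
  shows "stieltjes g holomorphic_on {y. Re y > -1}"
proof -
  have [measurable]: "g \<in> borel_measurable \<mu>" using assms by (rule borel_measurable_integrable)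
  have "\<exists>D. (stieltjes g has_field_derivative D) (at y0)" if y0: "Re y0 > -1" for y0
  proof -
    let ?q = "\<lambda>t. - (complex_of_real (g t) * of_real t) / (1 + y0 * of_real t) ^ 2"
    let ?E = "\<lambda>y t. (of_real (g t) / (1 + y * of_real t) - of_real (g t) / (1 + y0 * of_real t)) / (y - y0) - ?q t"
    define d where "d = min 1 (1 + Re y0) / 2"
    have d: "d > 0" using y0 by (simp add: d_def)
    have near: "norm (1 + y * of_real t) \<ge> d" if "norm (y - y0) < d" "0 < t" "t \<le> 1" for y t
    proof -
      have "\<bar>Re (y - y0)\<bar> < d" using that(1) abs_Re_le_cmod[of "y - y0"] by linarith
      moreover have "d \<le> 1 / 2" "d \<le> (1 + Re y0) / 2" by (auto simp: d_def)
      ultimately have "d \<le> min 1 (1 + Re y)" by simp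
      then show ?thesis using norm_one_plus_ge[OF that(2,3), of y] by linarith
    qed
    have near0: "norm (1 + y0 * of_real t) \<ge> d" if "0 < t" "t \<le> 1" for t
      using near[of y0 t] that d by simp
    have int2: "integrable \<mu> (\<lambda>t. ?q t)"
    proof (rule Bochner_Integration.integrable_bound)
      show "integrable \<mu> (\<lambda>t. g t / d ^ 2)" using assms by simp
      show "AE t in \<mu>. norm (?q t) \<le> norm (g t / d ^ 2)"
        using AE_unit
      proof eventually_elim
        case (elim t)
        have "\<bar>g t\<bar> * t / norm (1 + y0 * of_real t) ^ 2 \<le> \<bar>g t\<bar> * 1 / d ^ 2"
          using near0[of t] elim d by (intro frac_le mult_left_mono power_mono) auto
        then show ?case using elim by (simp add: norm_divide norm_mult norm_power)
      qed
    qed measurable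
    define D where "D = (\<integral>t. ?q t \<partial>\<mu>)"
    \<comment> \<open>The integrand of the error is at most \<open>\<bar>g t\<bar> t\<^sup>2 / (\<bar>1 + y t\<bar> \<bar>1 + y\<^sub>0 t\<bar>\<^sup>2)\<close> times \<open>\<bar>y - y\<^sub>0\<bar>\<close>.\<close>
    define K where "K = (\<integral>t. \<bar>g t\<bar> / d ^ 3 \<partial>\<mu>)"
    have bound: "norm ((stieltjes g y - stieltjes g y0) / (y - y0) - D) \<le> K * norm (y - y0)"
      if y: "norm (y - y0) < d" "y \<noteq> y0" for y
    proof -
      have Rey: "Re y > -1"
      proof -
        have "\<bar>Re (y - y0)\<bar> < d" using y(1) abs_Re_le_cmod[of "y - y0"] by linarith
        then have "- d < Re y - Re y0" by auto
        moreover have "2 * d \<le> 1 + Re y0" by (simp add: d_def)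
        ultimately have "2 * Re y > - 2" using y0 by argo
        then show ?thesis by simp
      qed
      have eq: "(stieltjes g y - stieltjes g y0) / (y - y0) - D
        = (\<integral>t. ?E y t \<partial>\<mu>)"
        unfolding stieltjes_def D_def
        using integrable_stieltjes[OF assms Rey] integrable_stieltjes[OF assms y0] int2 by simp
      have "norm ((stieltjes g y - stieltjes g y0) / (y - y0) - D) \<le> (\<integral>t. norm (y - y0) * (\<bar>g t\<bar> / d ^ 3) \<partial>\<mu>)"
        unfolding eq
      proof (rule norm_integral_le_AE)
        show "integrable \<mu> (\<lambda>t. ?E y t)"
          using integrable_stieltjes[OF assms Rey] integrable_stieltjes[OF assms y0] int2
          by (intro Bochner_Integration.integrable_diff integrable_divide) auto
        show "integrable \<mu> (\<lambda>t. norm (y - y0) * (\<bar>g t\<bar> / d ^ 3))" using assms by simp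
        show "AE t in \<mu>. norm (?E y t) \<le> norm (y - y0) * (\<bar>g t\<bar> / d ^ 3)"
          using AE_unit
        proof eventually_elim
          case (elim t)
          define u where "u = 1 + y * of_real t"
          define v where "v = 1 + y0 * complex_of_real t"
          have nu: "norm u \<ge> d" "norm v \<ge> d" unfolding u_def v_def using near near0 elim y by auto
          then have nz: "u \<noteq> 0" "v \<noteq> 0" using d by auto
          have uv: "u - v = (y - y0) * of_real t" by (simp add: u_def v_def algebra_simps)
          have "(of_real (g t) / u - of_real (g t) / v) / (y - y0) = of_real (g t) * ((v - u) / (y - y0)) / (u * v)"
            using nz by (simp add: field_simps)
          also have "(v - u) / (y - y0) = - of_real t"
            using uv y(2) by (metis minus_diff_eq minus_divide_left nonzero_mult_div_cancel_left right_minus_eq)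
          finally have e1: "(of_real (g t) / u - of_real (g t) / v) / (y - y0) = - (of_real (g t) * of_real t) / (u * v)"
            by simp
          have "(of_real (g t) / u - of_real (g t) / v) / (y - y0) - (- (complex_of_real (g t) * of_real t) / v ^ 2)
            = of_real (g t) * of_real t * (u - v) / (u * v ^ 2)"
            unfolding e1 using nz by (simp add: field_simps power2_eq_square)
          also have "\<dots> = (y - y0) * (of_real (g t) * of_real t ^ 2 / (u * v ^ 2))"
            unfolding uv by (simp add: power2_eq_square)
          finally have "norm ((of_real (g t) / u - of_real (g t) / v) / (y - y0) - (- (complex_of_real (g t) * of_real t) / v ^ 2))
            = norm (y - y0) * (\<bar>g t\<bar> * t ^ 2 / (norm u * norm v ^ 2))"
            using elim by (simp add: norm_mult norm_divide norm_power)
          also have "\<dots> \<le> norm (y - y0) * (\<bar>g t\<bar> * 1 / (d * d ^ 2))"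
            using nu d elim by (intro mult_left_mono frac_le mult_mono power_mono)
              (auto simp: power_le_one)
          finally have "norm ((of_real (g t) / u - of_real (g t) / v) / (y - y0) - (- (complex_of_real (g t) * of_real t) / v ^ 2))
            \<le> norm (y - y0) * (\<bar>g t\<bar> * 1 / (d * d ^ 2))" .
          moreover have "d * d ^ 2 = d ^ 3" by (simp add: power3_eq_cube power2_eq_square)
          ultimately show ?case by (simp only: u_def v_def mult_1_right)
        qed
      qed
      then show ?thesis using d by (simp add: K_def mult.commute)
    qed
    have "((\<lambda>y. (stieltjes g y - stieltjes g y0) / (y - y0) - D) \<longlongrightarrow> 0) (at y0)"
    proof (rule Lim_null_comparison)
      show "\<forall>\<^sub>F y in at y0. norm ((stieltjes g y - stieltjes g y0) / (y - y0) - D) \<le> K * norm (y - y0)"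
        unfolding eventually_at using bound d by (auto simp: dist_norm intro!: exI[of _ d])
      have "((\<lambda>y. K * norm (y - y0)) \<longlongrightarrow> K * norm (y0 - y0)) (at y0)" by (intro tendsto_intros)
      then show "((\<lambda>y. K * norm (y - y0)) \<longlongrightarrow> 0) (at y0)" by simp
    qed
    then have "((\<lambda>y. (stieltjes g y - stieltjes g y0) / (y - y0)) \<longlongrightarrow> D) (at y0)"
      by (simp add: LIM_zero_iff)
    then show ?thesis by (auto simp: has_field_derivative_iff)
  qed
  then show ?thesis
    by (subst holomorphic_on_open) (auto simp: open_halfspace_Re_gt)
qed

text \<open>
  Expanding \<open>1 / (1 + y t)\<close> as a finite geometric sum leaves a remainder of size \<open>\<bar>y\<bar>\<^sup>n\<close>.
\<close>

lemma stieltjes_sums: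
  assumes "integrable \<mu> g" "norm y < 1"
  shows "(\<lambda>m. of_real (\<integral>t. t ^ m * g t \<partial>\<mu>) * (- y) ^ m) sums stieltjes g y"
proof -
  let ?S = "\<lambda>n. \<Sum>m<n. of_real (\<integral>t. t ^ m * g t \<partial>\<mu>) * (- y) ^ m"
  let ?P = "\<lambda>n t. \<Sum>m<n. complex_of_real (t ^ m * g t) * (- y) ^ m"
  have [measurable]: "g \<in> borel_measurable \<mu>" using assms(1) by (rule borel_measurable_integrable)
  have Rey: "Re y > -1" using assms(2) abs_Re_le_cmod[of y] by linarith
  have int: "integrable \<mu> (\<lambda>t. t ^ m * g t)" for m
  proof (rule Bochner_Integration.integrable_bound[OF assms(1)])
    show "AE t in \<mu>. norm (t ^ m * g t) \<le> norm (g t)"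
      using AE_unit by eventually_elim (auto simp: abs_mult power_le_one intro!: mult_left_le_one_le)
  qed measurable
  have ge: "norm (1 + y * of_real t) \<ge> 1 - norm y" if "0 < t" "t \<le> 1" for t
  proof -
    have "norm (y * of_real t) \<le> norm y * 1" using that by (simp add: norm_mult mult_left_le)
    then show ?thesis using norm_diff_ineq[of 1 "y * of_real t"] by simp
  qed
  have bound: "norm (?S n - stieltjes g y)
      \<le> (\<integral>t. \<bar>g t\<bar> \<partial>\<mu>) / (1 - norm y) * norm y ^ n" for n
  proof -
    have "?S n - stieltjes g y
       = (\<integral>t. ?P n t - of_real (g t) / (1 + y * of_real t) \<partial>\<mu>)"
      unfolding stieltjes_def
      using int integrable_stieltjes[OF assms(1) Rey]
      by (subst Bochner_Integration.integral_diff) (auto simp: Bochner_Integration.integral_sum simp del: of_real_mult of_real_power)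
    also have "norm \<dots> \<le> (\<integral>t. \<bar>g t\<bar> * (norm y ^ n / (1 - norm y)) \<partial>\<mu>)"
    proof (rule norm_integral_le_AE)
      show "integrable \<mu> (\<lambda>t. ?P n t - of_real (g t) / (1 + y * of_real t))"
        using int integrable_stieltjes[OF assms(1) Rey]
        by (intro Bochner_Integration.integrable_diff Bochner_Integration.integrable_sum integrable_mult_left integrable_of_real) auto
      show "integrable \<mu> (\<lambda>t. \<bar>g t\<bar> * (norm y ^ n / (1 - norm y)))" using assms(1) by simp
      show "AE t in \<mu>. norm (?P n t - of_real (g t) / (1 + y * of_real t))
          \<le> \<bar>g t\<bar> * (norm y ^ n / (1 - norm y))"
        using AE_unit
      proof eventually_elim
        case (elim t)
        have nz: "1 + y * of_real t \<noteq> 0" using ge[of t] elim assms(2) by auto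
        have "?P n t = of_real (g t) * (\<Sum>m<n. (- y * of_real t) ^ m)"
          by (simp only: sum_distrib_left power_mult_distrib of_real_mult of_real_power mult_ac)
        also have "(\<Sum>m<n. (- y * of_real t) ^ m) = (1 - (- y * of_real t) ^ n) / (1 + y * of_real t)"
        proof -
          have "- y * of_real t \<noteq> 1"
          proof
            assume *: "- y * of_real t = 1"
            have "1 + y * of_real t = 1 - (- y * of_real t)" by simp
            then show False using nz unfolding * by simp
          qed
          then show ?thesis by (subst sum_gp_strict) auto
        qed
        finally have "?P n t - of_real (g t) / (1 + y * of_real t)
          = - (of_real (g t) * (- y * of_real t) ^ n / (1 + y * of_real t))"
          by (simp only:) (simp add: right_diff_distrib diff_divide_distrib)
        then have "norm (?P n t - of_real (g t) / (1 + y * of_real t))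
          = \<bar>g t\<bar> * ((norm y * t) ^ n / norm (1 + y * of_real t))"
          using elim by (simp add: norm_divide norm_mult norm_power)
        also have "\<dots> \<le> \<bar>g t\<bar> * (norm y ^ n / (1 - norm y))"
          using ge[of t] elim assms(2)
          by (intro mult_left_mono frac_le power_mono) (auto intro!: mult_left_le)
        finally show ?case .
      qed
    qed
    also have "\<dots> = (\<integral>t. \<bar>g t\<bar> \<partial>\<mu>) / (1 - norm y) * norm y ^ n" by simp
    finally show ?thesis .
  qed
  have "(\<lambda>n. ?S n - stieltjes g y) \<longlonglongrightarrow> 0"
  proof (rule Lim_null_comparison)
    show "\<forall>\<^sub>F n in sequentially. norm (?S n - stieltjes g y)
      \<le> (\<integral>t. \<bar>g t\<bar> \<partial>\<mu>) / (1 - norm y) * norm y ^ n" using bound by simp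
    show "(\<lambda>n. (\<integral>t. \<bar>g t\<bar> \<partial>\<mu>) / (1 - norm y) * norm y ^ n) \<longlonglongrightarrow> 0"
      using assms(2) by (intro tendsto_mult_right_zero LIMSEQ_power_zero) auto
  qed
  then show ?thesis unfolding sums_def by (simp add: LIM_zero_iff)
qed

lemma stieltjes_of_real:
  "stieltjes g (of_real y) = of_real (\<integral>t. g t / (1 + y * t) \<partial>\<mu>)"
proof -
  have "complex_of_real (g t) / (1 + of_real y * of_real t) = of_real (g t / (1 + y * t))" for t by simp
  then have "stieltjes g (of_real y) = (\<integral>t. complex_of_real (g t / (1 + y * t)) \<partial>\<mu>)"
    unfolding stieltjes_def by (simp only:)
  then show ?thesis by (simp only: integral_complex_of_real)
qed

lemma integrable_stieltjes_real:
  assumes "integrable \<mu> g" "y > -1"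
  shows "integrable \<mu> (\<lambda>t. g t / (1 + y * t))"
proof -
  have eq: "complex_of_real (g t) / (1 + of_real y * of_real t) = of_real (g t / (1 + y * t))" for t by simp
  have "integrable \<mu> (\<lambda>t. complex_of_real (g t / (1 + y * t)))"
    using integrable_stieltjes[OF assms(1), of "of_real y"] assms(2) unfolding eq by simp
  then show ?thesis by (simp only: complex_of_real_integrable_eq)
qed

text \<open>
  The values \<open>1 / (1 + y t)\<close> lie in the right half-plane. The lemma guarantees that the denominator of
  the continued \<open>G / F\<close> does not vanish.
\<close>

lemma Re_stieltjes_1_pos:
  assumes "Re y > -1" "emeasure \<mu> (space \<mu>) \<noteq> 0"
  shows "Re (stieltjes (\<lambda>_. 1) y) > 0"
proof -
  define c where "c = min 1 (1 + Re y) / (1 + norm y) ^ 2"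
  have c: "c > 0" unfolding c_def using assms by (auto intro!: divide_pos_pos zero_less_power add_pos_nonneg)
  have int: "integrable \<mu> (\<lambda>t. complex_of_real 1 / (1 + y * of_real t))"
    by (rule integrable_stieltjes) (use assms in auto)
  have "0 < c * measure \<mu> (space \<mu>)"
    using c assms(2) by (simp add: measure_eq_emeasure_eq_ennreal zero_less_measure_iff emeasure_eq_measure)
  also have "\<dots> = (\<integral>t. c \<partial>\<mu>)" by simp
  also have "\<dots> \<le> (\<integral>t. Re (complex_of_real 1 / (1 + y * of_real t)) \<partial>\<mu>)"
  proof (rule integral_mono_AE)
    show "integrable \<mu> (\<lambda>t. Re (complex_of_real 1 / (1 + y * of_real t)))" using int by (rule integrable_Re)
    show "AE t in \<mu>. c \<le> Re (complex_of_real 1 / (1 + y * of_real t))"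
      using AE_unit
    proof eventually_elim
      case (elim t)
      have nz: "norm (1 + y * of_real t) > 0" using norm_one_plus_ge[of t y] elim assms by auto
      have "norm (1 + y * of_real t) \<le> 1 + norm y * t"
        using norm_triangle_ineq[of 1 "y * of_real t"] elim by (simp add: norm_mult)
      also have "\<dots> \<le> 1 + norm y" using elim by (simp add: mult_left_le)
      finally have up: "norm (1 + y * of_real t) \<le> 1 + norm y" .
      have re: "min 1 (1 + Re y) \<le> 1 + Re y * t" using elim by (intro one_plus_mult_ge) auto
      have "c \<le> (1 + Re y * t) / norm (1 + y * of_real t) ^ 2"
        unfolding c_def using re up nz assms by (intro frac_le power_mono) auto
      also have "\<dots> = Re (complex_of_real 1 / (1 + y * of_real t))"
        by (simp add: Re_divide cmod_power2)
      finally show ?case .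
    qed
  qed auto
  also have "\<dots> = Re (stieltjes (\<lambda>_. 1) y)"
    unfolding stieltjes_def using int by (simp add: integral_Re)
  finally show ?thesis .
qed

end

lemma mellin_rep_unit_interval_measure:
  assumes "mellin_rep \<mu> A e"
  shows "unit_interval_measure \<mu>"
proof -
  interpret finite_measure \<mu> using assms by (rule mellin_rep_finite_measure)
  show ?thesis by unfold_locales (use mellin_repD[OF assms] in auto)
qed

section \<open>Continuation of the canonical coordinate along the negative axis\<close>

lemma F_of_eq: "fps_nth (F_of Ns) m = real (C_of Ns) ^ m * bcoef (params Ns) m"
  by (simp add: F_of_def B_of_eq_bcoef)

lemma G_of_eq: "fps_nth (G_of Ns) m = hcoef (params Ns) m * (real (C_of Ns) ^ m * bcoef (params Ns) m)"
  by (simp add: G_of_def B_of_eq_bcoef H_of_eq_hcoef)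

lemma params_pos:
  assumes "\<And>N. N \<in> set Ns \<Longrightarrow> N \<ge> 2" "a \<in># params Ns"
  shows "0 < a" "a < 1"
proof -
  have "Ns \<noteq> []" using assms(2) by (auto simp: params_def)
  then have "M_of Ns \<in> set Ns" unfolding M_of_def by (intro Max_in) auto
  then have "M_of Ns \<ge> 2" using assms by blast
  then have "0 < 1 / real (M_of Ns)" by simp
  also have "\<dots> \<le> a" using params_range[OF assms] by simp
  finally show "0 < a" .
  show "a < 1" using params_range[OF assms] by simp
qed

lemma psi_gap_params:
  assumes "\<And>N. N \<in> set Ns \<Longrightarrow> N \<ge> 2"
  shows "psi_gap (params Ns) = ln (real (C_of Ns))"
proof -
  have "hcoef (params Ns) \<longlonglongrightarrow> psi_gap (params Ns)"
    using params_pos[OF assms] by (intro hcoef_tendsto)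
  moreover have "hcoef (params Ns) = H_of Ns" by (auto simp: H_of_eq_hcoef)
  ultimately show ?thesis using H_of_tendsto(2)[of Ns] assms LIMSEQ_unique by metis
qed

text \<open>
  The function \<open>\<phi>\<close> in the proof is the continuation of the canonical coordinate to the half-plane
  \<open>Re z < 1 / C\<close>. As \<open>\<bar>\<phi>(-x)\<bar> \<le> exp k\<close> for all \<open>x \<ge> 0\<close>, a mirror map \<open>Z\<close> with larger radius of convergence
  satisfies \<open>Z(\<phi>(-x)) = -x\<close> on the whole negative axis, although \<open>Z\<close> is bounded on the disc of radius
  \<open>exp k\<close>.
\<close>

lemma conv_radius_mirror_le_of_log_mean:
  assumes Ns: "\<And>N. N \<in> set Ns \<Longrightarrow> N \<ge> 2"
    and rep: "mellin_rep \<mu> (params Ns) e" and mean: "log_mean_le \<mu> k"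
  shows "fps_conv_radius (mirror_map Ns) \<le> ereal (exp k)"
proof (rule ccontr)
  assume "\<not> fps_conv_radius (mirror_map Ns) \<le> ereal (exp k)"
  then have R: "fps_conv_radius (cfps (mirror_map Ns)) > ereal (exp k)" by simp
  interpret unit_interval_measure \<mu> using rep by (rule mellin_rep_unit_interval_measure)
  define A where "A = params Ns"
  define C where "C = real (C_of Ns)"
  define L where "L = ln C"
  define Z where "Z = eval_fps (cfps (mirror_map Ns))"
  have C: "C > 0" using H_of_tendsto(1)[of Ns] Ns by (simp add: C_def)
  have L: "psi_gap A = L" using psi_gap_params[OF Ns] by (simp add: A_def L_def C_def)
  have int1: "integrable \<mu> (\<lambda>_. 1 :: real)" by simp
  have intln: "integrable \<mu> ln" using mellin_rep_moments(3)[OF rep, of 0] by simp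
  define Fh where "Fh z = stieltjes (\<lambda>_. 1) (- of_real C * z)" for z
  define Gh where "Gh z = stieltjes ln (- of_real C * z)" for z
  let ?H = "{z. Re (- of_real C * z) > -1}"
  have prob: "emeasure \<mu> (space \<mu>) = 1" using rep by (rule mellin_rep_prob)
  have Fpos: "Re (Fh z) > 0" if "z \<in> ?H" for z
    unfolding Fh_def using that prob by (intro Re_stieltjes_1_pos) auto
  have F0: "Fh z \<noteq> 0" if "z \<in> ?H" for z using Fpos[OF that] by auto
  define phi where "phi z = z * exp (Gh z / Fh z + of_real L)" for z
  have openH: "open ?H"
    by (intro open_Collect_less continuous_intros)
  have hol: "Fh holomorphic_on ?H" "Gh holomorphic_on ?H"
    unfolding Fh_def[abs_def] Gh_def[abs_def]
    by (rule holomorphic_on_compose_gen[unfolded o_def, OF _ holomorphic_stieltjes[OF int1]],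
        (intro holomorphic_intros)[1], force,
        rule holomorphic_on_compose_gen[unfolded o_def, OF _ holomorphic_stieltjes[OF intln]],
        (intro holomorphic_intros)[1], force)
  have phihol: "phi holomorphic_on ?H"
    unfolding phi_def using hol F0 by (intro holomorphic_intros) auto
  have near0: "\<forall>\<^sub>F z in nhds 0. norm (- complex_of_real C * z) < 1"
  proof -
    have "((\<lambda>z. norm (- complex_of_real C * z)) \<longlongrightarrow> norm (- of_real C * 0 :: complex)) (nhds 0)"
      by (intro tendsto_intros filterlim_ident)
    then show ?thesis by (rule order_tendstoD(2)) simp
  qed
  have Fexp: "Fh has_fps_expansion cfps (F_of Ns)"
  proof (rule has_fps_expansionI)
    show "\<forall>\<^sub>F z in nhds 0. (\<lambda>m. fps_nth (cfps (F_of Ns)) m * z ^ m) sums Fh z"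
      using near0
    proof eventually_elim
      case (elim z)
      have "(\<integral>t. t ^ m * 1 \<partial>\<mu>) = bcoef A m" for m
        using mellin_rep_moments(2)[OF rep] by (simp add: A_def)
      then show ?case using stieltjes_sums[OF int1 elim]
        by (simp add: Fh_def F_of_eq A_def C_def power_mult_distrib mult_ac)
    qed
  qed
  have Gexp: "(\<lambda>z. Gh z + of_real L * Fh z) has_fps_expansion cfps (G_of Ns)"
  proof (rule has_fps_expansionI)
    show "\<forall>\<^sub>F z in nhds 0. (\<lambda>m. fps_nth (cfps (G_of Ns)) m * z ^ m)
        sums (Gh z + of_real L * Fh z)"
      using near0
    proof eventually_elim
      case (elim z)
      have 1: "(\<integral>t. t ^ m * 1 \<partial>\<mu>) = bcoef A m" for m
        using mellin_rep_moments(2)[OF rep] by (simp add: A_def)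
      have 2: "(\<integral>t. t ^ m * ln t \<partial>\<mu>) = bcoef A m * (hcoef A m - L)" for m
        using mellin_rep_moments(4)[OF rep] L by (simp add: A_def)
      have "(\<lambda>m. of_real (\<integral>t. t ^ m * ln t \<partial>\<mu>) * (- (- of_real C * z)) ^ m
          + of_real L * (of_real (\<integral>t. t ^ m * 1 \<partial>\<mu>) * (- (- of_real C * z)) ^ m))
          sums (Gh z + of_real L * Fh z)"
        unfolding Gh_def Fh_def by (intro sums_add sums_mult stieltjes_sums int1 intln elim)
      also have "(\<lambda>m. of_real (\<integral>t. t ^ m * ln t \<partial>\<mu>) * (- (- of_real C * z)) ^ m
          + of_real L * (of_real (\<integral>t. t ^ m * 1 \<partial>\<mu>) * (- (- of_real C * z)) ^ m))
          = (\<lambda>m. fps_nth (cfps (G_of Ns)) m * z ^ m)"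
        unfolding 1 2 by (auto simp: fun_eq_iff G_of_eq A_def C_def power_mult_distrib algebra_simps)
      finally show ?case .
    qed
  qed
  let ?h = "\<lambda>z. (Gh z + of_real L * Fh z) / Fh z"
  have "?h
      has_fps_expansion cfps (G_of Ns) / cfps (F_of Ns)"
    by (intro has_fps_expansion_divide' Fexp Gexp) simp
  then have "(exp \<circ> ?h)
      has_fps_expansion (fps_exp 1 oo (cfps (G_of Ns) / cfps (F_of Ns)))"
    using cfps_nth[of "G_of Ns / F_of Ns" 0] has_fps_expansion_exp1[where 'a = complex]
    by (intro has_fps_expansion_compose) (simp_all add: cfps_divide del: cfps_nth)
  then have "(\<lambda>z. z * (exp \<circ> ?h) z)
      has_fps_expansion cfps (canonical_coord Ns)"
    unfolding cfps_canonical_coord by (intro has_fps_expansion_mult has_fps_expansion_fps_X)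
  moreover have "\<forall>\<^sub>F z in nhds 0. z * (exp \<circ> ?h) z = phi z"
    using near0
  proof eventually_elim
    case (elim z)
    have "z \<in> ?H" unfolding mem_Collect_eq using elim abs_Re_le_cmod[of "- of_real C * z"] by linarith
    then show ?case using F0 by (simp add: phi_def add_divide_distrib)
  qed
  ultimately have phiexp: "phi has_fps_expansion cfps (canonical_coord Ns)"
    by (subst (asm) has_fps_expansion_cong[OF _ refl]) assumption+
  have Zexp: "Z has_fps_expansion cfps (mirror_map Ns)"
    unfolding Z_def by (rule eval_fps_has_fps_expansion) (rule order.strict_trans[OF _ R], simp)
  have "(Z \<circ> phi) has_fps_expansion fps_X"
    using has_fps_expansion_compose[OF Zexp phiexp] by (simp add: cfps_mirror_map)
  then have zero: "(\<lambda>z. (Z \<circ> phi) z - z) has_fps_expansion 0"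
    using has_fps_expansion_diff[OF _ has_fps_expansion_fps_X] by fastforce
  define U where "U = {z \<in> ?H. phi z \<in> eball 0 (fps_conv_radius (cfps (mirror_map Ns)))}"
  have openU: "open U"
  proof -
    have "open (?H \<inter> phi -` eball 0 (fps_conv_radius (cfps (mirror_map Ns))))"
      using holomorphic_on_imp_continuous_on[OF phihol] openH
      by (intro continuous_open_preimage) auto
    also have "?H \<inter> phi -` eball 0 (fps_conv_radius (cfps (mirror_map Ns))) = U" by (auto simp: U_def)
    finally show ?thesis .
  qed
  \<comment> \<open>The identity theorem is applied on the component of \<open>U\<close> that contains the negative axis.\<close>
  define D where "D = connected_component_set U 0"
  have phibound: "norm (phi (- of_real x)) \<le> exp k" if x: "x \<ge> 0" for x
  proof (cases "x = 0")
    case False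
    define y where "y = C * x"
    have y: "y > 0" using False x C by (simp add: y_def)
    define f where "f = (\<integral>t. 1 / (1 + y * t) \<partial>\<mu>)"
    define g where "g = (\<integral>t. ln t / (1 + y * t) \<partial>\<mu>)"
    have Cx: "- of_real C * - of_real x = complex_of_real y" by (simp add: y_def)
    have Fy: "Fh (- of_real x) = of_real f" unfolding Fh_def f_def Cx by (rule stieltjes_of_real)
    have Gy: "Gh (- of_real x) = of_real g" unfolding Gh_def g_def Cx by (rule stieltjes_of_real)
    have "- of_real x \<in> ?H" unfolding mem_Collect_eq Cx using y by simp
    from Fpos[OF this] have fpos: "f > 0" by (simp add: Fy)
    have intf: "integrable \<mu> (\<lambda>t. 1 / (1 + y * t))" using integrable_stieltjes_real[OF int1, of y] y by simp
    have intg: "integrable \<mu> (\<lambda>t. ln t / (1 + y * t))" using integrable_stieltjes_real[OF intln, of y] y by simp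
    have "(\<integral>t. (ln (y * t) - k) / (1 + y * t) \<partial>\<mu>) \<le> 0" using mean y by (simp add: log_mean_le_def)
    also have "(\<integral>t. (ln (y * t) - k) / (1 + y * t) \<partial>\<mu>)
        = (\<integral>t. (ln y - k) * (1 / (1 + y * t)) + ln t / (1 + y * t) \<partial>\<mu>)"
      using AE_unit
    proof (intro integral_cong_AE)
      assume "AE t in \<mu>. 0 < t \<and> t \<le> 1"
      then show "AE t in \<mu>. (ln (y * t) - k) / (1 + y * t) = (ln y - k) * (1 / (1 + y * t)) + ln t / (1 + y * t)"
        by eventually_elim (use y in \<open>auto simp: ln_mult add_divide_distrib[symmetric]\<close>)
    qed measurable
    also have "\<dots> = (ln y - k) * f + g" unfolding f_def g_def
      by (subst Bochner_Integration.integral_add)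
         (intro integrable_mult_right intf, rule intg, simp only: integral_mult_right_zero)
    finally have "g / f + ln y \<le> k" using fpos by (simp add: field_simps)
    then have "exp (g / f + ln y) \<le> exp k" by simp
    moreover have "norm (phi (- of_real x)) = x * exp (g / f + L)"
    proof -
      have "phi (- of_real x) = - of_real (x * exp (g / f + L))"
        unfolding phi_def by (simp add: Fy Gy exp_of_real flip: of_real_divide of_real_add)
      then show ?thesis using x by (simp add: norm_mult)
    qed
    moreover have "x * exp (g / f + L) = exp (g / f + ln y)"
      using C False x by (simp add: exp_add L_def y_def)
    ultimately show ?thesis by simp
  qed (simp add: phi_def)
  have inU: "- of_real x \<in> U" if "x \<ge> 0" for x :: real
  proof -
    have "ereal (norm (phi (- of_real x))) < fps_conv_radius (cfps (mirror_map Ns))"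
      using phibound[OF that] R by (meson ereal_less_eq(3) order.strict_trans1)
    then show ?thesis using that C by (auto simp: U_def mult_nonneg_nonneg intro: order.strict_trans2[of _ 0])
  qed
  have 0: "0 \<in> U" using inU[of 0] by simp
  have inD: "- of_real x \<in> D" if "x \<ge> 0" for x :: real
  proof -
    have "connected ((\<lambda>x. - complex_of_real x) ` {0..})"
      by (intro connected_continuous_image continuous_intros) auto
    then have "(\<lambda>x. - complex_of_real x) ` {0..} \<subseteq> D"
      unfolding D_def using inU by (intro connected_component_maximal) (auto intro!: image_eqI[of _ _ 0])
    then show ?thesis using that by auto
  qed
  have DU: "D \<subseteq> U" unfolding D_def by (rule connected_component_subset)
  have holD: "(\<lambda>z. (Z \<circ> phi) z - z) holomorphic_on D"
  proof -
    have "phi holomorphic_on D" by (rule holomorphic_on_subset[OF phihol]) (use DU in \<open>auto simp: U_def\<close>)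
    then have "(Z \<circ> phi) holomorphic_on D"
      by (rule holomorphic_on_compose_gen[where t = "eball 0 (fps_conv_radius (cfps (mirror_map Ns)))"])
         (use DU in \<open>auto simp: U_def Z_def intro!: holomorphic_intros\<close>)
    then show ?thesis by (intro holomorphic_intros)
  qed
  have Zphi: "Z (phi (- of_real x)) = - of_real x" if "x \<ge> 0" for x :: real
  proof -
    have "(Z \<circ> phi) (- of_real x) - (- of_real x) = 0"
      by (rule has_fps_expansion_0_analytic_continuation[OF zero holD])
         (use inD[of 0] inD[OF that] openU in \<open>auto simp: D_def open_connected_component\<close>)
    then show ?thesis unfolding o_def by (simp only: right_minus_eq)
  qed
  have "compact (Z ` cball 0 (exp k))"
  proof (intro compact_continuous_image)
    show "continuous_on (cball 0 (exp k)) Z"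
      unfolding Z_def
    proof (rule continuous_on_subset[OF continuous_on_eval_fps], safe)
      fix w :: complex assume "w \<in> cball 0 (exp k)"
      then show "w \<in> eball 0 (fps_conv_radius (cfps (mirror_map Ns)))"
        using R by (auto intro: order.strict_trans1[of _ "ereal (exp k)"])
    qed
  qed simp
  then obtain b where b: "\<And>w. w \<in> Z ` cball 0 (exp k) \<Longrightarrow> norm w \<le> b"
    using compact_imp_bounded bounded_iff by metis
  define x where "x = max 0 b + 1"
  have "Z (phi (- of_real x)) \<in> Z ` cball 0 (exp k)" using phibound[of x] by (auto simp: x_def)
  then have "norm (Z (phi (- of_real x))) \<le> b" by (rule b)
  moreover have "Z (phi (- of_real x)) = - of_real x" by (rule Zphi) (simp add: x_def)
  moreover have "norm (- complex_of_real x) = x"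
    unfolding norm_minus_cancel norm_of_real by (simp add: x_def)
  ultimately have "x \<le> b" by simp
  then show False by (simp add: x_def)
qed

section \<open>Power series with nonnegative coefficients\<close>

lemma fps_deriv_funpow_nth:
  fixes f :: "'a :: field_char_0 fps"
  shows "fps_nth ((fps_deriv ^^ k) f) n = fact (n + k) / fact n * fps_nth f (n + k)"
proof (induction k arbitrary: n)
  case (Suc k)
  have "(of_nat (n + 1) :: 'a) \<noteq> 0" by (simp only: of_nat_eq_0_iff)
  then have "of_nat (n + 1) * (fact (n + 1 + k) / fact (n + 1)) = (fact (n + Suc k) / fact n :: 'a)"
    by (simp add: fact_Suc[of n] del: fact_Suc)
  note eq = this
  have "fps_nth ((fps_deriv ^^ Suc k) f) n
      = of_nat (n + 1) * (fact (n + 1 + k) / fact (n + 1) * fps_nth f (n + 1 + k))"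
    by (simp only: funpow.simps o_apply fps_deriv_nth Suc.IH)
  also have "\<dots> = fact (n + Suc k) / fact n * fps_nth f (n + 1 + k)"
    by (simp only: mult.assoc[symmetric] eq[symmetric])
  finally show ?case by (simp del: fact_Suc)
qed simp

lemma conv_radius_deriv_funpow:
  fixes f :: "'a :: {banach, real_normed_field} fps"
  shows "fps_conv_radius ((fps_deriv ^^ k) f) \<ge> fps_conv_radius f"
  by (induction k) (auto intro: order.trans[OF _ fps_conv_radius_deriv])

lemma higher_deriv_eval_fps:
  fixes f :: "complex fps"
  assumes "ereal (norm z) < fps_conv_radius f"
  shows "(deriv ^^ k) (eval_fps f) z = eval_fps ((fps_deriv ^^ k) f) z"
  using assms
proof (induction k arbitrary: z)
  case (Suc k)
  have "\<forall>\<^sub>F w in nhds z. w \<in> eball 0 (fps_conv_radius f)"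
    using Suc.prems by (intro eventually_nhds_in_open) auto
  then have "\<forall>\<^sub>F w in nhds z. (deriv ^^ k) (eval_fps f) w = eval_fps ((fps_deriv ^^ k) f) w"
    by eventually_elim (rule Suc.IH, simp)
  then have "deriv ((deriv ^^ k) (eval_fps f)) z = deriv (eval_fps ((fps_deriv ^^ k) f)) z"
    by (intro deriv_cong_ev refl)
  also have "\<dots> = eval_fps (fps_deriv ((fps_deriv ^^ k) f)) z"
    using Suc.prems conv_radius_deriv_funpow[of f k]
    by (intro eval_fps_deriv[symmetric]) (auto intro: order.strict_trans2)
  finally show ?case by simp
qed simp

lemma cfps_deriv_funpow: "cfps ((fps_deriv ^^ k) f) = (fps_deriv ^^ k) (cfps f)"
  by (simp add: fps_eq_iff fps_deriv_funpow_nth)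

text \<open>
  The theorem of Vivanti and Pringsheim. Expand the continuation around a point \<open>x\<^sub>1 < x\<^sub>0\<close> so close to
  \<open>x\<^sub>0\<close> that the disc of convergence contains some \<open>x\<^sub>1 + h > x\<^sub>0\<close>. All Taylor coefficients at \<open>x\<^sub>1\<close> are sums
  of nonnegative terms, so the binomial expansion of \<open>(x\<^sub>1 + h)\<^sup>n\<close> can be rearranged, and the partial sums
  of the original series at \<open>x\<^sub>1 + h\<close> stay bounded.
\<close>

lemma vivanti_pringsheim:
  fixes f :: "real fps"
  assumes nonneg: "\<And>n. fps_nth f n \<ge> 0" and x0: "x0 > 0" "fps_conv_radius f \<ge> ereal x0"
    and g: "e > 0" "g holomorphic_on ball (complex_of_real x0) e"
    and agree: "\<And>x. x0 - e < x \<Longrightarrow> 0 < x \<Longrightarrow> x < x0 \<Longrightarrow> g (of_real x) = of_real (eval_fps f x)"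
  shows "fps_conv_radius f > ereal x0"
proof -
  \<comment> \<open>With \<open>x\<^sub>1 = x\<^sub>0 - d\<close> the disc of radius \<open>2 d\<close> around \<open>x\<^sub>1\<close> lies in the domain of \<open>g\<close> and reaches
    beyond \<open>x\<^sub>0\<close>, and the disc of radius \<open>d\<close> lies in the domain of \<open>f\<close>.\<close>
  define d where "d = min e x0 / 3"
  have d: "d > 0" "3 * d \<le> e" "3 * d \<le> x0" using g x0 by (auto simp: d_def)
  define x1 where "x1 = x0 - d"
  have x1: "x1 > 0" "x1 < x0" using d x0 by (auto simp: x1_def)
  have sub: "ball (complex_of_real x1) (2 * d) \<subseteq> ball (of_real x0) e"
  proof
    fix w assume "w \<in> ball (complex_of_real x1) (2 * d)"
    then have "dist (of_real x0) w < d + 2 * d"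
      using dist_triangle[of "of_real x0" w "complex_of_real x1"] d
      by (simp add: x1_def dist_norm flip: of_real_diff)
    then show "w \<in> ball (of_real x0) e" using d by simp
  qed
  have sub0: "ball (complex_of_real x1) d \<subseteq> eball 0 (fps_conv_radius (cfps f))"
  proof
    fix w assume "w \<in> ball (complex_of_real x1) d"
    then have "norm (w - complex_of_real x1) < d" by (simp add: dist_norm norm_minus_commute)
    moreover have "norm (complex_of_real x1) = x1" using x1 by simp
    ultimately have "norm w < x1 + d"
      using norm_triangle_sub[of w "complex_of_real x1"] by linarith
    then have "norm w < x0" by (simp add: x1_def)
    then have "ereal (norm w) < ereal x0" by simp
    also note x0(2)
    finally show "w \<in> eball 0 (fps_conv_radius (cfps f))" by simp
  qed
  let ?F = "eval_fps (cfps f)"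
  have holF: "?F holomorphic_on ball (of_real x1) d" using sub0 by (rule holomorphic_on_eval_fps)
  have holg: "g holomorphic_on ball (of_real x1) (2 * d)" by (rule holomorphic_on_subset[OF g(2) sub])
  have holg': "g holomorphic_on ball (of_real x1) d"
    by (rule holomorphic_on_subset[OF holg]) (use d in auto)
  have eq: "g w = ?F w" if w: "w \<in> ball (of_real x1) d" for w
  proof -
    let ?U = "complex_of_real ` {x1<..<x0}"
    have "(\<lambda>w. g w - ?F w) w = 0"
    proof (rule analytic_continuation[where f = "\<lambda>w. g w - ?F w" and U = ?U and \<xi> = "of_real x1"])
      show "(\<lambda>w. g w - ?F w) holomorphic_on ball (of_real x1) d" by (intro holomorphic_intros holF holg')
      show "?U \<subseteq> ball (of_real x1) d"
      proof
        fix v assume "v \<in> ?U"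
        then obtain x where x: "v = of_real x" "x1 < x" "x < x0" by auto
        have "\<bar>x1 - x\<bar> < d" using x by (simp add: x1_def abs_if)
        then show "v \<in> ball (of_real x1) d" by (simp add: x(1) dist_real_def)
      qed
      show "complex_of_real x1 islimpt ?U"
        unfolding islimpt_approachable
      proof (intro allI impI)
        fix r :: real assume r: "r > 0"
        define y where "y = x1 + min r d / 2"
        have "y \<in> {x1<..<x0}" "\<bar>y - x1\<bar> < r" using r d by (auto simp: y_def x1_def min_def)
        then show "\<exists>w\<in>?U. w \<noteq> complex_of_real x1 \<and> dist w (of_real x1) < r"
          by (intro bexI[of _ "of_real y"]) (auto simp: dist_real_def)
      qed
      fix v assume "v \<in> ?U"
      then obtain x where x: "v = of_real x" "x1 < x" "x < x0" by auto
      have "ereal (norm x) < ereal x0" using x x1 by simp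
      also note x0(2)
      finally have "?F v = of_real (eval_fps f x)" unfolding x(1) by (intro eval_cfps_of_real summable_fps)
      moreover have "g v = of_real (eval_fps f x)"
        unfolding x(1) by (rule agree) (use x x1 d in \<open>auto simp: x1_def\<close>)
      ultimately show "g v - ?F v = 0" by simp
    qed (use w d in auto)
    then show ?thesis by simp
  qed
  define r where "r k = eval_fps ((fps_deriv ^^ k) f) x1 / fact k" for k
  have conv: "ereal (norm x1) < fps_conv_radius ((fps_deriv ^^ k) f)" for k
  proof -
    have "ereal (norm x1) < ereal x0" using x1 by simp
    also note x0(2)
    also note conv_radius_deriv_funpow[of f k]
    finally show ?thesis .
  qed
  have coeff: "(deriv ^^ k) g (of_real x1) / fact k = of_real (r k)" for k
  proof -
    have "(deriv ^^ k) g (of_real x1) = (deriv ^^ k) ?F (of_real x1)"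
      by (rule higher_deriv_transform_within_open[OF holg' holF]) (use eq d in auto)
    also have "\<dots> = eval_fps (cfps ((fps_deriv ^^ k) f)) (of_real x1)"
      unfolding cfps_deriv_funpow using conv[of 0] by (intro higher_deriv_eval_fps) simp
    also have "\<dots> = of_real (eval_fps ((fps_deriv ^^ k) f) x1)"
      by (intro eval_cfps_of_real summable_fps conv)
    finally show ?thesis by (simp add: r_def)
  qed
  define h where "h = 3 / 2 * d"
  define w where "w = complex_of_real (x1 + h)"
  have h: "h > 0" "x1 + h > x0" using d by (auto simp: h_def x1_def)
  have "(\<lambda>k. (deriv ^^ k) g (of_real x1) / fact k * (w - of_real x1) ^ k) sums g w"
    by (rule holomorphic_power_series[OF holg]) (use d in \<open>simp add: w_def h_def dist_norm\<close>)
  then have "(\<lambda>k. complex_of_real (r k * h ^ k)) sums g w" by (simp add: coeff w_def)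
  then have S: "(\<lambda>k. r k * h ^ k) sums Re (g w)" using sums_Re by fastforce
  have rge: "(\<Sum>n\<in>{k..N}. real (n choose k) * fps_nth f n * x1 ^ (n - k)) \<le> r k" for k N
  proof -
    have "(\<Sum>n\<in>{k..N}. fact k * (real (n choose k) * fps_nth f n * x1 ^ (n - k)))
       = (\<Sum>i\<in>{0..<Suc N - k}. fps_nth ((fps_deriv ^^ k) f) i * x1 ^ i)"
    proof (rule sum.reindex_bij_witness[of _ "\<lambda>i. i + k" "\<lambda>n. n - k"])
      fix n assume n: "n \<in> {k..N}"
      show "fps_nth ((fps_deriv ^^ k) f) (n - k) * x1 ^ (n - k)
          = fact k * (real (n choose k) * fps_nth f n * x1 ^ (n - k))"
        using n by (simp add: fps_deriv_funpow_nth binomial_fact)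
    qed auto
    also have "\<dots> \<le> (\<Sum>i. fps_nth ((fps_deriv ^^ k) f) i * x1 ^ i)"
      using conv[of k] nonneg x1
      by (intro sum_le_suminf summable_fps) (auto simp: fps_deriv_funpow_nth)
    finally show ?thesis
      by (simp add: r_def eval_fps_def field_simps sum_distrib_left[symmetric])
  qed
  have r0: "r k \<ge> 0" for k using rge[of k 0] nonneg x1
    by (intro order.trans[OF sum_nonneg rge[of k 0]]) auto
  have bound: "(\<Sum>n\<le>N. fps_nth f n * (x1 + h) ^ n) \<le> Re (g w)" for N
  proof -
    have "(\<Sum>n\<le>N. fps_nth f n * (x1 + h) ^ n)
        = (\<Sum>n\<le>N. \<Sum>k\<le>N. if k \<le> n then real (n choose k) * fps_nth f n * x1 ^ (n - k) * h ^ k else 0)"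
    proof (intro sum.cong refl)
      fix n assume n: "n \<in> {..N}"
      have "fps_nth f n * (x1 + h) ^ n = (\<Sum>k\<le>n. real (n choose k) * fps_nth f n * x1 ^ (n - k) * h ^ k)"
        by (subst add.commute, subst binomial_ring) (simp add: sum_distrib_left mult_ac)
      also have "\<dots> = (\<Sum>k\<in>{..N}. if k \<le> n then real (n choose k) * fps_nth f n * x1 ^ (n - k) * h ^ k else 0)"
        using n by (intro sum.mono_neutral_cong_left) auto
      finally show "fps_nth f n * (x1 + h) ^ n = \<dots>" .
    qed
    also have "\<dots> = (\<Sum>k\<le>N. \<Sum>n\<le>N. if k \<le> n then real (n choose k) * fps_nth f n * x1 ^ (n - k) * h ^ k else 0)"
      by (rule sum.swap)
    also have "\<dots> = (\<Sum>k\<le>N. (\<Sum>n\<in>{k..N}. real (n choose k) * fps_nth f n * x1 ^ (n - k)) * h ^ k)"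
      unfolding sum_distrib_right
      by (intro sum.cong refl sum.mono_neutral_cong_right) auto
    also have "\<dots> \<le> (\<Sum>k\<le>N. r k * h ^ k)"
      using rge h by (intro sum_mono mult_right_mono) auto
    also have "\<dots> \<le> (\<Sum>k. r k * h ^ k)"
      using S r0 h by (intro sum_le_suminf) (auto simp: sums_iff)
    also have "\<dots> = Re (g w)" using S by (simp add: sums_iff)
    finally show ?thesis .
  qed
  have "summable (\<lambda>n. fps_nth f n * (x1 + h) ^ n)"
    using nonneg x1 h bound by (intro bounded_imp_summable) auto
  then have "ereal (norm (x1 + h)) \<le> fps_conv_radius f"
    unfolding fps_conv_radius_def by (rule conv_radius_geI)
  moreover have "ereal x0 < ereal (norm (x1 + h))" using h x0 by simp
  ultimately show ?thesis by order
qed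

text \<open>
  \<open>H\<^sub>n\<close> is the sum of \<open>g\<^sub>j b\<^sub>n\<^sub>-\<^sub>j / b\<^sub>n\<close> over \<open>j \<le> n\<close>, and each quotient tends to \<open>1\<close>. Since \<open>b\<^sub>n s\<^sup>n\<close> is eventually
  increasing, the quotients are bounded by a multiple of \<open>s\<^sup>j\<close>, so Tannery's theorem applies.
\<close>

lemma convolution_quotient_tendsto:
  fixes b g H :: "nat \<Rightarrow> real"
  assumes b: "\<And>n. b n > 0" "\<And>n. b (Suc n) = b n * \<rho> n" "\<rho> \<longlonglongrightarrow> 1"
    and g: "\<And>n. g n \<ge> 0" "s > 1" "summable (\<lambda>n. g n * s ^ n)"
    and conv: "\<And>n. H n * b n = (\<Sum>j\<le>n. g j * b (n - j))"
  shows "H \<longlonglongrightarrow> (\<Sum>n. g n)"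
proof -
  have ratio: "(\<lambda>n. b (n - j) / b n) \<longlonglongrightarrow> 1" for j
  proof (induction j)
    case 0
    have "b n \<noteq> 0" for n using b(1)[of n] by simp
    then show ?case by simp
  next
    case (Suc j)
    have rpos: "\<rho> n > 0" for n using b(1)[of n] b(1)[of "Suc n"] b(2)[of n] by (simp add: zero_less_mult_iff)
    have "(\<lambda>n. (b (n - j) / b n) * inverse (\<rho> n)) \<longlonglongrightarrow> 1 * inverse 1"
      by (intro tendsto_intros Suc.IH b(3)) simp
    moreover have "b (Suc n - Suc j) / b (Suc n) = (b (n - j) / b n) * inverse (\<rho> n)" for n
      using b(2)[of n] by (simp add: field_simps)
    ultimately have "(\<lambda>n. b (Suc n - Suc j) / b (Suc n)) \<longlonglongrightarrow> 1" by simp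
    then show ?case by (subst (asm) filterlim_sequentially_Suc[of "\<lambda>n. b (n - Suc j) / b n"])
  qed
  have "eventually (\<lambda>n. \<rho> n > 1 / s) sequentially"
    using b(3) g(2) by (intro order_tendstoD(1)) auto
  then obtain k0 where k0: "\<And>n. n \<ge> k0 \<Longrightarrow> \<rho> n > 1 / s" unfolding eventually_sequentially by blast
  define c where "c n = b n * s ^ n" for n
  have cpos: "c n > 0" for n using b(1)[of n] g(2) by (simp add: c_def)
  have cmono: "c m \<le> c n" if "k0 \<le> m" "m \<le> n" for m n
    using that(2)
  proof (induction n rule: dec_induct)
    case (step n)
    have "1 \<le> \<rho> n * s" using k0[of n] that(1) step g(2) by (simp add: field_simps)
    then have "c n * 1 \<le> c n * (\<rho> n * s)" using cpos[of n] by (intro mult_left_mono) auto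
    also have "\<dots> = c (Suc n)" by (simp add: c_def b(2) mult_ac)
    finally show ?case using step by simp
  qed simp
  define M where "M = Max (c ` {..k0})"
  \<comment> \<open>Before \<open>k0\<close> the sequence \<open>c\<close> need not be monotone; the loss is bounded by the factor \<open>M / m0\<close>.\<close>
  define m0 where "m0 = Min (c ` {..k0})"
  have M: "c i \<le> M" if "i \<le> k0" for i unfolding M_def using that by (intro Max_ge) auto
  have m0: "m0 \<le> c i" if "i \<le> k0" for i unfolding m0_def using that by (intro Min_le) auto
  have m0pos: "m0 > 0" unfolding m0_def using cpos by (subst Min_gr_iff) auto
  have m0all: "m0 \<le> c n" for n
    using m0[of n] m0[of k0] cmono[of k0 n] by (cases "n \<le> k0") auto
  have Mm: "M \<ge> m0" using M[of 0] m0[of 0] by simp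
  define K where "K = M / m0"
  have K1: "K \<ge> 1" unfolding K_def using Mm m0pos by simp
  have cK: "c i \<le> K * c n" if "i \<le> n" for i n
  proof (cases "k0 \<le> i")
    case True
    have "c i \<le> c n" using cmono True that by simp
    also have "\<dots> \<le> K * c n" using K1 cpos[of n] by simp
    finally show ?thesis .
  next
    case False
    then have "c i \<le> K * m0" using M[of i] m0pos by (simp add: K_def)
    also have "\<dots> \<le> K * c n" using K1 m0all[of n] by (intro mult_left_mono) auto
    finally show ?thesis .
  qed
  have dom: "b (n - j) / b n \<le> K * s ^ j" if "j \<le> n" for j n
  proof -
    have "b (n - j) * s ^ (n - j) \<le> K * (b n * s ^ n)" using cK[of "n - j" n] by (simp add: c_def)
    also have "s ^ n = s ^ j * s ^ (n - j)" using that by (simp add: power_add[symmetric])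
    finally have "b (n - j) * s ^ (n - j) \<le> (K * s ^ j * b n) * s ^ (n - j)" by (simp add: mult_ac)
    then have "b (n - j) \<le> K * s ^ j * b n" using g(2) by (simp only: mult_le_cancel_right_pos zero_less_power)
    then show ?thesis using b(1)[of n] by (simp add: field_simps)
  qed
  have "(\<lambda>n. \<Sum>j. if j \<le> n then g j * (b (n - j) / b n) else 0) \<longlonglongrightarrow> (\<Sum>j. g j)"
  proof (rule tannerys_theorem[THEN conjunct2, THEN conjunct2])
    show "((\<lambda>n. if j \<le> n then g j * (b (n - j) / b n) else 0) \<longlongrightarrow> g j) sequentially" for j
    proof -
      have "(\<lambda>n. g j * (b (n - j) / b n)) \<longlonglongrightarrow> g j * 1" by (intro tendsto_intros ratio)
      moreover have "\<forall>\<^sub>F n in sequentially. g j * (b (n - j) / b n) = (if j \<le> n then g j * (b (n - j) / b n) else 0)"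
        using eventually_ge_at_top[of j] by eventually_elim simp
      ultimately show ?thesis using Lim_transform_eventually by fastforce
    qed
    show "\<forall>\<^sub>F (j, n) in at_top \<times>\<^sub>F sequentially. norm (if j \<le> n then g j * (b (n - j) / b n) else 0) \<le> g j * s ^ j * K"
    proof (intro always_eventually allI, clarify)
      fix j n
      show "norm (if j \<le> n then g j * (b (n - j) / b n) else 0) \<le> g j * s ^ j * K"
      proof (cases "j \<le> n")
        case True
        have "g j * (b (n - j) / b n) \<le> g j * (K * s ^ j)" using dom[OF True] g(1) by (intro mult_left_mono) auto
        moreover have "g j * (b (n - j) / b n) \<ge> 0" using g(1) b(1)[of n] b(1)[of "n - j"] by (intro mult_nonneg_nonneg) auto
        ultimately show ?thesis using True by (simp add: mult_ac)
      next
        case False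
        then show ?thesis using g(1)[of j] g(2) K1 by simp
      qed
    qed
    show "summable (\<lambda>j. g j * s ^ j * K)" using g(3) by (intro summable_mult2)
  qed simp
  moreover have "(\<Sum>j. if j \<le> n then g j * (b (n - j) / b n) else 0) = H n" for n
  proof -
    have "(\<Sum>j. if j \<le> n then g j * (b (n - j) / b n) else 0) = (\<Sum>j\<le>n. g j * (b (n - j) / b n))"
      by (subst suminf_finite[of "{..n}"]) (auto intro: sum.cong)
    also have "\<dots> = (\<Sum>j\<le>n. g j * b (n - j)) / b n" by (simp add: sum_divide_distrib)
    also have "\<dots> = H n" using conv[of n, symmetric] b(1)[of n] by simp
    finally show ?thesis .
  qed
  ultimately show ?thesis by simp
qed

section \<open>The canonical coordinate at its dominant singularity\<close>

text \<open>
  Interpolation between the bounds \<open>1\<close> and \<open>n (1 - y)\<close>. Any exponent strictly between \<open>1 / 2\<close> and \<open>1\<close>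
  would serve: below \<open>1\<close> the series with terms \<open>n\<^sup>-\<^sup>2 n\<^bsup>3/4\<^esup>\<close> converges, and above \<open>1 / 2\<close> the square of
  \<open>(1 - y)\<^bsup>3/4\<^esup>\<close> is of smaller order than \<open>1 - y\<close>.
\<close>

lemma one_minus_power_le:
  assumes "0 \<le> y" "y < (1::real)" "n > 0"
  shows "1 - y ^ n \<le> real n powr (3/4) * (1 - y) powr (3/4)"
proof -
  have "1 - y ^ n \<le> real n * (1 - y)"
  proof -
    have "1 + real n * (y - 1) \<le> (1 + (y - 1)) ^ n" using assms by (intro Bernoulli_inequality) auto
    then show ?thesis by (simp add: algebra_simps)
  qed
  then have "(1 - y ^ n) powr (3/4) \<le> (real n * (1 - y)) powr (3/4)"
    using assms by (intro powr_mono2) (auto simp: power_le_one)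
  moreover have "1 - y ^ n \<le> (1 - y ^ n) powr (3/4)"
  proof (cases "1 - y ^ n = 0")
    case False
    moreover have "y ^ n \<le> 1" "0 \<le> y ^ n" using assms by (auto intro: power_le_one)
    ultimately have "0 < 1 - y ^ n" "1 - y ^ n \<le> 1" by linarith+
    then have "(1 - y ^ n) powr 1 \<le> (1 - y ^ n) powr (3/4)" by (intro powr_mono') auto
    then show ?thesis using \<open>0 < 1 - y ^ n\<close> by simp
  qed simp
  ultimately show ?thesis by (simp add: powr_mult)
qed

lemma holomorphic_quadratic_bound:
  assumes "f holomorphic_on S" "open S" "w \<in> S" "deriv f w = 0"
  obtains K r where "r > 0" "K \<ge> 0" "\<And>z. norm (z - w) \<le> r \<Longrightarrow> norm (f z - f w) \<le> K * norm (z - w) ^ 2"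
proof -
  obtain r where r: "r > 0" "cball w r \<subseteq> S" using assms open_contains_cball by blast
  have hol2: "deriv (deriv f) holomorphic_on S" using assms by (intro holomorphic_deriv)
  have "continuous_on (cball w r) (deriv (deriv f))"
    using hol2 r(2) holomorphic_on_imp_continuous_on holomorphic_on_subset by blast
  then have "bounded (deriv (deriv f) ` cball w r)"
    by (intro compact_imp_bounded compact_continuous_image) auto
  then obtain K where "\<forall>v \<in> deriv (deriv f) ` cball w r. norm v \<le> K"
    unfolding bounded_iff by blast
  then have K: "\<And>z. z \<in> cball w r \<Longrightarrow> norm (deriv (deriv f) z) \<le> K" by blast
  define F where "F i = (deriv ^^ i) f" for i :: nat
  have der: "(F i has_field_derivative F (Suc i) z) (at z within cball w r)" if "z \<in> cball w r" for i z
  proof -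
    have "F i holomorphic_on S" unfolding F_def using assms by (intro holomorphic_higher_deriv)
    then have "(F i has_field_derivative deriv (F i) z) (at z)"
      using holomorphic_derivI[of "F i" S z] assms(2) r that by blast
    then show ?thesis by (simp add: F_def has_field_derivative_at_within)
  qed
  have "norm (f z - f w) \<le> K * norm (z - w) ^ 2" if "norm (z - w) \<le> r" for z
  proof -
    have "norm (F 0 z - (\<Sum>i\<le>1. F i w * (z - w) ^ i / fact i)) \<le> K * norm (z - w) ^ Suc 1 / fact 1"
    proof (rule complex_Taylor)
      show "convex (cball w r)" by simp
      show "\<And>i x. x \<in> cball w r \<Longrightarrow> i \<le> 1 \<Longrightarrow> (F i has_field_derivative F (Suc i) x) (at x within cball w r)"
        by (rule der)
      show "\<And>x. x \<in> cball w r \<Longrightarrow> norm (F (Suc 1) x) \<le> K" using K by (simp add: F_def)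
      show "w \<in> cball w r" using r by simp
      show "z \<in> cball w r" using that by (simp add: dist_norm norm_minus_commute)
    qed
    then show ?thesis using assms(4) by (simp add: F_def power2_eq_square)
  qed
  moreover have "K \<ge> 0" using K[of w] r(1) norm_ge_zero[of "deriv (deriv f) w"] by (simp del: norm_ge_zero)
  ultimately show ?thesis using r(1) that by blast
qed

lemma conv_radius_geI_real_nonneg:
  fixes f :: "real fps"
  assumes "summable (\<lambda>n. fps_nth f n * x ^ n)" "x \<ge> 0"
  shows "fps_conv_radius f \<ge> ereal x"
  using conv_radius_geI[OF assms(1)] assms(2) by (simp add: fps_conv_radius_def)

text \<open>
  Passing from the coefficients of \<open>F\<close> to \<open>b\<close> moves the singularity from \<open>x0\<close> to \<open>1\<close>. The name \<open>L\<close> stands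
  for the limit of \<open>H\<close>.
\<close>

locale mirror_data =
  fixes Ns :: "nat list" and A b H C L x0 F G h q
  assumes Ns: "\<And>N. N \<in> set Ns \<Longrightarrow> N \<ge> 2" and Phi: "Phi_of Ns \<ge> 4"
  defines "A \<equiv> params Ns" and "b \<equiv> bcoef A" and "H \<equiv> hcoef A" and "C \<equiv> real (C_of Ns)"
    and "L \<equiv> ln C" and "x0 \<equiv> 1 / C" and "F \<equiv> F_of Ns" and "G \<equiv> G_of Ns" and "h \<equiv> G / F"
    and "q \<equiv> canonical_coord Ns"
begin

lemma C_pos: "C > 0" using H_of_tendsto(1)[of Ns] Ns by (simp add: C_def)

lemma x0_pos: "x0 > 0" using C_pos by (simp add: x0_def)

lemma A_range: "a \<in># A \<Longrightarrow> 0 < a \<and> a < 1" using params_pos[OF Ns] by (simp add: A_def)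

lemma F_term: "fps_nth F n * x0 ^ n = b n"
  using C_pos by (simp add: F_def F_of_eq b_def A_def C_def x0_def power_divide)

lemma G_term: "fps_nth G n * x0 ^ n = H n * b n"
  using C_pos by (simp add: G_def G_of_eq b_def H_def A_def C_def x0_def power_divide)

lemma b_pos: "b n > 0" unfolding b_def using A_range by (intro bcoef_pos) auto

lemma H_strict_mono: "strict_mono H"
proof -
  have "size A \<ge> 4" using Phi by (simp add: A_def size_params)
  then have "A \<noteq> {#}" by auto
  then show ?thesis unfolding H_def using A_range by (intro hcoef_strict_mono)
qed

lemma H_tendsto: "H \<longlonglongrightarrow> L"
  using hcoef_tendsto[of A] psi_gap_params[OF Ns] A_range by (auto simp: H_def A_def L_def C_def)

lemma H_0: "H 0 = 0" by (simp add: H_def)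

lemma H_less: "H n < L"
proof -
  have "H n < H (Suc n)" using H_strict_mono by (simp add: strict_mono_def)
  also have "H (Suc n) \<le> L" using H_strict_mono H_tendsto by (intro incseq_le) (auto simp: strict_mono_mono)
  finally show ?thesis .
qed

lemma H_nonneg: "H n \<ge> 0"
  using monoD[OF strict_mono_mono[OF H_strict_mono], of 0 n] H_0 by simp

lemma L_pos: "L > 0" using H_less[of 0] H_0 by simp

lemma b_le: "b n \<le> 1 / (2 * real n + 1) ^ 2"
proof -
  have "b n \<le> (1 / (2 * real n + 1)) ^ 2"
    unfolding b_def
  proof (rule bcoef_le_inverse_square)
    show "image_mset (\<lambda>a. 1 - a) A = A" unfolding A_def by (rule params_reflect[OF Ns])
    show "size A \<ge> 4" using Phi by (simp add: A_def size_params)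
  qed (rule A_range)
  then show ?thesis by (simp add: power_divide)
qed

lemma summable_b_powr: "summable (\<lambda>n. b n * real n powr (3/4))"
proof (rule summable_comparison_test)
  show "summable (\<lambda>n. real n powr (-5/4))" by (simp add: summable_real_powr_iff)
  show "\<exists>N. \<forall>n\<ge>N. norm (b n * real n powr (3/4)) \<le> real n powr (-5/4)"
  proof (intro exI[of _ 1] allI impI)
    fix n :: nat assume n: "n \<ge> 1"
    have "b n \<le> 1 / (2 * real n + 1) ^ 2" by (rule b_le)
    also have "\<dots> \<le> 1 / real n ^ 2" using n by (intro divide_left_mono power_mono) auto
    also have "\<dots> = real n powr (-2)" using n by (simp add: powr_minus_divide)
    finally have "b n * real n powr (3/4) \<le> real n powr (-2) * real n powr (3/4)" by (intro mult_right_mono) auto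
    also have "\<dots> = real n powr (-5/4)" by (simp add: powr_add[symmetric])
    finally show "norm (b n * real n powr (3/4)) \<le> real n powr (-5/4)" using b_pos[of n] by simp
  qed
qed

lemma summable_b: "summable b"
proof (rule summable_comparison_test)
  show "summable (\<lambda>n. b n * real n powr (3/4))" by (rule summable_b_powr)
  show "\<exists>N. \<forall>n\<ge>N. norm (b n) \<le> b n * real n powr (3/4)"
  proof (intro exI[of _ 1] allI impI)
    fix n :: nat assume n: "n \<ge> 1"
    have "b n * 1 \<le> b n * real n powr (3/4)"
      using n b_pos[of n] by (intro mult_left_mono) (auto intro: ge_one_powr_ge_zero)
    then show "norm (b n) \<le> b n * real n powr (3/4)" using b_pos[of n] by simp
  qed
qed

lemma summable_Hb: "summable (\<lambda>n. H n * b n)"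
proof (rule summable_comparison_test)
  show "summable (\<lambda>n. L * b n)" by (intro summable_mult summable_b)
  have "norm (H n * b n) \<le> L * b n" for n
    using H_nonneg[of n] b_pos[of n] H_less[of n] by (simp add: abs_mult)
  then show "\<exists>N. \<forall>n\<ge>N. norm (H n * b n) \<le> L * b n" by blast
qed

lemma F_eq: "F = Abs_fps (\<lambda>n. C ^ n * b n)"
  by (simp add: fps_eq_iff F_def F_of_eq b_def A_def C_def)

lemma G_eq: "G = Abs_fps (\<lambda>n. H n * (C ^ n * b n))"
  by (simp add: fps_eq_iff G_def G_of_eq b_def H_def A_def C_def)

lemma h_nonneg: "fps_nth h n \<ge> 0"
  unfolding h_def F_eq G_eq
proof (rule quotient_nonneg)
  show "C ^ 0 * b 0 = 1" by (simp add: b_def)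
  show "C ^ n * b n > 0" for n using C_pos b_pos[of n] by simp
  show "C ^ Suc n * b (Suc n) = C ^ n * b n * (C * bratio A n)" for n by (simp add: b_def bcoef_Suc)
  show "C * bratio A n \<le> C * bratio A (Suc n)" for n
    using bratio_mono[of A n] A_range C_pos by (intro mult_left_mono) auto
  show "H 0 = 0" by (rule H_0)
  show "mono H" by (rule strict_mono_mono[OF H_strict_mono])
qed

lemma h_le_G: "fps_nth h n \<le> fps_nth G n"
  unfolding h_def F_eq
proof (rule quotient_le_numerator)
  show "C ^ 0 * b 0 = 1" by (simp add: b_def)
  show "C ^ n * b n \<ge> 0" for n using C_pos b_pos[of n] by simp
  show "fps_nth (G / Abs_fps (\<lambda>n. C ^ n * b n)) n \<ge> 0" for n using h_nonneg[of n] by (simp add: h_def F_eq)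
qed

lemma h_term_le: "fps_nth h n * x0 ^ n \<le> H n * b n"
  using h_le_G[of n] x0_pos by (auto simp: G_term[symmetric] intro: mult_right_mono)

lemma h_term_nonneg: "fps_nth h n * x0 ^ n \<ge> 0"
  using h_nonneg[of n] x0_pos by simp

lemma summable_h: "summable (\<lambda>n. fps_nth h n * x0 ^ n)"
  by (rule summable_comparison_test[OF _ summable_Hb])
     (use h_term_le h_term_nonneg in auto)

lemma conv_h: "fps_conv_radius h \<ge> ereal x0"
  using summable_h x0_pos by (intro conv_radius_geI_real_nonneg) auto

lemma h_convolution: "H n * b n = (\<Sum>j\<le>n. (fps_nth h j * x0 ^ j) * b (n - j))"
proof -
  have F0: "fps_nth F 0 \<noteq> 0" by (simp add: F_def)
  have "h * F = G" unfolding h_def using F0 by (simp add: fps_divide_unit inverse_mult_eq_1 mult.assoc)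
  then have "fps_nth G n = (\<Sum>j=0..n. fps_nth h j * fps_nth F (n - j))" by (simp add: fps_mult_nth[symmetric])
  then have "H n * b n = (\<Sum>j=0..n. fps_nth h j * fps_nth F (n - j)) * x0 ^ n" by (simp add: G_term[symmetric])
  also have "\<dots> = (\<Sum>j=0..n. (fps_nth h j * x0 ^ j) * (fps_nth F (n - j) * x0 ^ (n - j)))"
    unfolding sum_distrib_right
    by (intro sum.cong refl) (simp add: power_add[symmetric] mult_ac flip: power_add)
  finally show ?thesis by (simp add: F_term atLeast0AtMost)
qed

definition h1 where "h1 = eval_fps h x0"

text \<open>
  At \<open>x0\<close> all series converge absolutely, so \<open>h1\<close> times the sum of the \<open>b\<^sub>n\<close> is the sum of the \<open>H\<^sub>n b\<^sub>n\<close>, where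
  \<open>H\<^sub>n < L\<close>.
\<close>

lemma h1_less: "h1 < L"
proof -
  have "(\<lambda>k. \<Sum>i\<le>k. (fps_nth h i * x0 ^ i) * b (k - i)) sums (h1 * (\<Sum>n. b n))"
    unfolding h1_def eval_fps_def
    using summable_h summable_b h_term_nonneg b_pos
    by (intro Cauchy_product_sums) (auto simp: less_imp_le)
  then have s: "(\<lambda>n. H n * b n) sums (h1 * (\<Sum>n. b n))" by (simp add: h_convolution)
  have "(\<lambda>n. L * b n - H n * b n) sums (L * (\<Sum>n. b n) - h1 * (\<Sum>n. b n))"
    by (intro sums_diff s sums_mult summable_sums summable_b)
  moreover have "L * b n - H n * b n > 0" for n
    using H_less[of n] b_pos[of n] by (simp add: mult_strict_right_mono)
  ultimately have "L * (\<Sum>n. b n) - h1 * (\<Sum>n. b n) > 0"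
    using suminf_pos[of "\<lambda>n. L * b n - H n * b n"] by (auto simp: sums_iff)
  moreover have "(\<Sum>n. b n) > 0" using summable_b b_pos by (intro suminf_pos) auto
  ultimately show ?thesis by (simp add: left_diff_distrib[symmetric] zero_less_mult_iff)
qed

lemma eval_h_summable:
  assumes "0 \<le> y" "y \<le> 1"
  shows "summable (\<lambda>n. fps_nth h n * (x0 * y) ^ n)"
proof (rule summable_comparison_test[OF _ summable_h], intro exI allI impI)
  fix n
  have "(fps_nth h n * x0 ^ n) * y ^ n \<le> (fps_nth h n * x0 ^ n) * 1"
    using h_term_nonneg[of n] assms by (intro mult_left_mono) (auto simp: power_le_one)
  moreover have "0 \<le> (fps_nth h n * x0 ^ n) * y ^ n" using h_term_nonneg[of n] assms by simp
  ultimately show "norm (fps_nth h n * (x0 * y) ^ n) \<le> fps_nth h n * x0 ^ n"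
    by (simp add: power_mult_distrib mult.assoc)
qed

lemma eval_h_le: "0 \<le> y \<Longrightarrow> y \<le> 1 \<Longrightarrow> eval_fps h (x0 * y) \<le> h1"
  unfolding h1_def eval_fps_def
  using eval_h_summable[of y] summable_h h_term_nonneg h_nonneg x0_pos
  by (intro suminf_le) (auto intro!: mult_left_mono power_mono mult_left_le)

definition K1 where "K1 = L * (\<Sum>n. b n * real n powr (3/4))"

text \<open>
  Termwise, the coefficients of \<open>h\<close> are at most those of \<open>G\<close>, which are at most \<open>L\<close> times those of \<open>F\<close>.
\<close>

lemma h1_diff_le:
  assumes "0 \<le> y" "y < 1"
  shows "h1 - eval_fps h (x0 * y) \<le> K1 * (1 - y) powr (3/4)"
proof -
  have "h1 - eval_fps h (x0 * y) = (\<Sum>n. fps_nth h n * x0 ^ n - fps_nth h n * (x0 * y) ^ n)"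
    unfolding h1_def eval_fps_def using assms
    by (intro suminf_diff summable_h eval_h_summable) auto
  also have "\<dots> \<le> (\<Sum>n. L * (b n * real n powr (3/4)) * (1 - y) powr (3/4))"
  proof (rule suminf_le)
    show "summable (\<lambda>n. fps_nth h n * x0 ^ n - fps_nth h n * (x0 * y) ^ n)"
      using assms by (intro summable_diff summable_h eval_h_summable) auto
    show "summable (\<lambda>n. L * (b n * real n powr (3/4)) * (1 - y) powr (3/4))"
      by (intro summable_mult2 summable_mult summable_b_powr)
    fix n
    show "fps_nth h n * x0 ^ n - fps_nth h n * (x0 * y) ^ n \<le> L * (b n * real n powr (3/4)) * (1 - y) powr (3/4)"
    proof (cases "n = 0")
      case False
      have "fps_nth h n * x0 ^ n - fps_nth h n * (x0 * y) ^ n = (fps_nth h n * x0 ^ n) * (1 - y ^ n)"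
        by (simp add: power_mult_distrib algebra_simps)
      also have "\<dots> \<le> (L * b n) * (real n powr (3/4) * (1 - y) powr (3/4))"
      proof (rule mult_mono)
        have "fps_nth h n * x0 ^ n \<le> H n * b n" by (rule h_term_le)
        also have "\<dots> \<le> L * b n" using H_less[of n] b_pos[of n] by (intro mult_right_mono) auto
        finally show "fps_nth h n * x0 ^ n \<le> L * b n" .
        show "1 - y ^ n \<le> real n powr (3/4) * (1 - y) powr (3/4)"
          using one_minus_power_le[of y n] assms False by simp
        show "0 \<le> L * b n" using L_pos b_pos[of n] by simp
        show "0 \<le> 1 - y ^ n" using assms by (simp add: power_le_one)
      qed
      finally show ?thesis by (simp add: mult_ac)
    qed (use L_pos in simp)
  qed
  also have "\<dots> = K1 * (1 - y) powr (3/4)"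
    unfolding K1_def using summable_b_powr
    by (simp add: suminf_mult suminf_mult2[symmetric] summable_mult)
  finally show ?thesis .
qed

text \<open>
  The holomorphic function on the disc of radius \<open>x0\<close> whose Taylor series is \<open>q\<close>.
\<close>

definition Qc where "Qc z = z * exp (eval_fps (cfps h) z)"

lemma Qc_holomorphic: "Qc holomorphic_on ball 0 x0"
  unfolding Qc_def
proof (intro holomorphic_intros)
  show "ball 0 x0 \<subseteq> eball (0::complex) (fps_conv_radius (cfps h))"
    using ball_eball_mono[OF conv_h] by simp
qed

lemma Qc_expansion: "Qc has_fps_expansion cfps q"
proof -
  have "fps_conv_radius (cfps h) > 0"
    using conv_h x0_pos by (simp add: order.strict_trans2[of 0 "ereal x0"])
  then have hexp: "eval_fps (cfps h) has_fps_expansion cfps h" by (rule eval_fps_has_fps_expansion)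
  have hc: "cfps h = cfps (G_of Ns) / cfps (F_of Ns)" unfolding h_def G_def F_def by (rule cfps_divide) simp
  have "fps_nth (cfps h) 0 = 0" by (simp add: h_def G_def F_def)
  from has_fps_expansion_compose[OF has_fps_expansion_exp1 hexp this]
  have "(exp \<circ> eval_fps (cfps h)) has_fps_expansion (fps_exp 1 oo cfps h)" .
  from has_fps_expansion_mult[OF has_fps_expansion_fps_X this]
  show ?thesis unfolding q_def cfps_canonical_coord hc Qc_def by (simp add: o_def)
qed

lemma q_nonneg: "fps_nth q n \<ge> 0"
proof -
  have "fps_nth (fps_exp 1 oo h) m \<ge> 0" for m by (intro fps_exp_compose_nonneg h_nonneg)
  then show ?thesis by (simp add: q_def canonical_coord_def h_def G_def F_def)
qed

lemma conv_q: "fps_conv_radius q \<ge> ereal x0"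
  using holomorphic_on_imp_fps_conv_radius_ge[OF Qc_expansion, of "ereal x0"] Qc_holomorphic by simp

lemma eval_cq: "norm z < x0 \<Longrightarrow> eval_fps (cfps q) z = Qc z"
  by (rule has_fps_expansion_imp_eval_fps_eq[OF Qc_expansion _ Qc_holomorphic])

lemma Qc_of_real:
  assumes "0 \<le> x" "x < x0"
  shows "Qc (of_real x) = of_real (eval_fps q x)"
proof -
  have "ereal (norm x) < ereal x0" using assms by simp
  then have "summable (\<lambda>n. fps_nth q n * x ^ n)"
    using order.strict_trans2[OF _ conv_q] by (intro summable_fps) auto
  then have "complex_of_real (eval_fps q x) = eval_fps (cfps q) (of_real x)"
    by (rule eval_cfps_of_real[symmetric])
  also have "\<dots> = Qc (of_real x)" using assms by (intro eval_cq) simp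
  finally show ?thesis ..
qed

lemma eval_q:
  assumes "0 \<le> x" "x < x0"
  shows "eval_fps q x = x * exp (eval_fps h x)"
proof -
  have n: "ereal (norm x) < ereal x0" using assms by simp
  have "complex_of_real (eval_fps q x) = Qc (of_real x)" by (rule Qc_of_real[OF assms, symmetric])
  also have "eval_fps (cfps h) (of_real x) = of_real (eval_fps h x)"
    using order.strict_trans2[OF n conv_h] by (intro eval_cfps_of_real summable_fps)
  then have "Qc (of_real x) = of_real (x * exp (eval_fps h x))" by (simp add: Qc_def exp_of_real)
  finally show ?thesis by (simp only: of_real_eq_iff)
qed

lemma powr_tendsto_left: "((\<lambda>y::real. (1 - y) powr (3/4)) \<longlongrightarrow> 0) (at_left 1)"
  by real_asymp

lemma at_left_1: "\<forall>\<^sub>F y in at_left (1::real). 0 \<le> y \<and> y < 1"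
  using eventually_at_left_real[of 0 "1::real"] by (auto elim: eventually_mono)

text \<open>
  For \<open>y < 1\<close> the partial sums at \<open>x0 * y\<close> are at most \<open>q(x0 * y)\<close>, and finite sums are continuous in \<open>y\<close>.
\<close>

lemma q_partial_sum_le: "(\<Sum>n<N. fps_nth q n * x0 ^ n) \<le> x0 * exp h1"
proof -
  have "((\<lambda>y. \<Sum>n<N. fps_nth q n * (x0 * y) ^ n) \<longlongrightarrow> (\<Sum>n<N. fps_nth q n * (x0 * 1) ^ n)) (at_left 1)"
    by (intro tendsto_intros)
  moreover have "\<forall>\<^sub>F y in at_left 1. (\<Sum>n<N. fps_nth q n * (x0 * y) ^ n) \<le> x0 * exp h1"
    using at_left_1
  proof eventually_elim
    case (elim y)
    have xy: "0 \<le> x0 * y" "x0 * y < x0" using elim x0_pos by auto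
    have "ereal (norm (x0 * y)) < ereal x0" using xy by simp
    then have "(\<Sum>n<N. fps_nth q n * (x0 * y) ^ n) \<le> eval_fps q (x0 * y)"
      unfolding eval_fps_def using q_nonneg xy order.strict_trans2[OF _ conv_q]
      by (intro sum_le_suminf summable_fps) auto
    also have "\<dots> = x0 * y * exp (eval_fps h (x0 * y))" by (rule eval_q[OF xy])
    also have "\<dots> \<le> x0 * 1 * exp h1"
      using elim x0_pos eval_h_le[of y] by (intro mult_mono) auto
    finally show ?case by simp
  qed
  ultimately show ?thesis by (simp add: tendsto_upperbound)
qed

lemma summable_q: "summable (\<lambda>n. fps_nth q n * x0 ^ n)"
  using q_nonneg x0_pos q_partial_sum_le by (intro summableI_nonneg_bounded) auto

definition q0 where "q0 = eval_fps q x0"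

lemma eval_q_le:
  assumes y: "0 \<le> y" "y < 1"
  shows "eval_fps q (x0 * y) \<le> q0"
proof -
  have "ereal (norm (x0 * y)) < ereal x0" using y x0_pos by simp
  then have "summable (\<lambda>n. fps_nth q n * (x0 * y) ^ n)"
    using order.strict_trans2[OF _ conv_q] by (intro summable_fps) auto
  moreover have "fps_nth q n * (x0 * y) ^ n \<le> fps_nth q n * x0 ^ n" for n
    using q_nonneg[of n] y x0_pos by (intro mult_left_mono power_mono) (auto intro: mult_left_le)
  ultimately show ?thesis
    unfolding q0_def eval_fps_def using summable_q by (intro suminf_le) auto
qed

lemma q0_le: "q0 \<le> x0 * exp h1"
  unfolding q0_def eval_fps_def using summable_q q_partial_sum_le by (rule suminf_le_const)

definition K2 where "K2 = x0 * exp h1 * (1 + K1)"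

text \<open>
  From \<open>exp h1 - exp u \<le> exp h1 (h1 - u)\<close> the estimate for \<open>h\<close> carries over to \<open>q = x exp h\<close>. It implies
  continuity from the left at \<open>x0\<close>, and it is sharp enough to exclude a critical point of the mirror
  map at \<open>q0\<close>.
\<close>

lemma q0_diff_le:
  assumes "0 \<le> y" "y < 1"
  shows "q0 - eval_fps q (x0 * y) \<le> K2 * (1 - y) powr (3/4)"
proof -
  define u where "u = eval_fps h (x0 * y)"
  have "eval_fps q (x0 * y) = x0 * y * exp u"
    unfolding u_def using assms x0_pos by (intro eval_q) auto
  then have "q0 - eval_fps q (x0 * y) \<le> x0 * exp h1 - x0 * y * exp u" using q0_le by simp
  also have "\<dots> \<le> x0 * exp h1 * ((1 - y) + (h1 - u))"
  proof -
    have e: "exp u \<ge> exp h1 * (1 - (h1 - u))"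
      using exp_ge_add_one_self[of "u - h1"] by (simp add: exp_diff field_simps)
    have hu: "h1 - u \<ge> 0" using eval_h_le[of y] assms by (simp add: u_def)
    have "y * exp u \<ge> y * (exp h1 * (1 - (h1 - u)))" using e assms by (intro mult_left_mono) auto
    moreover have "y * (exp h1 * (h1 - u)) \<le> 1 * (exp h1 * (h1 - u))"
      using assms hu by (intro mult_right_mono) auto
    ultimately have "exp h1 - y * exp u \<le> exp h1 * ((1 - y) + (h1 - u))" by (simp add: algebra_simps)
    then have "x0 * (exp h1 - y * exp u) \<le> x0 * (exp h1 * ((1 - y) + (h1 - u)))"
      using x0_pos by (intro mult_left_mono) auto
    then show ?thesis by (simp add: algebra_simps)
  qed
  also have "\<dots> \<le> x0 * exp h1 * ((1 - y) powr (3/4) + K1 * (1 - y) powr (3/4))"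
  proof -
    have "1 - y \<le> (1 - y) powr (3/4)" using one_minus_power_le[of y 1] assms by simp
    moreover have "h1 - u \<le> K1 * (1 - y) powr (3/4)" using h1_diff_le[OF assms] by (simp add: u_def)
    ultimately show ?thesis using x0_pos by (intro mult_left_mono) auto
  qed
  finally show ?thesis by (simp add: K2_def algebra_simps)
qed

lemma eval_q_tendsto: "((\<lambda>y. eval_fps q (x0 * y)) \<longlongrightarrow> q0) (at_left 1)"
proof (rule tendsto_sandwich)
  show "\<forall>\<^sub>F y in at_left 1. q0 - K2 * (1 - y) powr (3/4) \<le> eval_fps q (x0 * y)"
    using at_left_1 by eventually_elim (use q0_diff_le in \<open>simp add: algebra_simps\<close>)
  show "\<forall>\<^sub>F y in at_left 1. eval_fps q (x0 * y) \<le> q0"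
    using at_left_1 by eventually_elim (use eval_q_le in simp)
  have "((\<lambda>y. q0 - K2 * (1 - y) powr (3/4)) \<longlongrightarrow> q0 - K2 * 0) (at_left 1)"
    by (intro tendsto_diff tendsto_const tendsto_mult powr_tendsto_left)
  then show "((\<lambda>y. q0 - K2 * (1 - y) powr (3/4)) \<longlongrightarrow> q0) (at_left 1)" by simp
qed simp

lemma q0_pos: "q0 > 0"
proof -
  have "0 < x0 * (1/2) * exp (eval_fps h (x0 * (1/2)))" using x0_pos by simp
  also have "\<dots> = eval_fps q (x0 * (1/2))" using x0_pos by (intro eval_q[symmetric]) auto
  also have "\<dots> \<le> q0" by (rule eval_q_le) auto
  finally show ?thesis .
qed

end

context mirror_data
begin

lemma norm_Qc_le:
  assumes "norm z < x0"
  shows "norm (Qc z) \<le> q0"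
proof -
  have "ereal (norm z) < ereal x0" using assms by simp
  then have n: "summable (\<lambda>n. norm (fps_nth (cfps q) n * z ^ n))"
    using order.strict_trans2[OF _ conv_q] by (intro norm_summable_fps) auto
  have "norm (Qc z) = norm (\<Sum>n. fps_nth (cfps q) n * z ^ n)"
    using eval_cq[OF assms] by (simp add: eval_fps_def)
  also have "\<dots> \<le> (\<Sum>n. norm (fps_nth (cfps q) n * z ^ n))" by (rule summable_norm[OF n])
  also have "\<dots> \<le> (\<Sum>n. fps_nth q n * x0 ^ n)"
  proof (rule suminf_le[OF _ n summable_q])
    fix n
    show "norm (fps_nth (cfps q) n * z ^ n) \<le> fps_nth q n * x0 ^ n"
      using q_nonneg[of n] assms by (auto simp: norm_mult norm_power intro!: mult_left_mono power_mono)
  qed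
  finally show ?thesis by (simp add: q0_def eval_fps_def)
qed

text \<open>
  Both alternatives for the derivative of the mirror map at \<open>q0\<close> are absurd: if it vanishes, the
  inverse function \<open>q\<close> would have to behave at \<open>x0\<close> at best like a square root; if not, \<open>h\<close> continues
  past \<open>x0\<close>.
\<close>

lemma conv_radius_mirror_le_q0: "fps_conv_radius (mirror_map Ns) \<le> ereal q0"
proof (rule ccontr)
  define S where "S = eball (0::complex) (fps_conv_radius (cfps (mirror_map Ns)))"
  define Z where "Z = eval_fps (cfps (mirror_map Ns))"
  assume "\<not> fps_conv_radius (mirror_map Ns) \<le> ereal q0"
  then have R: "fps_conv_radius (cfps (mirror_map Ns)) > ereal q0" by simp
  have openS: "open S" by (simp add: S_def)
  have holZ: "Z holomorphic_on S" unfolding Z_def S_def by (intro holomorphic_on_eval_fps) auto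
  have inS: "w \<in> S" if "norm w \<le> q0" for w
    using order.strict_trans1[OF _ R, of "ereal (norm w)"] that by (simp add: S_def)
  have q0S: "complex_of_real q0 \<in> S" using inS[of "of_real q0"] q0_pos by simp
  have ZQ: "Z (Qc z) = z" if z: "norm z < x0" for z
  proof -
    have "0 < ereal q0" using q0_pos by simp
    then have "fps_conv_radius (cfps (mirror_map Ns)) > 0" using R by (rule order.strict_trans)
    then have "Z has_fps_expansion cfps (mirror_map Ns)"
      unfolding Z_def by (rule eval_fps_has_fps_expansion)
    from has_fps_expansion_compose[OF this Qc_expansion]
    have "(Z \<circ> Qc) has_fps_expansion fps_X" by (simp add: q_def cfps_mirror_map)
    from has_fps_expansion_diff[OF this has_fps_expansion_fps_X]
    have zero: "(\<lambda>z. (Z \<circ> Qc) z - z) has_fps_expansion 0" by simp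
    have "(Z \<circ> Qc) holomorphic_on ball 0 x0"
      by (rule holomorphic_on_compose_gen[OF Qc_holomorphic holZ]) (auto intro!: inS norm_Qc_le)
    then have "(\<lambda>z. (Z \<circ> Qc) z - z) holomorphic_on ball 0 x0" by (intro holomorphic_intros)
    from has_fps_expansion_0_analytic_continuation[OF zero this, of z]
    show ?thesis using z x0_pos by simp
  qed
  have Zq: "Z (of_real (eval_fps q (x0 * y))) = of_real (x0 * y)" if "0 \<le> y" "y < 1" for y
  proof -
    have y: "0 \<le> x0 * y" "x0 * y < x0" using that x0_pos by auto
    have "norm (complex_of_real (x0 * y)) < x0" unfolding norm_of_real using y by simp
    from ZQ[OF this] show ?thesis by (simp only: Qc_of_real[OF y])
  qed
  have lim: "((\<lambda>y. complex_of_real (eval_fps q (x0 * y))) \<longlongrightarrow> of_real q0) (at_left 1)"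
    by (intro tendsto_of_real eval_q_tendsto)
  have Zq0: "Z (of_real q0) = of_real x0"
  proof -
    have "isCont Z (of_real q0)"
      using holomorphic_on_imp_continuous_on[OF holZ] openS q0S continuous_on_eq_continuous_at by blast
    then have "((\<lambda>y. Z (of_real (eval_fps q (x0 * y)))) \<longlongrightarrow> Z (of_real q0)) (at_left 1)"
      using lim by (rule isCont_tendsto_compose)
    moreover have "((\<lambda>y. Z (of_real (eval_fps q (x0 * y)))) \<longlongrightarrow> of_real (x0 * 1)) (at_left 1)"
    proof (rule Lim_transform_eventually)
      show "((\<lambda>y. complex_of_real (x0 * y)) \<longlongrightarrow> of_real (x0 * 1)) (at_left 1)"
        by (intro tendsto_intros)
      show "\<forall>\<^sub>F y in at_left 1. complex_of_real (x0 * y) = Z (of_real (eval_fps q (x0 * y)))"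
        using at_left_1 by eventually_elim (use Zq in auto)
    qed
    ultimately show ?thesis using tendsto_unique[OF trivial_limit_at_left_real] by fastforce
  qed
  show False
  proof (cases "deriv Z (of_real q0) = 0")
    case True
    obtain K r where K: "r > 0" "K \<ge> 0"
      "\<And>z. norm (z - of_real q0) \<le> r \<Longrightarrow> norm (Z z - Z (of_real q0)) \<le> K * norm (z - of_real q0) ^ 2"
      using holomorphic_quadratic_bound[OF holZ openS q0S True] by metis
    have "\<forall>\<^sub>F y in at_left 1. dist (complex_of_real (eval_fps q (x0 * y))) (of_real q0) < r"
      using lim K(1) by (rule tendstoD)
    with at_left_1 have "\<forall>\<^sub>F y in at_left 1. x0 \<le> K * K2 ^ 2 * (1 - y) powr (1/2)"
    proof eventually_elim
      case (elim y)
      define u where "u = eval_fps q (x0 * y)"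
      have u: "0 \<le> q0 - u" "q0 - u \<le> K2 * (1 - y) powr (3/4)"
        using eval_q_le[of y] q0_diff_le[of y] elim by (auto simp: u_def)
      have nu: "norm (complex_of_real u - of_real q0) = q0 - u"
        using u(1) by (simp flip: of_real_diff)
      have "x0 * (1 - y) = norm (complex_of_real (x0 * y) - of_real x0)"
        using elim x0_pos by (simp add: algebra_simps mult_left_le flip: of_real_diff of_real_mult)
      also have "\<dots> = norm (Z (of_real u) - Z (of_real q0))" using Zq[of y] Zq0 elim by (simp add: u_def)
      also have "\<dots> \<le> K * norm (complex_of_real u - of_real q0) ^ 2"
        using elim by (intro K(3)) (simp add: u_def dist_norm)
      also have "\<dots> = K * (q0 - u) ^ 2" unfolding nu ..
      also have "\<dots> \<le> K * (K2 * (1 - y) powr (3/4)) ^ 2" using u K(2) by (intro mult_left_mono power_mono) auto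
      also have "\<dots> = K * K2 ^ 2 * ((1 - y) powr (3/4) * (1 - y) powr (3/4))"
        by (simp add: power_mult_distrib power2_eq_square)
      also have "(1 - y) powr (3/4) * (1 - y) powr (3/4) = (1 - y) powr (1/2) * (1 - y)"
      proof -
        have "(1 - y) powr (3/4) * (1 - y) powr (3/4) = (1 - y) powr (1/2) * (1 - y) powr 1"
          by (simp only: powr_add[symmetric]) simp
        then show ?thesis using elim by simp
      qed
      finally have "x0 * (1 - y) \<le> (K * K2 ^ 2 * (1 - y) powr (1/2)) * (1 - y)" by (simp only: mult.assoc)
      moreover have "1 - y > 0" using elim by simp
      ultimately show ?case by (simp only: mult_le_cancel_right_pos)
    qed
    moreover have "((\<lambda>y. K * K2 ^ 2 * (1 - y) powr (1/2)) \<longlongrightarrow> K * K2 ^ 2 * 0) (at_left (1::real))"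
      by (intro tendsto_mult tendsto_const) real_asymp
    ultimately have "x0 \<le> K * K2 ^ 2 * 0"
      by (intro tendsto_lowerbound[OF _ _ trivial_limit_at_left_real])
    then show False using x0_pos by simp
  next
    case False
    obtain r where r: "r > 0" "ball (of_real q0) r \<subseteq> S" "inj_on Z (ball (of_real q0) r)"
      using has_complex_derivative_locally_injective[OF holZ q0S openS False] by metis
    have holZr: "Z holomorphic_on ball (of_real q0) r" by (rule holomorphic_on_subset[OF holZ r(2)])
    obtain g where g: "g holomorphic_on Z ` ball (of_real q0) r" "\<And>z. z \<in> ball (of_real q0) r \<Longrightarrow> g (Z z) = z"
      using holomorphic_has_inverse[OF holZr _ r(3)] by (metis open_ball)
    define T where "T = Z ` ball (complex_of_real q0) r"
    have openT: "open T" unfolding T_def by (rule open_mapping_thm3[OF holZr _ r(3)]) simp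
    have x0T: "of_real x0 \<in> T" unfolding T_def using Zq0 r(1) by (intro image_eqI[of _ _ "of_real q0"]) auto
    have gx0: "g (of_real x0) = of_real q0" using g(2)[of "of_real q0"] r(1) by (simp add: Zq0)
    have holw: "(\<lambda>z. g z / z) holomorphic_on (T - {0})"
      using g(1) by (intro holomorphic_intros) (auto simp: T_def intro: holomorphic_on_subset)
    \<comment> \<open>On \<open>T'\<close> the principal branch of the logarithm is holomorphic along \<open>g z / z\<close>.\<close>
    define T' where "T' = (T - {0}) \<inter> (\<lambda>z. g z / z) -` {w. Re w > 0}"
    have "open T'" unfolding T'_def
      using holomorphic_on_imp_continuous_on[OF holw] openT
      by (intro continuous_open_preimage open_halfspace_Re_gt) (auto simp: open_delete)
    moreover have "of_real x0 \<in> T'"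
    proof -
      have "g (of_real x0) / of_real x0 = complex_of_real (q0 / x0)" using gx0 by simp
      moreover have "Re (complex_of_real (q0 / x0)) > 0" using q0_pos x0_pos by simp
      ultimately show ?thesis using x0T x0_pos by (simp add: T'_def)
    qed
    ultimately obtain e0 where e0: "e0 > 0" "ball (of_real x0) e0 \<subseteq> T'" by (auto simp: open_contains_ball)
    have holh: "(\<lambda>z. Ln (g z / z)) holomorphic_on ball (of_real x0) e0"
    proof (rule holomorphic_on_Ln')
      show "(\<lambda>z. g z / z) holomorphic_on ball (of_real x0) e0"
        by (rule holomorphic_on_subset[OF holw]) (use e0 in \<open>auto simp: T'_def\<close>)
      show "g z / z \<notin> \<real>\<^sub>\<le>\<^sub>0" if "z \<in> ball (of_real x0) e0" for z
        using e0(2) that by (auto simp: T'_def complex_nonpos_Reals_iff)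
    qed
    have "\<forall>\<^sub>F y in at_left 1. dist (complex_of_real (eval_fps q (x0 * y))) (of_real q0) < r"
      using lim r(1) by (rule tendstoD)
    then obtain y0 where y0: "y0 < 1"
      "\<And>y. y0 < y \<Longrightarrow> y < 1 \<Longrightarrow> dist (complex_of_real (eval_fps q (x0 * y))) (of_real q0) < r"
      unfolding eventually_at_left_field by auto
    define e where "e = min e0 (x0 * (1 - y0))"
    have "fps_conv_radius h > ereal x0"
    proof (rule vivanti_pringsheim[OF h_nonneg x0_pos conv_h])
      show "e > 0" using e0 x0_pos y0 by (simp add: e_def)
      show "(\<lambda>z. Ln (g z / z)) holomorphic_on ball (complex_of_real x0) e"
        by (rule holomorphic_on_subset[OF holh]) (auto simp: e_def)
      fix x assume x: "x0 - e < x" "0 < x" "x < x0"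
      define y where "y = x / x0"
      have xy: "x = x0 * y" using x0_pos by (simp add: y_def)
      have "x0 * y0 < x0 * y" using x(1) by (simp add: e_def xy algebra_simps min_def split: if_splits)
      then have y: "y0 < y" "0 \<le> y" "y < 1" using x x0_pos by (auto simp: xy mult_less_cancel_left_pos zero_less_mult_iff)
      have "g (Z (of_real (eval_fps q x))) = of_real (eval_fps q x)"
        using y0(2)[OF y(1,3)] by (intro g(2)) (simp add: xy dist_commute)
      then have "g (of_real x) = of_real (eval_fps q x)" using Zq[OF y(2,3)] by (simp add: xy)
      then have "g (of_real x) / of_real x = of_real (exp (eval_fps h x))"
        using eval_q[of x] x by simp
      then show "Ln (g (of_real x) / of_real x) = of_real (eval_fps h x)"
        by (simp add: Ln_of_real del: of_real_exp exp_of_real)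
    qed
    then obtain t where t: "ereal x0 < ereal t" "ereal t < fps_conv_radius h"
      using ereal_dense2 by blast
    have "H \<longlonglongrightarrow> (\<Sum>n. fps_nth h n * x0 ^ n)"
    proof (rule convolution_quotient_tendsto)
      show "b n > 0" for n by (rule b_pos)
      show "b (Suc n) = b n * bratio A n" for n by (simp add: b_def bcoef_Suc)
      show "bratio A \<longlonglongrightarrow> 1" by (rule bratio_tendsto)
      show "fps_nth h n * x0 ^ n \<ge> 0" for n by (rule h_term_nonneg)
      show "t / x0 > 1" using t x0_pos by simp
      have "summable (\<lambda>n. fps_nth h n * t ^ n)" using t x0_pos by (intro summable_fps) simp
      then show "summable (\<lambda>n. fps_nth h n * x0 ^ n * (t / x0) ^ n)" using x0_pos by (simp add: power_divide)
      show "H n * b n = (\<Sum>j\<le>n. fps_nth h j * x0 ^ j * b (n - j))" for n by (rule h_convolution)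
    qed
    then have "L = h1" using H_tendsto LIMSEQ_unique by (auto simp: h1_def eval_fps_def)
    then show False using h1_less by simp
  qed
qed

end


section \<open>The exceptional case of a single square root\<close>

text \<open>
  For \<open>Ns = [2]\<close> the series \<open>F\<close> is \<open>(1 - 4x)\<^bsup>-1/2\<^esup>\<close> and \<open>1 + x h' = F\<close>. With \<open>s = 1 / F\<close> this integrates to
  \<open>exp h = 4 / (1 + s)\<^sup>2\<close>, that is \<open>q = x (1 + q)\<^sup>2\<close>.
\<close>

lemma mirror_map_2: "mirror_map [2] * (1 + fps_X) ^ 2 = fps_X"
proof -
  define B where "B = B_of [2]"
  define H where "H = H_of [2]"
  define F where "F = F_of [2]"
  define G where "G = G_of [2]"
  have tot: "totatives 2 = {1}" by (auto simp: totatives_prime)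
  have C: "C1 2 = 4"
    by (simp add: C1_def prime_factorization_prime totient_prime)
  have Bm: "B m = 4 ^ m * (pochhammer (1 / 2) m / fact m)" for m
    by (simp add: B_def B_of_def B1_def tot C)
  have Hm: "H m = harm_shift (1 / 2) m - harm_shift 1 m" for m
    by (simp add: H_def H_of_def H1_def tot totient_prime)
  have Bs: "real (Suc m) * B (Suc m) = (4 * real m + 2) * B m" for m
  proof -
    have "real (Suc m) * B (Suc m) = 4 ^ Suc m * pochhammer (1 / 2) (Suc m) / fact m"
      unfolding Bm fact_Suc by (simp del: of_nat_Suc power_Suc)
    also have "\<dots> = (4 * real m + 2) * B m"
      unfolding Bm by (simp add: pochhammer_Suc algebra_simps add_divide_distrib)
    finally show ?thesis .
  qed
  have Hs: "H (Suc m) = H m + 1 / (1 / 2 + real m) - 1 / (1 + real m)" for m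
    unfolding Hm by (simp add: harm_shift_def)
  have Fn: "fps_nth F m = B m" for m by (simp add: F_def F_of_def B_def)
  have Gn: "fps_nth G m = H m * B m" for m
    by (simp add: G_def G_of_def B_def H_def H_of_def H1_def harm_shift_def)
  have F0: "fps_nth F 0 = 1" by (simp add: F_def)
  have E1: "(1 - 4 * fps_X) * fps_deriv F = 2 * F"
  proof (rule fps_ext)
    fix m
    show "fps_nth ((1 - 4 * fps_X) * fps_deriv F) m = fps_nth (2 * F) m"
    proof (cases m)
      case 0
      then show ?thesis using Bs[of 0] by (simp add: Fn fps_numeral_fps_const algebra_simps)
    next
      case (Suc k)
      then show ?thesis using Bs[of m]
        by (simp add: Fn fps_numeral_fps_const algebra_simps)
    qed
  qed
  have E2: "(1 - 4 * fps_X) * (F + fps_X * fps_deriv G) - 2 * fps_X * G = 1"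
  proof (rule fps_ext)
    fix m
    show "fps_nth ((1 - 4 * fps_X) * (F + fps_X * fps_deriv G) - 2 * fps_X * G) m = fps_nth 1 m"
    proof (cases m)
      case 0
      then show ?thesis using F0 by (simp add: algebra_simps fps_numeral_fps_const)
    next
      case (Suc k)
      have nz: "1 / 2 + real k \<noteq> 0" by linarith
      have "fps_nth ((1 - 4 * fps_X) * (F + fps_X * fps_deriv G) - 2 * fps_X * G) (Suc k)
         = (B (Suc k) + real (Suc k) * (H (Suc k) * B (Suc k)))
           - 4 * (B k + real k * (H k * B k)) - 2 * (H k * B k)"
      proof -
        have "(1 - 4 * fps_X) * (F + fps_X * fps_deriv G) - 2 * fps_X * G
            = (F + fps_X * fps_deriv G) - fps_const 4 * (fps_X * (F + fps_X * fps_deriv G)) - fps_const 2 * (fps_X * G)"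
          by (simp add: fps_numeral_fps_const algebra_simps)
        then show ?thesis by (cases k) (simp_all add: Fn Gn fps_X_mult_nth)
      qed
      also have "\<dots> = B (Suc k) * (1 + real (Suc k) * (H (Suc k) - H k)) - 4 * B k
            + (real (Suc k) * B (Suc k) - (4 * real k + 2) * B k) * H k"
        by (simp add: algebra_simps)
      also have "\<dots> = B (Suc k) * (1 + real (Suc k) * (H (Suc k) - H k)) - 4 * B k"
        using Bs[of k] by simp
      also have "1 + real (Suc k) * (H (Suc k) - H k) = real (Suc k) / (1 / 2 + real k)"
        unfolding Hs using nz by (simp add: right_diff_distrib add.commute)
      also have "B (Suc k) * (real (Suc k) / (1 / 2 + real k)) = 4 * B k"
      proof -
        have "B (Suc k) * (real (Suc k) / (1 / 2 + real k)) = (4 * real k + 2) * B k / (1 / 2 + real k)"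
          using Bs[of k] by (simp add: mult.commute)
        also have "(4 * real k + 2) * B k = 4 * B k * (1 / 2 + real k)" by (simp add: algebra_simps)
        finally show ?thesis using nz by simp
      qed
      finally show ?thesis using Suc by simp
    qed
  qed
  have FF: "F ^ 2 * (1 - 4 * fps_X) = 1"
  proof -
    have "fps_deriv (F ^ 2 * (1 - 4 * fps_X)) = 2 * F * ((1 - 4 * fps_X) * fps_deriv F) - 4 * F ^ 2"
      by (simp add: fps_deriv_power' power2_eq_square algebra_simps)
    also have "\<dots> = 0" unfolding E1 by (simp add: power2_eq_square algebra_simps)
    finally have "F ^ 2 * (1 - 4 * fps_X) = fps_const (fps_nth (F ^ 2 * (1 - 4 * fps_X)) 0)"
      by (simp only: fps_deriv_eq_0_iff)
    then show ?thesis using F0 by (simp add: fps_nth_power_0)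
  qed
  define h where "h = G / F"
  have Gh: "G = h * F" unfolding h_def using F0 by (simp add: fps_divide_unit inverse_mult_eq_1 mult.assoc)
  have nz: "(1 - 4 * fps_X) * F \<noteq> 0" using FF by (metis mult.commute mult_zero_left mult.assoc power2_eq_square zero_neq_one)
  have h': "1 + fps_X * fps_deriv h = F"
  proof -
    have "1 = (1 - 4 * fps_X) * (F + fps_X * fps_deriv G) - 2 * fps_X * G" by (rule E2[symmetric])
    also have "\<dots> = (1 - 4 * fps_X) * F * (1 + fps_X * fps_deriv h)
        + fps_X * h * ((1 - 4 * fps_X) * fps_deriv F) - 2 * fps_X * (h * F)"
      unfolding Gh by (simp add: algebra_simps)
    also have "\<dots> = (1 - 4 * fps_X) * F * (1 + fps_X * fps_deriv h)"
      unfolding E1 by (simp add: algebra_simps)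
    finally have "(1 - 4 * fps_X) * F * (1 + fps_X * fps_deriv h) = (1 - 4 * fps_X) * F * F"
      using FF by (simp add: power2_eq_square mult_ac)
    then show ?thesis using nz mult_left_cancel by blast
  qed
  define ex where "ex = fps_exp 1 oo h"
  have h0: "fps_nth h 0 = 0" by (simp add: h_def G_def F_def)
  have ex': "fps_deriv ex = ex * fps_deriv h" unfolding ex_def using h0 by (simp add: fps_compose_deriv)
  have q: "canonical_coord [2] = fps_X * ex" by (simp add: canonical_coord_def ex_def h_def G_def F_def)
  define s where "s = (1 - 4 * fps_X) * F"
  have s': "fps_deriv s = - 2 * F"
    unfolding s_def using E1 by (simp add: algebra_simps)
  have sF: "s * F = 1" using FF by (simp add: s_def power2_eq_square mult_ac)
  have ss: "s * s = 1 - 4 * fps_X"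
    using FF unfolding s_def by (metis (no_types, lifting) mult.assoc mult.commute mult_1_right power2_eq_square)
  have W: "ex * (1 + s) ^ 2 = 4"
  proof -
    have "fps_X * fps_deriv (ex * (1 + s) ^ 2)
        = ex * (1 + s) * ((fps_X * fps_deriv h) * (1 + s) - 4 * fps_X * F)"
      by (simp add: ex' s' power2_eq_square algebra_simps)
    also have "fps_X * fps_deriv h = F - 1" using h' by (simp add: algebra_simps)
    also have "(F - 1) * (1 + s) - 4 * fps_X * F = s * F - 1 + (F - s - 4 * fps_X * F)"
      by (simp add: algebra_simps)
    also have "\<dots> = 0" unfolding sF by (simp add: s_def algebra_simps)
    finally have "fps_deriv (ex * (1 + s) ^ 2) = 0" by simp
    then have "ex * (1 + s) ^ 2 = fps_const (fps_nth (ex * (1 + s) ^ 2) 0)" by (simp only: fps_deriv_eq_0_iff)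
    also have "fps_nth (ex * (1 + s) ^ 2) 0 = 4"
      using F0 by (simp add: ex_def s_def fps_nth_power_0)
    finally show ?thesis by (simp add: fps_numeral_fps_const)
  qed
  have s0: "1 + s \<noteq> 0"
  proof
    assume "1 + s = 0"
    then have "fps_nth (1 + s) 0 = 0" by simp
    then show False using F0 by (simp add: s_def)
  qed
  have "fps_X * ex * (1 + s) * (1 + s) = (1 - s) * (1 + s)"
  proof -
    have "fps_X * ex * (1 + s) * (1 + s) = fps_X * (ex * (1 + s) ^ 2)" by (simp add: power2_eq_square mult_ac)
    also have "\<dots> = 1 - s * s" unfolding W ss by (simp add: mult.commute)
    finally show ?thesis by (simp add: algebra_simps)
  qed
  then have "fps_X * ex * (1 + s) = 1 - s" using s0 by simp
  then have "(1 + fps_X * ex) * (1 + s) = 2" by (simp add: algebra_simps)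
  then have "(1 + fps_X * ex) ^ 2 * (1 + s) ^ 2 = 2 ^ 2" by (simp only: power_mult_distrib[symmetric])
  also have "\<dots> = ex * (1 + s) ^ 2" using W by simp
  finally have "ex = (1 + fps_X * ex) ^ 2" using s0 by simp
  then have fe: "canonical_coord [2] = fps_X * (1 + canonical_coord [2]) ^ 2" unfolding q by simp
  have m0: "fps_nth (mirror_map [2]) 0 = 0" by (rule mirror_map_nth_0)
  have "fps_X = canonical_coord [2] oo mirror_map [2]" by (rule mirror_map_inverse(2)[symmetric])
  also have "\<dots> = (fps_X * (1 + canonical_coord [2]) ^ 2) oo mirror_map [2]"
    by (rule arg_cong[OF fe, where f = "\<lambda>x. x oo mirror_map [2]"])
  also have "\<dots> = mirror_map [2] * (1 + (canonical_coord [2] oo mirror_map [2])) ^ 2"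
    by (simp add: fps_compose_mult_distrib[OF m0] fps_compose_power[OF m0, symmetric] fps_compose_add_distrib
          fps_X_fps_compose_startby0[OF m0])
  finally show ?thesis by (simp add: mirror_map_inverse(2))
qed

text \<open>
  Evaluating the functional equation at \<open>-1\<close> would give \<open>0 = -1\<close>.
\<close>

lemma conv_radius_mirror_map_2: "fps_conv_radius (mirror_map [2]) \<le> 1"
proof (rule ccontr)
  assume "\<not> ?thesis"
  then have R: "ereal (norm (-1 :: real)) < fps_conv_radius (mirror_map [2])" by (simp add: one_ereal_def)
  have "(1 + fps_X :: real fps) = fps_of_poly [:1, 1:]" by (simp add: fps_of_poly_pCons)
  then have poly: "(1 + fps_X :: real fps) ^ 2 = fps_of_poly ([:1, 1:] ^ 2)" by (simp add: fps_of_poly_power)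
  have "eval_fps (mirror_map [2] * (1 + fps_X) ^ 2) (-1) = eval_fps (mirror_map [2]) (-1) * poly ([:1, 1:] ^ 2) (-1)"
    unfolding poly using R by (subst eval_fps_mult) auto
  then show False unfolding mirror_map_2 by simp
qed


section \<open>The bounds on the radius of convergence\<close>

text \<open>
  For \<open>M \<ge> 3\<close> both \<open>1\<close> and \<open>M - 1\<close> are coprime to \<open>M\<close> and distinct. For \<open>M = 2\<close> all entries equal \<open>2\<close>, and
  two of them are needed.
\<close>

lemma pair_subset_params:
  assumes "Ns \<noteq> []" "\<And>N. N \<in> set Ns \<Longrightarrow> N \<ge> 2" "Ns \<noteq> [2]"
  shows "{#1 / real (M_of Ns), 1 - 1 / real (M_of Ns)#} \<subseteq># params Ns"
proof -
  define M where "M = M_of Ns"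
  have M: "M \<in> set Ns" unfolding M_def M_of_def using assms(1) by (intro Max_in) auto
  have Mmax: "N \<le> M" if "N \<in> set Ns" for N unfolding M_def M_of_def using that by simp
  have M2: "M \<ge> 2" using M assms(2) by blast
  have mem: "image_mset (\<lambda>r. real r / real N) (mset_set (totatives N)) \<subseteq># params Ns" if "N \<in> set Ns" for N Ns
    using that
  proof (induction Ns)
    case (Cons K Ns)
    show ?case
    proof (cases "N \<in> set Ns")
      case True
      have "params Ns \<subseteq># params (K # Ns)" by (simp add: params_Cons)
      with Cons.IH[OF True] show ?thesis by (rule subset_mset.order_trans)
    next
      case False
      then show ?thesis using Cons.prems by (simp add: params_Cons)
    qed
  qed simp
  show ?thesis
  proof (cases "M = 2")
    case True
    have all2: "N = 2" if "N \<in> set Ns" for N using Mmax[OF that] assms(2)[OF that] True by simp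
    obtain x xs where Ns: "Ns = x # xs" using assms(1) by (cases Ns) auto
    have x: "x = 2" using all2 Ns by simp
    then have "xs \<noteq> []" using assms(3) Ns by auto
    then obtain y ys where xs: "xs = y # ys" by (cases xs) auto
    have y: "y = 2" using all2 Ns xs by simp
    have tot: "totatives 2 = {1}" by (auto simp: totatives_prime)
    have "params Ns = {#1 / 2, 1 / 2#} + params ys"
      unfolding Ns xs x y params_Cons tot by simp
    then show ?thesis using True by (simp add: M_def)
  next
    case False
    then have M3: "M \<ge> 3" using M2 by simp
    have sub: "{1, M - 1} \<subseteq> totatives M" using M3 minus_one_in_totatives[of M] by simp
    have "mset_set {1, M - 1} \<subseteq># mset_set (totatives M)"
      by (rule subset_imp_msubset_mset_set[OF sub]) simp
    then have "image_mset (\<lambda>r. real r / real M) (mset_set {1, M - 1})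
        \<subseteq># image_mset (\<lambda>r. real r / real M) (mset_set (totatives M))"
      by (rule image_mset_subseteq_mono)
    also have "\<dots> \<subseteq># params Ns" by (rule mem[OF M])
    also have "image_mset (\<lambda>r. real r / real M) (mset_set {1, M - 1}) = {#1 / real M, 1 - 1 / real M#}"
      using M3 by (simp add: of_nat_diff diff_divide_distrib)
    finally show ?thesis by (simp add: M_def)
  qed
qed

theorem theorem1p4:
  fixes Ns :: "nat list"
  assumes "length Ns \<ge> 1"
    and "\<And>N. N \<in> set Ns \<Longrightarrow> N \<ge> 2"
  shows "fps_conv_radius (mirror_map Ns) \<le> ereal (exp (- pi * cot (pi / real (M_of Ns))))
       \<and> (Phi_of Ns \<ge> 4 \<longrightarrow>
            fps_conv_radius (mirror_map Ns)
              \<le> ereal (eval_fps (canonical_coord Ns) (1 / real (C_of Ns))))"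
proof (intro conjI impI)
  have ne: "Ns \<noteq> []" using assms(1) by auto
  show "fps_conv_radius (mirror_map Ns) \<le> ereal (exp (- pi * cot (pi / real (M_of Ns))))"
  proof (cases "Ns = [2]")
    case True
    then show ?thesis using conv_radius_mirror_map_2 by (simp add: M_of_def cot_def one_ereal_def)
  next
    case False
    define a where "a = 1 / real (M_of Ns)"
    have "M_of Ns \<in> set Ns" unfolding M_of_def using ne by (intro Max_in) auto
    then have "M_of Ns \<ge> 2" using assms(2) by blast
    then have a: "0 < a" "a \<le> 1 / 2" by (auto simp: a_def divide_simps)
    obtain A where A: "params Ns = {#a, 1 - a#} + A"
      using pair_subset_params[OF ne assms(2) False] unfolding a_def by (metis mset_subset_eq_exists_conv)
    have "a \<le> b \<and> b < 1" if "b \<in># A" for b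
      using params_range[of Ns b] assms(2) that by (auto simp: A a_def)
    from exists_log_mean_le_measure[OF a this] obtain \<mu>
      where "mellin_rep \<mu> (params Ns) a" "log_mean_le \<mu> (- pi * cot (pi * a))"
      by (auto simp: A)
    from conv_radius_mirror_le_of_log_mean[OF assms(2) this]
    show ?thesis by (simp add: a_def)
  qed
next
  assume Phi: "Phi_of Ns \<ge> 4"
  interpret mirror_data Ns "params Ns" "bcoef (params Ns)" "hcoef (params Ns)" "real (C_of Ns)"
    "ln (real (C_of Ns))" "1 / real (C_of Ns)" "F_of Ns" "G_of Ns" "G_of Ns / F_of Ns" "canonical_coord Ns"
    by unfold_locales (use assms Phi in auto)
  show "fps_conv_radius (mirror_map Ns) \<le> ereal (eval_fps (canonical_coord Ns) (1 / real (C_of Ns)))"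
    using conv_radius_mirror_le_q0 by (simp only: q0_def)
qed

end
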